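(* Let $A\subset K$ be a closed convex set. Let $1\le p<+\infty$. For every $f\in\mathcal F_p$, \[ \frac1{\mu(A)}\int_A\Big|f(x)-\frac1{\mu(A)}\int_Af\,d\mu\Big|^p d\mu(x)\le \mathrm{diam}(A)^{p-1}\,\mathcal E_{A,p}(f). \] In particular, there is a constant $C>0$ (independent of $f$, $x_0$, $r$) such that for any ball $B(x_0,r)\subset K$ and every $f\in\mathcal F_p$, \[ \int_{B(x_0,r)}\Big|f(x)-\frac1{\mu(B(x_0,r))}\int_{B(x_0,r)}f\,d\mu\Big|^p d\mu(x)\le C\,r^{p\alpha_p}\,\mathcal E_{B(x_0,r),p}(f). \]
   Context: Vicsek set. In $\mathbb R^2$ let $q_1=(-\sqrt2/2,\sqrt2/2)$, $q_2=(\sqrt2/2,\sqrt2/2)$, $q_3=(\sqrt2/2,-\sqrt2/2)$, $q_4=(-\sqrt2/2,-\sqrt2/2)$, $q_5=(0,0)$ and $\psi_i(z)=\frac13(z-q_i)+q_i$, $1\le i\le5$. $K$ is the unique non-empty compact set with $K=\bigcup_{i=1}^5\psi_i(K)$, and $C(K)$ is the set of continuous real functions on $K$. Cable systems. $V_0=\{q_1,\dots,q_5\}$, $\bar V_0$ is the union of the four segments (edges) $[q_5,q_i]$, $1\le i\le4$; $V_{n+1}=\bigcup_i\psi_i(V_n)$, $\bar V_{n+1}=\bigcup_i\psi_i(\bar V_n)$. The edges of $\bar V_n$ are the images of the edges of $\bar V_0$ under the maps $\psi_{i_1}\circ\cdots\circ\psi_{i_n}$; they have length $3^{-n}$, and $\bar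 V_n$ is a tree with vertex set $V_n$. Vertices $u,v\in V_n$ are adjacent, $u\sim v$, if they are joined by an edge of $\bar V_n$. The skeleton is $\mathcal S=\bigcup_n\bar V_n$, which is dense in $K$. $d$ is the geodesic distance: for $x,y\in\bar V_n$, $d(x,y)$ is the length of the geodesic path in $\bar V_n$ from $x$ to $y$, extended by continuity to $K\times K$; $\mathrm{diam}$ is taken with respect to $d$, and $B(x,r)=\{y\in K:d(x,y)\le r\}$, $x\in K$, $r>0$. $\mu$ is the normalized Hausdorff measure, i.e. the Borel probability measure on $K$ with $\mu(\psi_{i_1}\circ\cdots\circ\psi_{i_n}(K))=5^{-n}$; $d_h=\log5/\log3$ and $\alpha_p=1-\frac1p+\frac{d_h}p$. The averages over $A$ are understood for $\mu(A)>0$. A subset $A\subset K$ is called convex if for any two points $x,y\in A\cap\mathcal S$ the geodesic path connecting $x$ to $y$ is included in $A\cap\mathcal S$; any ball $B(x_0,r)$ is convex. For $f\in C(K)$, $A\subset K$, $m\ge0$: $\mathcal E_{A,p}^m(f)=\frac12 3^{(p-1)m}\sum_{x,y\in A\cap V_m,\,x\sim y}|f(x)-f(y)|^p$ (sum over ordered pairs, adjacency in $V_m$), $\mathcal E_p^m=\mathcal E_{K,p}^m$. For convex $A$ the sequence $m\mapsto\mathcal E^m_{A,p}(f)$ is non-decreasing and $\mathcal E_{A,p}(f)=\lim_{m\to\infty}\mathcal E_{A,p}^m(f)\in[0,+\infty]$. $\mathcal F_p=\{f\in C(K):\sup_{m\ge0}\mathcal E_p^m(f)<+\infty\}$.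
   Formalization: In the first part A is also assumed to lie in the closure of A∩𝒮; otherwise a compact A⊂K∖𝒮 with μ(A)>0 is vacuously convex with zero energy and the inequality fails. Balls satisfy this, so the second part is unchanged. *)

theory Defs
  imports "HOL-Probability.Probability"
begin

section \<open>The Vicsek set\<close>

definition vq :: "nat \<Rightarrow> real \<times> real" where
  "vq i = (if i = 1 then (- sqrt 2 / 2, sqrt 2 / 2)
      else if i = 2 then (sqrt 2 / 2, sqrt 2 / 2)
      else if i = 3 then (sqrt 2 / 2, - sqrt 2 / 2)
      else if i = 4 then (- sqrt 2 / 2, - sqrt 2 / 2)
      else (0, 0))"

definition vpsi :: "nat \<Rightarrow> real \<times> real \<Rightarrow> real \<times> real" where
  "vpsi i z = (1/3) *\<^sub>R (z - vq i) + vq i"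

definition vicsek :: "(real \<times> real) set" where
  "vicsek = (THE K. compact K \<and> K \<noteq> {} \<and> K = (\<Union>i\<in>{1..5}. vpsi i ` K))"

text \<open>For a word \<open>w = [i1, ..., in]\<close>, \<open>foldr vpsi w\<close> is the composition
  \<open>vpsi i1 \<circ> ... \<circ> vpsi in\<close>.\<close>

definition vwords :: "nat \<Rightarrow> nat list set" where
  "vwords n = {w. length w = n \<and> set w \<subseteq> {1..5}}"

text \<open>The Borel probability measure on the Vicsek set (a measure whose space is the set itself)
  giving mass \<open>5^(-n)\<close> to each cell of level \<open>n\<close>; it exists and is unique.\<close>

definition is_vicsek_measure :: "(real \<times> real) measure \<Rightarrow> bool" where
  "is_vicsek_measure M \<longleftrightarrow>
     prob_space M \<and> sets M = sets (restrict_space borel vicsek) \<and>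
     (\<forall>n. \<forall>w\<in>vwords n. measure M (foldr vpsi w ` vicsek) = 1 / 5 ^ n)"

section \<open>Cable systems and skeleton\<close>

fun vvert :: "nat \<Rightarrow> (real \<times> real) set" where
  "vvert 0 = vq ` {1..5}"
| "vvert (Suc n) = (\<Union>i\<in>{1..5}. vpsi i ` vvert n)"

fun vcable :: "nat \<Rightarrow> (real \<times> real) set" where
  "vcable 0 = (\<Union>i\<in>{1..4}. closed_segment (vq 5) (vq i))"
| "vcable (Suc n) = (\<Union>i\<in>{1..5}. vpsi i ` vcable n)"

text \<open>The maps \<open>vpsi\<close> are affine, so an edge of level \<open>n\<close> is the segment joining the images
  of the end points of an edge of level \<open>0\<close>.\<close>

definition vadj :: "nat \<Rightarrow> real \<times> real \<Rightarrow> real \<times> real \<Rightarrow> bool" where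
  "vadj n x y \<longleftrightarrow>
     (\<exists>w\<in>vwords n. \<exists>i\<in>{1..4}. {x, y} = {foldr vpsi w (vq 5), foldr vpsi w (vq i)})"

definition vskeleton :: "(real \<times> real) set" where
  "vskeleton = (\<Union>n. vcable n)"

section \<open>Geodesics and geodesic distance\<close>

text \<open>Length of a curve \<open>[0,1] \<rightarrow> \<real>\<^sup>2\<close>: supremum of the lengths of inscribed polygons.\<close>

definition curve_length :: "(real \<Rightarrow> real \<times> real) \<Rightarrow> ereal" where
  "curve_length g =
     (SUP (n, t) \<in> {(n :: nat, t :: nat \<Rightarrow> real). mono t \<and> range t \<subseteq> {0..1}}.
        ereal (\<Sum>i<n. dist (g (t i)) (g (t (Suc i)))))"

definition joins_in :: "(real \<times> real) set \<Rightarrow> real \<times> real \<Rightarrow> real \<times> real \<Rightarrow>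
    (real \<Rightarrow> real \<times> real) \<Rightarrow> bool" where
  "joins_in X x y g \<longleftrightarrow>
     path g \<and> path_image g \<subseteq> X \<and> pathstart g = x \<and> pathfinish g = y"

definition geodesic_in :: "(real \<times> real) set \<Rightarrow> real \<times> real \<Rightarrow> real \<times> real \<Rightarrow>
    (real \<Rightarrow> real \<times> real) \<Rightarrow> bool" where
  "geodesic_in X x y g \<longleftrightarrow>
     joins_in X x y g \<and> (\<forall>h. joins_in X x y h \<longrightarrow> curve_length g \<le> curve_length h)"

text \<open>Since every cable system is a tree contained in the next one, the geodesic between two
  points of the skeleton (up to parametrization) does not depend on the level.\<close>

definition skeleton_dist :: "real \<times> real \<Rightarrow> real \<times> real \<Rightarrow> real" where
  "skeleton_dist x y =
     real_of_ereal (THE l. \<exists>n g. geodesic_in (vcable n) x y g \<and> l = curve_length g)"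

text \<open>Extension by continuity to pairs of points of the Vicsek set.\<close>

definition vdist :: "real \<times> real \<Rightarrow> real \<times> real \<Rightarrow> real" where
  "vdist x y =
     Lim (at (x, y) within vskeleton \<times> vskeleton) (\<lambda>(u, v). skeleton_dist u v)"

definition vdiam :: "(real \<times> real) set \<Rightarrow> real" where
  "vdiam A = (SUP (x, y) \<in> A \<times> A. vdist x y)"

definition vball :: "real \<times> real \<Rightarrow> real \<Rightarrow> (real \<times> real) set" where
  "vball x r = {y \<in> vicsek. vdist x y \<le> r}"

text \<open>Only the points of the skeleton are constrained: a subset of the Vicsek set disjoint from the
  skeleton is vacuously convex, although the skeleton is a null set. Statements comparing integrals
  over a convex set \<open>A\<close> with its energy, which only sees \<open>A \<inter> vskeleton\<close>, therefore also need
  \<open>A \<inter> vskeleton\<close> to be dense in \<open>A\<close>.\<close>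

definition geodesically_convex :: "(real \<times> real) set \<Rightarrow> bool" where
  "geodesically_convex A \<longleftrightarrow>
     A \<subseteq> vicsek \<and>
     (\<forall>x \<in> A \<inter> vskeleton. \<forall>y \<in> A \<inter> vskeleton. \<forall>n g.
        geodesic_in (vcable n) x y g \<longrightarrow> path_image g \<subseteq> A \<inter> vskeleton)"

section \<open>Energies\<close>

definition venergy_m :: "nat \<Rightarrow> real \<Rightarrow> (real \<times> real) set \<Rightarrow> (real \<times> real \<Rightarrow> real) \<Rightarrow> real" where
  "venergy_m m p A f =
     1/2 * 3 powr ((p - 1) * real m) *
       (\<Sum>(x, y) \<in> {(x, y). x \<in> A \<inter> vvert m \<and> y \<in> A \<inter> vvert m \<and> vadj m x y}.
          \<bar>f x - f y\<bar> powr p)"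

definition venergy :: "real \<Rightarrow> (real \<times> real) set \<Rightarrow> (real \<times> real \<Rightarrow> real) \<Rightarrow> ereal" where
  "venergy p A f = lim (\<lambda>m. ereal (venergy_m m p A f))"

definition vsobolev :: "real \<Rightarrow> (real \<times> real \<Rightarrow> real) set" where
  "vsobolev p =
     {f. continuous_on vicsek f \<and> (SUP m. ereal (venergy_m m p vicsek f)) < \<infinity>}"

section \<open>Averages and exponents\<close>

definition vavg ::
    "(real \<times> real) measure \<Rightarrow> (real \<times> real) set \<Rightarrow> (real \<times> real \<Rightarrow> real) \<Rightarrow> real" where
  "vavg M A f = 1 / measure M A * (LINT x:A|M. f x)"

definition vdh :: real where
  "vdh = ln 5 / ln 3"

definition valpha :: "real \<Rightarrow> real" where
  "valpha p = 1 - 1 / p + vdh / p"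

end

theory Submission
  imports Defs
begin

text \<open>Each cable system is a finite union of segments glued at single points, hence a tree: any
  two of its points are joined by a polygonal arc that every connecting path has to cover in order,
  so the arc is the geodesic. Geodesic distances therefore agree on all levels, scale by \<open>1/3\<close>
  under the contractions and are additive along the joints \<open>vjoint i\<close>. Being at most ten times the
  Euclidean distance, they extend continuously to the Vicsek set.

  For a convex \<open>A\<close>, a geodesic between two vertices of level \<open>m\<close> in \<open>A\<close> is a chain of edges in \<open>A\<close>,
  and the power mean inequality along it bounds \<open>\<bar>f u - f v\<bar> powr p\<close> by
  \<open>d u v powr (p - 1)\<close> times the energy of level \<open>m\<close>. Letting \<open>m\<close> grow and passing to the closure, the
  oscillation of \<open>f\<close> on \<open>A\<close>, and hence its deviation from the mean, is bounded pointwise by diameter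
  and energy. For balls it remains to see that they are convex (a tree has no
  geodesic leaving a ball), have dense skeleton, diameter at most \<open>2 * r\<close> and measure at most
  \<open>125 * r powr vdh\<close>; the last bound counts cells by means of their centers, which lie on a lattice.\<close>

section \<open>Curves and arcs in planar trees\<close>

text \<open>A geodesic competes with all continuous paths, including those of infinite length.
  \<open>tree_arc\<close> therefore isolates a topological property, being covered by every joining
  path, which survives one-point gluing and similarities; length enters afterwards, only through the
  break points of a polygonal arc. For upper bounds, \<open>rect_curve\<close> lets \<open>L\<close>
  bound the length through a Lipschitz condition, so that cutting and joining curves needs no length
  formula. The comparison with the Euclidean distance must not lose a factor at each level. The
  taxicab distance \<open>vl1\<close> achieves this: it obeys the same scaling and the same addition
  rule at the joints as the geodesic distance, so one constant serves all levels. The Euclidean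
  distance returns only at the end, through \<open>vl1 x y \<le> 2 * dist x y\<close>, which turns
  the constant 5 into ten.\<close>

definition rect_curve ::
    "(real \<times> real) set \<Rightarrow> real \<times> real \<Rightarrow> real \<times> real \<Rightarrow> real \<Rightarrow> (real \<Rightarrow> real \<times> real) \<Rightarrow> bool" where
  "rect_curve X x y L g \<longleftrightarrow>
     0 \<le> L \<and> g 0 = x \<and> g L = y \<and> g ` {0..L} \<subseteq> X \<and> 1-lipschitz_on {0..L} g"

text \<open>Only the break points are constrained: on each piece the chord is as long as the
  parameter interval, so the chords add up to the whole length. For a 1-Lipschitz curve this forces
  straight pieces run through at unit speed.\<close>

inductive polygonal :: "(real \<Rightarrow> real \<times> real) \<Rightarrow> real \<Rightarrow> real \<Rightarrow> bool" for g where
  segment: "a \<le> b \<Longrightarrow> dist (g a) (g b) = b - a \<Longrightarrow> polygonal g a b"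
| trans: "polygonal g a b \<Longrightarrow> polygonal g b c \<Longrightarrow> polygonal g a c"

text \<open>The covering clause stands in for uniqueness of arcs; together with injectivity it
  yields covering in order.\<close>

definition tree_arc ::
    "(real \<times> real) set \<Rightarrow> real \<times> real \<Rightarrow> real \<times> real \<Rightarrow> real \<Rightarrow> (real \<Rightarrow> real \<times> real) \<Rightarrow> bool" where
  "tree_arc X x y L g \<longleftrightarrow>
     rect_curve X x y L g \<and> inj_on g {0..L} \<and> polygonal g 0 L \<and>
     (\<forall>h. joins_in X x y h \<longrightarrow> g ` {0..L} \<subseteq> path_image h)"

definition is_tree :: "(real \<times> real) set \<Rightarrow> bool" where
  "is_tree X \<longleftrightarrow> (\<forall>x\<in>X. \<forall>y\<in>X. \<exists>L g. tree_arc X x y L g)"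

text \<open>An upper bound needs just one curve, and in a tree the infimum is attained
  (\<open>tdist_tree_arc\<close>). Unlike \<open>curve_length\<close>, the value is a real
  number.\<close>

definition tdist :: "(real \<times> real) set \<Rightarrow> real \<times> real \<Rightarrow> real \<times> real \<Rightarrow> real" where
  "tdist X x y = Inf {L. \<exists>g. rect_curve X x y L g}"

definition curve_cat ::
    "real \<Rightarrow> (real \<Rightarrow> real \<times> real) \<Rightarrow> (real \<Rightarrow> real \<times> real) \<Rightarrow> real \<Rightarrow> real \<times> real" where
  "curve_cat a g h t = (if t \<le> a then g t else h (t - a))"

lemma joins_in_endpoints: "joins_in X x y g \<Longrightarrow> x \<in> X \<and> y \<in> X"
  unfolding joins_in_def
  using pathstart_in_path_image pathfinish_in_path_image by blast

lemma joins_in_join: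
  assumes "joins_in X x y g" "joins_in X y z h"
  shows "joins_in X x z (g +++ h)" "path_image (g +++ h) = path_image g \<union> path_image h"
  using assms by (auto simp: joins_in_def path_image_join)

lemma joins_in_subpath:
  assumes "joins_in X x y h" "s \<in> {0..1}" "t \<in> {0..1}"
  shows "joins_in X (h s) (h t) (subpath s t h)"
  using assms path_image_subpath_subset[of s t h]
  by (auto simp: joins_in_def)

lemma joins_in_mono: "joins_in X x y h \<Longrightarrow> X \<subseteq> Y \<Longrightarrow> joins_in Y x y h"
  by (auto simp: joins_in_def)

lemma rect_curve_mono: "rect_curve X x y L g \<Longrightarrow> X \<subseteq> Y \<Longrightarrow> rect_curve Y x y L g"
  by (auto simp: rect_curve_def)

lemma rect_curve_endpoints: "rect_curve X x y L g \<Longrightarrow> x \<in> X \<and> y \<in> X"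
  by (auto simp: rect_curve_def)

lemma rect_curve_sub:
  assumes "rect_curve X x y L g" "0 \<le> a" "a \<le> b" "b \<le> L"
  shows "rect_curve X (g a) (g b) (b - a) (\<lambda>t. g (a + t))"
proof -
  have "1-lipschitz_on {0..b - a} (\<lambda>t. g (a + t))"
  proof (rule lipschitz_onI)
    fix s t assume "s \<in> {0..b - a}" "t \<in> {0..b - a}"
    then have "dist (g (a + s)) (g (a + t)) \<le> 1 * dist (a + s) (a + t)"
      using assms by (intro lipschitz_onD[of 1 "{0..L}" g]) (auto simp: rect_curve_def)
    then show "dist (g (a + s)) (g (a + t)) \<le> 1 * dist s t" by (simp add: dist_real_def)
  qed simp
  then show ?thesis using assms by (auto simp: rect_curve_def)
qed

lemma rect_curve_reverse:
  assumes "rect_curve X x y L g"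
  shows "rect_curve X y x L (\<lambda>t. g (L - t))"
proof -
  have "1-lipschitz_on {0..L} (\<lambda>t. g (L - t))"
  proof (rule lipschitz_onI)
    fix s t assume "s \<in> {0..L}" "t \<in> {0..L}"
    then have "dist (g (L - s)) (g (L - t)) \<le> 1 * dist (L - s) (L - t)"
      using assms by (intro lipschitz_onD[of 1 "{0..L}" g]) (auto simp: rect_curve_def)
    then show "dist (g (L - s)) (g (L - t)) \<le> 1 * dist s t" by (simp add: dist_real_def)
  qed simp
  then show ?thesis using assms by (auto simp: rect_curve_def)
qed

lemma curve_cat_image:
  assumes "0 \<le> a" "0 \<le> b" "g a = h 0"
  shows "curve_cat a g h ` {0..a + b} = g ` {0..a} \<union> h ` {0..b}"
proof -
  have "curve_cat a g h t \<in> g ` {0..a} \<union> h ` {0..b}" if "t \<in> {0..a + b}" for t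
    using that by (auto simp: curve_cat_def)
  moreover have "g t \<in> curve_cat a g h ` {0..a + b}" if "t \<in> {0..a}" for t
    using that assms by (intro image_eqI[of _ _ t]) (auto simp: curve_cat_def)
  moreover have "h t \<in> curve_cat a g h ` {0..a + b}" if "t \<in> {0..b}" for t
    using that assms by (intro image_eqI[of _ _ "t + a"]) (auto simp: curve_cat_def)
  ultimately show ?thesis by blast
qed

lemma rect_curve_cat:
  assumes "rect_curve X x y a g" "rect_curve X y z b h"
  shows "rect_curve X x z (a + b) (curve_cat a g h)"
proof -
  have "1-lipschitz_on {a..a + b} (\<lambda>t. h (t - a))"
  proof (rule lipschitz_onI)
    fix s t assume "s \<in> {a..a + b}" "t \<in> {a..a + b}"
    then have "dist (h (s - a)) (h (t - a)) \<le> 1 * dist (s - a) (t - a)"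
      using assms by (intro lipschitz_onD[of 1 "{0..b}" h]) (auto simp: rect_curve_def)
    then show "dist (h (s - a)) (h (t - a)) \<le> 1 * dist s t" by (simp add: dist_real_def)
  qed simp
  then have "1-lipschitz_on {0..a + b} (\<lambda>t. if t \<le> a then g t else h (t - a))"
    using assms by (intro lipschitz_on_concat) (auto simp: rect_curve_def)
  then have "1-lipschitz_on {0..a + b} (curve_cat a g h)"
    by (simp add: curve_cat_def[abs_def])
  then show ?thesis
    using assms curve_cat_image[of a b g h]
    by (auto simp: rect_curve_def curve_cat_def)
qed

lemma rect_curve_joins_in:
  assumes "rect_curve X x y L g"
  shows "joins_in X x y (\<lambda>t. g (L * t))" "path_image (\<lambda>t. g (L * t)) = g ` {0..L}"
proof -
  have L: "0 \<le> L" and cont: "continuous_on {0..L} g"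
    using assms by (auto simp: rect_curve_def intro: lipschitz_on_continuous_on)
  have im: "(\<lambda>t. L * t) ` {0..1} = {0..L}"
  proof (cases "L = 0")
    case False
    then show ?thesis using L image_mult_atLeastAtMost[of L 0 1] by simp
  qed (auto intro!: image_eqI[of _ _ 0])
  have "continuous_on {0..1} (g \<circ> (\<lambda>t. L * t))"
    by (intro continuous_on_compose continuous_intros) (simp add: im cont)
  then have "path (\<lambda>t. g (L * t))" by (simp add: path_def o_def)
  moreover show "path_image (\<lambda>t. g (L * t)) = g ` {0..L}"
    unfolding path_image_def by (metis im image_image)
  ultimately show "joins_in X x y (\<lambda>t. g (L * t))"
    using assms by (auto simp: joins_in_def rect_curve_def pathstart_def pathfinish_def)
qed

section \<open>Lower bounds for the length of an arbitrary path\<close>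

definition has_variation_ge :: "(real \<Rightarrow> real \<times> real) \<Rightarrow> real \<Rightarrow> real \<Rightarrow> real \<Rightarrow> bool" where
  "has_variation_ge h a b V \<longleftrightarrow>
     (\<exists>n t. mono t \<and> range t \<subseteq> {a..b} \<and> V \<le> (\<Sum>i<n. dist (h (t i)) (h (t (Suc i)))))"

lemma has_variation_ge_dist:
  assumes "a \<le> b" shows "has_variation_ge h a b (dist (h a) (h b))"
  unfolding has_variation_ge_def
  using assms
  by (intro exI[of _ "1::nat"] exI[of _ "\<lambda>i::nat. if i = 0 then a else b"]) (auto simp: mono_def)

lemma has_variation_ge_trans:
  assumes "has_variation_ge h a b V" "has_variation_ge h b c W"
  shows "has_variation_ge h a c (V + W)"
proof -
  obtain n t where t: "mono t" "range t \<subseteq> {a..b}" "V \<le> (\<Sum>i<n. dist (h (t i)) (h (t (Suc i))))"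
    using assms(1) by (auto simp: has_variation_ge_def)
  obtain m u where u: "mono u" "range u \<subseteq> {b..c}" "W \<le> (\<Sum>i<m. dist (h (u i)) (h (u (Suc i))))"
    using assms(2) by (auto simp: has_variation_ge_def)
  \<comment> \<open>The shift by \<open>Suc n\<close> inserts one extra step from \<open>t n\<close>
    to \<open>u 0\<close>, which contributes a nonnegative distance.\<close>
  define v where "v i = (if i \<le> n then t i else u (i - Suc n))" for i
  have tb: "a \<le> t i" "t i \<le> b" and ub: "b \<le> u i" "u i \<le> c" for i
    using t(2) u(2) by (auto simp: image_subset_iff)
  have "v i \<le> v j" if "i \<le> j" for i j
    using that t(1) u(1) tb(2)[of i] ub(1)[of "j - Suc n"] by (auto simp: v_def mono_def)
  then have "mono v" by (simp add: mono_def)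
  moreover have "range v \<subseteq> {a..c}"
  proof -
    have "b \<le> c" "a \<le> b" using tb[of 0] ub[of 0] by linarith+
    then have "a \<le> v i" "v i \<le> c" for i
      using tb[of i] ub[of "i - Suc n"] by (auto simp: v_def)
    then show ?thesis by auto
  qed
  moreover have "V + W \<le> (\<Sum>i<Suc n + m. dist (h (v i)) (h (v (Suc i))))"
  proof -
    have split: "(\<Sum>i<k + m. f i) = (\<Sum>i<k. f i) + (\<Sum>i<m. f (k + i))" for k m :: nat and f :: "nat \<Rightarrow> real"
      by (induction m) auto
    have "(\<Sum>i<n. dist (h (v i)) (h (v (Suc i)))) = (\<Sum>i<n. dist (h (t i)) (h (t (Suc i))))"
      by (intro sum.cong) (auto simp: v_def)
    moreover have "(\<Sum>i<m. dist (h (v (Suc n + i))) (h (v (Suc (Suc n + i))))) =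
        (\<Sum>i<m. dist (h (u i)) (h (u (Suc i))))"
      by (intro sum.cong) (auto simp: v_def)
    ultimately show ?thesis
      using t(3) u(3) add_increasing2[OF zero_le_dist[of "h (v n)" "h (v (Suc n))"] t(3)]
      unfolding split[of _ "Suc n" m] sum.lessThan_Suc by linarith
  qed
  ultimately show ?thesis unfolding has_variation_ge_def by blast
qed


lemma polygonal_le: "polygonal g a b \<Longrightarrow> a \<le> b"
  by (induction rule: polygonal.induct) auto

lemma polygonal_reparam:
  assumes "polygonal g a b" "0 < k"
    and "\<And>s t. a \<le> s \<Longrightarrow> s \<le> t \<Longrightarrow> t \<le> b \<Longrightarrow> dist (g' (k * s + c)) (g' (k * t + c)) = k * dist (g s) (g t)"
  shows "polygonal g' (k * a + c) (k * b + c)"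
  using assms
proof (induction rule: polygonal.induct)
  case (segment a b)
  then have "dist (g' (k * a + c)) (g' (k * b + c)) = k * (b - a)" by simp
  then show ?case using segment by (intro polygonal.segment) (auto simp: right_diff_distrib)
next
  case (trans a b c)
  then show ?case using polygonal_le[OF trans.hyps(1)] polygonal_le[OF trans.hyps(2)]
    by (intro polygonal.trans[OF trans.IH]) auto
qed

text \<open>Following the arc from \<open>x\<close> to \<open>g a\<close> and then \<open>h\<close>
  from time \<open>s\<close> on gives another path from \<open>x\<close> to \<open>y\<close>, which
  must cover \<open>g b\<close>. Injectivity keeps \<open>g b\<close> off the first half, so
  \<open>h\<close> reaches it after time \<open>s\<close>.\<close>

lemma tree_arc_covers_later:
  assumes g: "tree_arc X x y L g" and h: "joins_in X x' y h"
    and s: "s \<in> {0..1}" "h s = g a" and ab: "0 \<le> a" "a \<le> b" "b \<le> L"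
  shows "\<exists>s'\<in>{s..1}. h s' = g b"
proof (cases "a = b")
  case False
  have r: "rect_curve X x y L g" and inj: "inj_on g {0..L}" using g by (auto simp: tree_arc_def)
  have "rect_curve X x (g a) a g"
    using rect_curve_sub[OF r order_refl ab(1)] ab r by (simp add: rect_curve_def)
  note k = rect_curve_joins_in[OF this]
  have "joins_in X (g a) y (subpath s 1 h)"
    using joins_in_subpath[OF h s(1), of 1] s h by (auto simp: joins_in_def pathfinish_def)
  note j = joins_in_join[OF k(1) this]
  have "g b \<in> path_image ((\<lambda>t. g (a * t)) +++ subpath s 1 h)"
    using g j(1) ab unfolding tree_arc_def by force
  then have "g b \<in> g ` {0..a} \<or> g b \<in> h ` {s..1}"
    using j(2) k(2) s by (auto simp: path_image_subpath)
  moreover have "g b \<notin> g ` {0..a}"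
  proof
    assume "g b \<in> g ` {0..a}"
    then obtain t where "t \<in> {0..a}" "g b = g t" by blast
    then show False using inj_onD[OF inj, of b t] ab False by auto
  qed
  ultimately obtain s' where "s' \<in> {s..1}" "g b = h s'" by blast
  then show ?thesis by metis
qed (use s in auto)

text \<open>A path through a tree visits the points of an arc in their order along the arc.\<close>

lemma tree_arc_variation:
  assumes g: "tree_arc X x y L g" and h: "joins_in X x y h"
  shows "has_variation_ge h 0 1 L"
proof -
  \<comment> \<open>The starting time \<open>s\<close> stays arbitrary, because the second piece of
    the arc has to be found after the time at which \<open>h\<close> reached the end of the
    first.\<close>
  have *: "\<exists>s'\<in>{s..1}. h s' = g b \<and> has_variation_ge h s s' (b - a)"
    if "polygonal g a b" "0 \<le> a" "b \<le> L" "s \<in> {0..1}" "h s = g a" for a b s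
    using that
  proof (induction arbitrary: s rule: polygonal.induct)
    case (segment a b)
    then obtain s' where "s' \<in> {s..1}" "h s' = g b"
      using tree_arc_covers_later[OF g h, of s a b] by auto
    then show ?case using has_variation_ge_dist[of s s' h] segment by auto
  next
    case (trans a b c)
    have le: "a \<le> b" "b \<le> c"
      using polygonal_le[OF trans.hyps(1)] polygonal_le[OF trans.hyps(2)] by auto
    obtain s' where s': "s' \<in> {s..1}" "h s' = g b" "has_variation_ge h s s' (b - a)"
      using trans.IH(1)[of s] trans.prems le by auto
    obtain s'' where s'': "s'' \<in> {s'..1}" "h s'' = g c" "has_variation_ge h s' s'' (c - b)"
      using trans.IH(2)[of s'] trans.prems le s' by auto
    show ?case using s' s'' has_variation_ge_trans[OF s'(3) s''(3)] by (intro bexI[of _ s'']) auto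
  qed
  have "polygonal g 0 L" "0 \<le> L" "h 0 = g 0"
    using g h by (auto simp: tree_arc_def rect_curve_def joins_in_def pathstart_def)
  then obtain s where "s \<in> {0..1}" "has_variation_ge h 0 s (L - 0)"
    using *[of 0 L 0] by auto
  then obtain n t where t: "mono t" "range t \<subseteq> {0..s}"
      "L \<le> (\<Sum>i<n. dist (h (t i)) (h (t (Suc i))))" and "s \<le> 1"
    by (auto simp: has_variation_ge_def)
  then have "range t \<subseteq> {0..1}" by (meson atLeastatMost_subset_iff order_refl subset_trans)
  then show ?thesis using t by (auto simp: has_variation_ge_def)
qed

lemma curve_length_ge:
  assumes "has_variation_ge h 0 1 V"
  shows "ereal V \<le> curve_length h"
proof -
  obtain n t where t: "mono t" "range t \<subseteq> {0..1}" "V \<le> (\<Sum>i<n. dist (h (t i)) (h (t (Suc i))))"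
    using assms by (auto simp: has_variation_ge_def)
  show ?thesis unfolding curve_length_def
    using t by (intro SUP_upper2[of "(n, t)"]) auto
qed

lemma rect_curve_sum_le:
  assumes r: "rect_curve X x y L g" and t: "mono t" "range t \<subseteq> {0..1}"
  shows "(\<Sum>i<n. dist (g (L * t i)) (g (L * t (Suc i)))) \<le> L"
proof -
  have L: "0 \<le> L" using r by (simp add: rect_curve_def)
  have t01: "0 \<le> t i" "t i \<le> 1" for i using t(2) by (auto simp: image_subset_iff)
  have "(\<Sum>i<n. dist (g (L * t i)) (g (L * t (Suc i)))) \<le> (\<Sum>i<n. L * t (Suc i) - L * t i)"
  proof (rule sum_mono)
    fix i
    have "dist (g (L * t i)) (g (L * t (Suc i))) \<le> 1 * dist (L * t i) (L * t (Suc i))"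
      using r t01 L by (intro lipschitz_onD[of 1 "{0..L}" g])
        (auto simp: rect_curve_def mult_left_le)
    also have "\<dots> = L * t (Suc i) - L * t i"
      using t(1) L by (simp add: dist_real_def mono_def mult_left_mono)
    finally show "dist (g (L * t i)) (g (L * t (Suc i))) \<le> L * t (Suc i) - L * t i" .
  qed
  also have "\<dots> = L * (t n - t 0)"
    using sum_lessThan_telescope[of "\<lambda>i. L * t i" n] by (simp add: algebra_simps)
  also have "\<dots> \<le> L" using t01[of 0] t01[of n] L by (intro mult_left_le) auto
  finally show ?thesis .
qed

lemma curve_length_rect_le:
  assumes "rect_curve X x y L g"
  shows "curve_length (\<lambda>t. g (L * t)) \<le> ereal L"
  unfolding curve_length_def
  using rect_curve_sum_le[OF assms] by (auto intro!: SUP_least)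

lemma tree_arc_le_rect:
  assumes "tree_arc X x y L g" "rect_curve X x y L' g'"
  shows "L \<le> L'"
proof -
  have "ereal L \<le> ereal L'"
    using curve_length_ge[OF tree_arc_variation[OF assms(1) rect_curve_joins_in(1)[OF assms(2)]]]
      curve_length_rect_le[OF assms(2)] by (rule order_trans)
  then show ?thesis by simp
qed

section \<open>Geodesic distance and betweenness in a tree\<close>

lemma tdist_le: "rect_curve X x y L g \<Longrightarrow> tdist X x y \<le> L"
  unfolding tdist_def by (rule cInf_lower) (auto intro!: bdd_belowI[of _ 0] simp: rect_curve_def)

lemma tdist_tree_arc:
  assumes "tree_arc X x y L g"
  shows "tdist X x y = L"
  unfolding tdist_def
proof (rule cInf_eq_minimum)
  show "L \<in> {L. \<exists>g. rect_curve X x y L g}" using assms by (auto simp: tree_arc_def)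
qed (use tree_arc_le_rect[OF assms] in blast)

lemma is_tree_arc:
  assumes "is_tree X" "x \<in> X" "y \<in> X"
  shows "\<exists>g. tree_arc X x y (tdist X x y) g"
proof -
  obtain L g where "tree_arc X x y L g" using assms unfolding is_tree_def by blast
  then show ?thesis using tdist_tree_arc by blast
qed

lemma is_tree_rect:
  assumes "is_tree X" "x \<in> X" "y \<in> X"
  shows "\<exists>g. rect_curve X x y (tdist X x y) g"
  using is_tree_arc[OF assms] unfolding tree_arc_def by blast

lemma tdist_nonneg: "is_tree X \<Longrightarrow> x \<in> X \<Longrightarrow> y \<in> X \<Longrightarrow> 0 \<le> tdist X x y"
  using is_tree_rect[of X x y] by (auto simp: rect_curve_def)

lemma dist_le_tdist:
  assumes "is_tree X" "x \<in> X" "y \<in> X"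
  shows "dist x y \<le> tdist X x y"
proof -
  obtain g where g: "rect_curve X x y (tdist X x y) g" using is_tree_rect[OF assms] by blast
  then have "dist (g 0) (g (tdist X x y)) \<le> 1 * dist 0 (tdist X x y)"
    by (intro lipschitz_onD[of 1 "{0..tdist X x y}" g]) (auto simp: rect_curve_def)
  then show ?thesis using g by (auto simp: rect_curve_def dist_real_def)
qed

lemma tdist_sym_le:
  assumes "is_tree X" "x \<in> X" "y \<in> X"
  shows "tdist X y x \<le> tdist X x y"
proof -
  obtain g where "rect_curve X x y (tdist X x y) g" using is_tree_rect[OF assms] by blast
  from tdist_le[OF rect_curve_reverse[OF this]] show ?thesis .
qed

lemma tdist_sym: "is_tree X \<Longrightarrow> x \<in> X \<Longrightarrow> y \<in> X \<Longrightarrow> tdist X y x = tdist X x y"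
  by (simp add: antisym tdist_sym_le)

lemma tdist_triangle:
  assumes "is_tree X" "x \<in> X" "y \<in> X" "z \<in> X"
  shows "tdist X x z \<le> tdist X x y + tdist X y z"
proof -
  obtain g h where "rect_curve X x y (tdist X x y) g" "rect_curve X y z (tdist X y z) h"
    using is_tree_rect[OF assms(1-3)] is_tree_rect[OF assms(1,3,4)] by blast
  from tdist_le[OF rect_curve_cat[OF this]] show ?thesis .
qed

lemma tdist_refl: "x \<in> X \<Longrightarrow> is_tree X \<Longrightarrow> tdist X x x = 0"
  using tdist_le[of X x x 0 "\<lambda>_. x"] tdist_nonneg[of X x x] by (auto simp: rect_curve_def)

text \<open>The three pieces of the curve bound three partial distances from above, and these bounds
  already add up to the total distance, so none of them has slack.\<close>

lemma tdist_along:
  assumes "is_tree X" "rect_curve X x y (tdist X x y) g" "0 \<le> s" "s \<le> t" "t \<le> tdist X x y"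
  shows "tdist X (g s) (g t) = t - s"
proof -
  let ?L = "tdist X x y"
  note r = assms(2)
  have X: "g s \<in> X" "g t \<in> X" "x \<in> X" "y \<in> X" and e: "g 0 = x" "g ?L = y"
    using assms rect_curve_endpoints[OF r] by (auto simp: rect_curve_def image_subset_iff)
  have "tdist X x (g s) \<le> s - 0" "tdist X (g s) (g t) \<le> t - s" "tdist X (g t) y \<le> ?L - t"
    using tdist_le[OF rect_curve_sub[OF r, of 0 s]] tdist_le[OF rect_curve_sub[OF r, of s t]]
      tdist_le[OF rect_curve_sub[OF r, of t ?L]] assms e by auto
  then show ?thesis
    using tdist_triangle[OF assms(1) X(3,1,4)] tdist_triangle[OF assms(1) X(1,2,4)] by linarith
qed

text \<open>A geodesic of \<open>X\<close> is also a path in \<open>Y\<close>, so it covers the arc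
  of \<open>Y\<close>; that arc therefore lies in \<open>X\<close>.\<close>

lemma tdist_subset:
  assumes "is_tree X" "is_tree Y" "X \<subseteq> Y" "x \<in> X" "y \<in> X"
  shows "tdist Y x y = tdist X x y"
proof (rule antisym)
  obtain g where g: "rect_curve X x y (tdist X x y) g"
    using is_tree_rect[OF assms(1,4,5)] by blast
  show "tdist Y x y \<le> tdist X x y"
    using tdist_le[OF rect_curve_mono[OF g assms(3)]] .
  obtain h where h: "tree_arc Y x y (tdist Y x y) h" 
    using is_tree_arc[OF assms(2)] assms by blast
  have "h ` {0..tdist Y x y} \<subseteq> path_image (\<lambda>t. g (tdist X x y * t))"
    using h joins_in_mono[OF rect_curve_joins_in(1)[OF g] assms(3)] by (auto simp: tree_arc_def)
  also have "\<dots> \<subseteq> X" using rect_curve_joins_in(1)[OF g] by (simp add: joins_in_def)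
  finally have "rect_curve X x y (tdist Y x y) h"
    using h by (auto simp: tree_arc_def rect_curve_def)
  then show "tdist X x y \<le> tdist Y x y" by (rule tdist_le)
qed

text \<open>Meant for cut points: a joint between two cells lies on every path from one to the
  other.\<close>

lemma tdist_cut:
  assumes "is_tree X" "x \<in> X" "y \<in> X" "\<And>h. joins_in X x y h \<Longrightarrow> z \<in> path_image h"
  shows "tdist X x y = tdist X x z + tdist X z y"
proof -
  obtain g where g: "rect_curve X x y (tdist X x y) g"
    using is_tree_rect[OF assms(1-3)] by blast
  from assms(4)[OF rect_curve_joins_in(1)[OF g]] rect_curve_joins_in(2)[OF g]
  obtain t where t: "0 \<le> t" "t \<le> tdist X x y" "z = g t" by auto
  then show ?thesis
    using tdist_along[OF assms(1) g, of 0 t] tdist_along[OF assms(1) g, of t "tdist X x y"] g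
    by (auto simp: rect_curve_def)
qed

text \<open>The arc point \<open>g s\<close> equals \<open>h t\<close> for some \<open>t\<close>,
  and both \<open>s\<close> and \<open>t\<close> are its distance from \<open>x\<close>.\<close>

lemma geodesic_unique:
  assumes "is_tree X" and g: "tree_arc X x y L g" and h: "rect_curve X x y L h" and s: "s \<in> {0..L}"
  shows "h s = g s"
proof -
  have L: "tdist X x y = L" using tdist_tree_arc[OF g] .
  have r: "rect_curve X x y L g" using g by (simp add: tree_arc_def)
  obtain t where t: "t \<in> {0..L}" "g s = h t"
    using g rect_curve_joins_in[OF h] s unfolding tree_arc_def by blast
  have "tdist X (g 0) (g s) = s - 0" "tdist X (h 0) (h t) = t - 0"
    using tdist_along[OF assms(1), of x y g 0 s] tdist_along[OF assms(1), of x y h 0 t] r h s t L by auto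
  then show ?thesis using r h t by (auto simp: rect_curve_def)
qed

text \<open>The source of the convexity of balls. The detour from \<open>y\<close> through
  \<open>x\<close> to \<open>z\<close> covers the arc from \<open>y\<close> to \<open>z\<close>, so
  \<open>w\<close> lies on one of its two geodesic halves, where no point is further from
  \<open>x\<close> than the end.\<close>

lemma tdist_between_le_max:
  assumes X: "is_tree X" "x \<in> X" "y \<in> X" "z \<in> X" "w \<in> X"
    and w: "tdist X y w + tdist X w z = tdist X y z"
  shows "tdist X x w \<le> max (tdist X x y) (tdist X x z)"
proof -
  obtain g where g: "tree_arc X y z (tdist X y z) g" 
    using is_tree_arc[OF X(1,3,4)] by blast
  obtain h k where h: "rect_curve X y w (tdist X y w) h" and k: "rect_curve X w z (tdist X w z) k"
    using is_tree_rect[OF X(1,3,5)] is_tree_rect[OF X(1,5,4)] by blast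
  have n: "0 \<le> tdist X y w" "0 \<le> tdist X w z" using X tdist_nonneg by auto
  have e: "h (tdist X y w) = w" using h by (simp add: rect_curve_def)
  \<comment> \<open>The concatenation through \<open>w\<close> has length
    \<open>tdist X y z\<close>, so uniqueness of geodesics puts \<open>w\<close> on the arc
    \<open>g\<close>.\<close>
  have "w = curve_cat (tdist X y w) h k (tdist X y w)" by (simp add: curve_cat_def e)
  also have "\<dots> = g (tdist X y w)"
    using geodesic_unique[OF X(1) g, of "curve_cat (tdist X y w) h k" "tdist X y w"]
      rect_curve_cat[OF h k] w n by auto
  finally have wg: "w \<in> g ` {0..tdist X y z}" using n w by auto
  obtain p q where p: "rect_curve X y x (tdist X y x) p" and q: "rect_curve X x z (tdist X x z) q"
    using is_tree_rect[OF X(1,3,2)] is_tree_rect[OF X(1,2,4)] by blast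
  have "w \<in> path_image ((\<lambda>t. p (tdist X y x * t)) +++ (\<lambda>t. q (tdist X x z * t)))"
    using wg g joins_in_join(1)[OF rect_curve_joins_in(1)[OF p] rect_curve_joins_in(1)[OF q]]
    by (auto simp: tree_arc_def)
  then consider t where "t \<in> {0..tdist X y x}" "w = p t" | t where "t \<in> {0..tdist X x z}" "w = q t"
    using joins_in_join(2)[OF rect_curve_joins_in(1)[OF p] rect_curve_joins_in(1)[OF q]]
      rect_curve_joins_in(2)[OF p] rect_curve_joins_in(2)[OF q] by auto
  then show ?thesis
  proof cases
    case 1
    then have "tdist X w x = tdist X y x - t"
      using tdist_along[OF X(1) p, of t "tdist X y x"] p by (auto simp: rect_curve_def)
    then show ?thesis using 1 tdist_sym[OF X(1,2,5)] tdist_sym[OF X(1,2,3)] by auto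
  next
    case 2
    then have "tdist X x w = t"
      using tdist_along[OF X(1) q, of 0 t] q by (auto simp: rect_curve_def)
    then show ?thesis using 2 by auto
  qed
qed

lemma joins_in_variation:
  assumes "is_tree X" "joins_in X x y h"
  shows "has_variation_ge h 0 1 (tdist X x y)"
  using is_tree_arc[OF assms(1)] joins_in_endpoints[OF assms(2)] tree_arc_variation[OF _ assms(2)]
  by blast

lemma joins_in_variation_sub:
  assumes X: "is_tree X" and h: "joins_in X x y h" and ab: "0 \<le> a" "a \<le> b" "b \<le> 1"
  shows "has_variation_ge h a b (tdist X (h a) (h b))"
proof -
  have "has_variation_ge (subpath a b h) 0 1 (tdist X (h a) (h b))"
    using joins_in_variation[OF X joins_in_subpath[OF h]] ab by auto
  then obtain n t where t: "mono t" "range t \<subseteq> {0..1}"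
    "tdist X (h a) (h b) \<le> (\<Sum>i<n. dist (subpath a b h (t i)) (subpath a b h (t (Suc i))))"
    by (auto simp: has_variation_ge_def)
  have t01: "0 \<le> t i" "t i \<le> 1" for i using t(2) by (auto simp: image_subset_iff)
  have "mono (\<lambda>i. (b - a) * t i + a)"
    using t(1) ab by (auto simp: mono_def mult_left_mono)
  moreover have "range (\<lambda>i. (b - a) * t i + a) \<subseteq> {a..b}"
  proof -
    have "0 \<le> (b - a) * t i \<and> (b - a) * t i \<le> b - a" for i
      using t01 ab by (simp add: mult_left_le)
    then show ?thesis by (auto simp: image_subset_iff algebra_simps)
  qed
  ultimately show ?thesis
    using t(3) unfolding has_variation_ge_def
    by (intro exI[of _ n] exI[of _ "\<lambda>i. (b - a) * t i + a"]) (simp add: subpath_def)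
qed

lemma tdist_le_curve_length:
  "is_tree X \<Longrightarrow> joins_in X x y h \<Longrightarrow> ereal (tdist X x y) \<le> curve_length h"
  by (intro curve_length_ge joins_in_variation)

lemma rect_curve_geodesic_in:
  assumes "is_tree X" "rect_curve X x y (tdist X x y) g"
  shows "geodesic_in X x y (\<lambda>t. g (tdist X x y * t))"
  unfolding geodesic_in_def
  using rect_curve_joins_in(1)[OF assms(2)]
    order_trans[OF curve_length_rect_le[OF assms(2)] tdist_le_curve_length[OF assms(1)]] by blast

lemma geodesic_in_length:
  assumes "is_tree X" "geodesic_in X x y g"
  shows "curve_length g = ereal (tdist X x y)"
proof -
  have j: "joins_in X x y g" using assms by (simp add: geodesic_in_def)
  obtain h where "rect_curve X x y (tdist X x y) h"
    using is_tree_rect[OF assms(1)] joins_in_endpoints[OF j] by blast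
  from rect_curve_joins_in(1)[OF this] curve_length_rect_le[OF this]
  have "curve_length g \<le> ereal (tdist X x y)"
    using assms(2) unfolding geodesic_in_def by (meson order_trans)
  then show ?thesis using tdist_le_curve_length[OF assms(1) j] by simp
qed

text \<open>The path is measured separately before and after \<open>z\<close>. Its total length is
  only the distance of its ends, so the triangle inequality has to be an equality.\<close>

lemma geodesic_in_between:
  assumes X: "is_tree X" and g: "geodesic_in X x y g" and z: "z \<in> path_image g"
  shows "tdist X x z + tdist X z y = tdist X x y"
proof -
  have j: "joins_in X x y g" using g by (simp add: geodesic_in_def)
  obtain s where s: "0 \<le> s" "s \<le> 1" "z = g s" using z by (auto simp: path_image_def)
  have e: "g 0 = x" "g 1 = y" using j by (auto simp: joins_in_def pathstart_def pathfinish_def)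
  have "has_variation_ge g 0 1 (tdist X x z + tdist X z y)"
    using has_variation_ge_trans[OF joins_in_variation_sub[OF X j, of 0 s] joins_in_variation_sub[OF X j, of s 1]]
      s e by auto
  from curve_length_ge[OF this] have "tdist X x z + tdist X z y \<le> tdist X x y"
    using geodesic_in_length[OF X g] by simp
  moreover have "z \<in> X" using z j by (auto simp: joins_in_def)
  ultimately show ?thesis using tdist_triangle[OF X, of x z y] joins_in_endpoints[OF j] by auto
qed

text \<open>Together with \<open>geodesic_in_between\<close> this turns convexity, which is stated
  through geodesic paths, into a condition on distances.\<close>

lemma between_geodesic_in:
  assumes X: "is_tree X" "x \<in> X" "y \<in> X" "z \<in> X" and z: "tdist X x z + tdist X z y = tdist X x y"
  obtains g where "geodesic_in X x y g" "z \<in> path_image g"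
proof -
  obtain h k where h: "rect_curve X x z (tdist X x z) h" and k: "rect_curve X z y (tdist X z y) k"
    using is_tree_rect[OF X(1,2,4)] is_tree_rect[OF X(1,4,3)] by blast
  let ?c = "curve_cat (tdist X x z) h k"
  have c: "rect_curve X x y (tdist X x y) ?c" using rect_curve_cat[OF h k] z by simp
  have "?c (tdist X x z) = z" using h by (simp add: curve_cat_def rect_curve_def)
  then have "z \<in> path_image (\<lambda>t. ?c (tdist X x y * t))"
    unfolding rect_curve_joins_in(2)[OF c]
    using tdist_nonneg[OF X(1,2,4)] tdist_nonneg[OF X(1,4,3)] z
    by (intro image_eqI[of _ _ "tdist X x z"]) auto
  with rect_curve_geodesic_in[OF X(1) c] show ?thesis using that by blast
qed

section \<open>Gluing trees\<close>

text \<open>Otherwise the connected image would split into two disjoint closed pieces.\<close>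

lemma glue_crossing:
  assumes "closed X" "closed Y" "X \<inter> Y = {c}" and h: "joins_in (X \<union> Y) x y h"
    and "path_image h \<inter> X \<noteq> {}" "path_image h \<inter> Y \<noteq> {}"
  shows "c \<in> path_image h"
proof (rule ccontr)
  assume "c \<notin> path_image h"
  then have "X \<inter> Y \<inter> path_image h = {}" using assms(3) by auto
  moreover have "connected (path_image h)" "path_image h \<subseteq> X \<union> Y"
    using h by (auto simp: joins_in_def intro: connected_path_image)
  ultimately show False
    using assms(1,2,5,6) unfolding connected_closed by blast
qed

text \<open>Collapsing \<open>Y\<close> to the gluing point retracts the union onto
  \<open>X\<close>. The retracted path uses no new points, since \<open>h\<close> itself runs
  through \<open>c\<close> whenever it meets both sides.\<close>

lemma glue_retract:
  assumes X: "closed X" and Y: "closed Y" and c: "X \<inter> Y = {c}" and h: "joins_in (X \<union> Y) x y h"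
    and hX: "path_image h \<inter> X \<noteq> {}"
  shows "\<exists>h'. joins_in X (if x \<in> X then x else c) (if y \<in> X then y else c) h' \<and>
              path_image h' \<subseteq> path_image h"
proof -
  let ?h' = "\<lambda>t. if h t \<in> X then h t else c"
  have ch: "continuous_on {0..1} h" and im: "h ` {0..1} \<subseteq> X \<union> Y"
    using h by (auto simp: joins_in_def path_def path_image_def)
  define S where "S = {0..1} \<inter> h -` X"
  define T where "T = {0..1} \<inter> h -` Y"
  have cl: "closed S" "closed T"
    unfolding S_def T_def by (auto intro!: continuous_closed_preimage ch X Y)
  \<comment> \<open>Pasting along closed sets: where both branches apply, \<open>h\<close> is in
    \<open>X\<close> and in \<open>Y\<close>, hence equal to \<open>c\<close>.\<close>
  have "continuous_on (S \<union> T) (\<lambda>t. if h t \<in> X then h t else c)"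
  proof (rule continuous_on_cases[OF cl])
    show "continuous_on S h" by (rule continuous_on_subset[OF ch]) (auto simp: S_def)
    show "\<forall>t. t \<in> S \<and> h t \<notin> X \<or> t \<in> T \<and> h t \<in> X \<longrightarrow> h t = c"
      using c by (auto simp: S_def T_def)
  qed simp
  moreover have "S \<union> T = {0..1}" using im by (auto simp: S_def T_def)
  ultimately have "path ?h'" by (simp add: path_def)
  moreover have "path_image ?h' \<subseteq> path_image h"
  proof
    fix z assume "z \<in> path_image ?h'"
    then obtain t where t: "t \<in> {0..1}" "z = ?h' t" by (auto simp: path_image_def)
    show "z \<in> path_image h"
    proof (cases "h t \<in> X")
      case False
      then have "h t \<in> path_image h \<inter> Y" using t(1) subsetD[OF im, of "h t"] by (auto simp: path_image_def)
      then show ?thesis using glue_crossing[OF X Y c h hX] False t by auto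
    qed (use t in \<open>auto simp: path_image_def\<close>)
  qed
  moreover have "path_image ?h' \<subseteq> X"
    unfolding path_image_def using c by (intro image_subsetI) auto
  moreover have "h 0 = x" "h 1 = y" using h by (auto simp: joins_in_def pathstart_def pathfinish_def)
  ultimately show ?thesis
    by (intro exI[of _ ?h']) (simp add: joins_in_def pathstart_def pathfinish_def)
qed

text \<open>A competing path may stray into \<open>Y\<close>, but its retraction joins the same ends
  inside \<open>X\<close>.\<close>

lemma tree_arc_glue_same:
  assumes "closed X" "closed Y" "X \<inter> Y = {c}" and g: "tree_arc X x y L g"
  shows "tree_arc (X \<union> Y) x y L g"
proof -
  have xy: "x \<in> X" "y \<in> X" using g by (auto simp: tree_arc_def dest: rect_curve_endpoints)
  have "g ` {0..L} \<subseteq> path_image h" if h: "joins_in (X \<union> Y) x y h" for h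
  proof -
    have "x \<in> path_image h" using h by (auto simp: joins_in_def)
    with glue_retract[OF assms(1-3) h] xy obtain h' where
      "joins_in X x y h'" "path_image h' \<subseteq> path_image h" by auto
    then show ?thesis using g unfolding tree_arc_def by blast
  qed
  then show ?thesis
    using g rect_curve_mono[of X x y L g "X \<union> Y"] by (auto simp: tree_arc_def)
qed

text \<open>Retracting a competing path to either side yields paths from \<open>x\<close> to
  \<open>c\<close> and from \<open>c\<close> to \<open>y\<close>, which cover the two
  halves.\<close>

lemma tree_arc_glue_cross:
  assumes X: "closed X" and Y: "closed Y" and c: "X \<inter> Y = {c}"
    and g: "tree_arc X x c a g" and h: "tree_arc Y c y b h"
  shows "tree_arc (X \<union> Y) x y (a + b) (curve_cat a g h)"
proof -
  have rg: "rect_curve X x c a g" and rh: "rect_curve Y c y b h"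
    and ig: "inj_on g {0..a}" and ih: "inj_on h {0..b}"
    using g h by (auto simp: tree_arc_def)
  have a: "0 \<le> a" "0 \<le> b" "g a = h 0" "h 0 = c" using rg rh by (auto simp: rect_curve_def)
  have xy: "x \<in> X" "y \<in> Y" "c \<in> X" "c \<in> Y"
    using rect_curve_endpoints[OF rg] rect_curve_endpoints[OF rh] by auto
  have "rect_curve (X \<union> Y) x y (a + b) (curve_cat a g h)"
    using rect_curve_mono[OF rg, of "X \<union> Y"] rect_curve_mono[OF rh, of "X \<union> Y"]
    by (intro rect_curve_cat) auto
  moreover have "inj_on (curve_cat a g h) {0..a + b}"
  proof -
    \<comment> \<open>The halves can meet only at \<open>c\<close>, and the second one is at
      \<open>c\<close> only at its start.\<close>
    have ne: "g s \<noteq> h (t - a)" if "0 \<le> s" "s \<le> a" "a < t" "t \<le> a + b" for s t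
    proof
      assume eq: "g s = h (t - a)"
      have "g s \<in> X" "h (t - a) \<in> Y" using that rg rh by (auto simp: rect_curve_def)
      then have "h (t - a) = h 0" using eq c a by auto
      then show False using inj_onD[OF ih, of "t - a" 0] that by auto
    qed
    show ?thesis
    proof (rule inj_onI)
      fix s t assume st: "s \<in> {0..a + b}" "t \<in> {0..a + b}" "curve_cat a g h s = curve_cat a g h t"
      consider "s \<le> a" "t \<le> a" | "s \<le> a" "a < t" | "a < s" "t \<le> a" | "a < s" "a < t" by linarith
      then show "s = t"
      proof cases
        case 1 then show ?thesis using st inj_onD[OF ig, of s t] by (auto simp: curve_cat_def)
      next
        case 2 then show ?thesis using st ne[of s t] by (auto simp: curve_cat_def)
      next
        case 3 then show ?thesis using st ne[of t s] by (auto simp: curve_cat_def)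
      next
        case 4 then show ?thesis using st inj_onD[OF ih, of "s - a" "t - a"] by (auto simp: curve_cat_def)
      qed
    qed
  qed
  moreover have "polygonal (curve_cat a g h) 0 (a + b)"
  proof (rule polygonal.trans)
    have "polygonal (curve_cat a g h) (1 * 0 + 0) (1 * a + 0)"
      by (rule polygonal_reparam[of g]) (use g in \<open>auto simp: tree_arc_def curve_cat_def\<close>)
    then show "polygonal (curve_cat a g h) 0 a" by simp
    have "polygonal (curve_cat a g h) (1 * 0 + a) (1 * b + a)"
      by (rule polygonal_reparam[of h]) (use h a in \<open>auto simp: tree_arc_def curve_cat_def\<close>)
    then show "polygonal (curve_cat a g h) a (a + b)" by (simp add: add.commute)
  qed
  moreover have "curve_cat a g h ` {0..a + b} \<subseteq> path_image k" if k: "joins_in (X \<union> Y) x y k" for k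
  proof -
    have "x \<in> path_image k" "y \<in> path_image k" using k by (auto simp: joins_in_def)
    then have ne: "path_image k \<inter> X \<noteq> {}" "path_image k \<inter> Y \<noteq> {}" using xy by auto
    have ends: "(if y \<in> X then y else c) = c" "(if x \<in> Y then x else c) = c" using xy c by auto
    obtain k1 where "joins_in X x c k1" "path_image k1 \<subseteq> path_image k"
      using glue_retract[OF X Y c k ne(1)] xy ends by auto
    moreover obtain k2 where "joins_in Y c y k2" "path_image k2 \<subseteq> path_image k"
      using glue_retract[OF Y X _ _ ne(2), of c x y] k c xy ends by (auto simp: Un_commute Int_commute)
    ultimately have "g ` {0..a} \<union> h ` {0..b} \<subseteq> path_image k"
      using g h unfolding tree_arc_def by blast
    then show ?thesis using curve_cat_image[of a b g h] a by simp
  qed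
  ultimately show ?thesis by (auto simp: tree_arc_def)
qed

lemma is_tree_glue:
  assumes X: "closed X" "is_tree X" and Y: "closed Y" "is_tree Y" and c: "X \<inter> Y = {c}"
  shows "is_tree (X \<union> Y)"
proof -
  have c': "c \<in> X" "c \<in> Y" "Y \<inter> X = {c}" using c by auto
  have same: "\<exists>L g. tree_arc (X \<union> Y) x y L g"
    if "closed X" "is_tree X" "closed Y" "X \<inter> Y = {c}" "x \<in> X" "y \<in> X" for x y X Y
    using that is_tree_arc[of X x y] tree_arc_glue_same[of X Y c x y] by blast
  have cross: "\<exists>L g. tree_arc (X \<union> Y) x y L g"
    if "closed X" "is_tree X" "closed Y" "is_tree Y" "X \<inter> Y = {c}" "x \<in> X" "y \<in> Y" for x y X Y
    using that is_tree_arc[of X x c] is_tree_arc[of Y c y] tree_arc_glue_cross[of X Y c x _ _ y]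
    by blast
  show ?thesis unfolding is_tree_def
    using same[OF X Y(1) c] same[OF Y X(1) c'(3)] cross[OF X Y c] cross[OF Y X c'(3)]
    by (auto simp: Un_commute)
qed

lemma tree_arc_image:
  fixes f :: "real \<times> real \<Rightarrow> real \<times> real"
  assumes g: "tree_arc X x y L g" and k: "0 < k" and f: "\<And>u v. dist (f u) (f v) = k * dist u v"
  shows "tree_arc (f ` X) (f x) (f y) (k * L) (\<lambda>t. f (g (t / k)))"
proof -
  have r: "rect_curve X x y L g" using g by (simp add: tree_arc_def)
  have inj: "inj f" by (rule injI) (use f[of _ _] k in \<open>metis dist_eq_0_iff mult_eq_0_iff less_irrefl\<close>)
  have im: "(\<lambda>t. t / k) ` {0..k * L} = {0..L}"
    using k r by (auto simp: rect_curve_def image_iff field_simps intro!: bexI[of _ "k * _"])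
  then have im': "(\<lambda>t. f (g (t / k))) ` {0..k * L} = f ` g ` {0..L}" by (metis image_image)
  have "1-lipschitz_on {0..k * L} (\<lambda>t. f (g (t / k)))"
  proof (rule lipschitz_onI)
    fix s t assume st: "s \<in> {0..k * L}" "t \<in> {0..k * L}"
    then have "s / k \<in> {0..L}" "t / k \<in> {0..L}" using k by (auto simp: field_simps)
    then have "dist (g (s / k)) (g (t / k)) \<le> 1 * dist (s / k) (t / k)"
      using r by (intro lipschitz_onD[of 1 "{0..L}" g]) (auto simp: rect_curve_def)
    also have "dist (s / k) (t / k) = dist s t / k"
      using k by (simp add: dist_real_def flip: diff_divide_distrib)
    finally show "dist (f (g (s / k))) (f (g (t / k))) \<le> 1 * dist s t"
      using k by (simp add: f field_simps)
  qed simp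
  then have "rect_curve (f ` X) (f x) (f y) (k * L) (\<lambda>t. f (g (t / k)))"
    using r k im' by (auto simp: rect_curve_def)
  moreover have "inj_on (\<lambda>t. f (g (t / k))) {0..k * L}"
  proof (rule inj_onI)
    fix s t assume st: "s \<in> {0..k * L}" "t \<in> {0..k * L}" "f (g (s / k)) = f (g (t / k))"
    then have "s / k \<in> {0..L}" "t / k \<in> {0..L}" using k by (auto simp: field_simps)
    moreover have "g (s / k) = g (t / k)" using st(3) inj by (simp add: inj_eq)
    ultimately have "s / k = t / k" using g by (auto simp: tree_arc_def dest: inj_onD)
    then show "s = t" using k by simp
  qed
  moreover have "polygonal (\<lambda>t. f (g (t / k))) 0 (k * L)"
  proof -
    have "polygonal (\<lambda>t. f (g (t / k))) (k * 0 + 0) (k * L + 0)"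
      by (rule polygonal_reparam[of g]) (use g k in \<open>auto simp: tree_arc_def f\<close>)
    then show ?thesis by simp
  qed
  moreover have "(\<lambda>t. f (g (t / k))) ` {0..k * L} \<subseteq> path_image h"
    if h: "joins_in (f ` X) (f x) (f y) h" for h
  proof -
    \<comment> \<open>The inverse similarity pulls a competing path back to
      \<open>X\<close>.\<close>
    define f' where "f' = inv f"
    have f'f: "f' (f z) = z" for z using inj by (simp add: f'_def)
    have him: "h ` {0..1} \<subseteq> f ` X" using h by (simp add: joins_in_def path_image_def)
    have "continuous_on (f ` X) f'"
    proof (rule lipschitz_on_continuous_on)
      show "(1 / k)-lipschitz_on (f ` X) f'"
        using k by (intro lipschitz_onI) (auto simp: f'f f)
    qed
    then have "continuous_on {0..1} (f' \<circ> h)"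
      using h him by (intro continuous_on_compose)
        (auto simp: joins_in_def path_def intro: continuous_on_subset)
    then have "joins_in X x y (f' \<circ> h)"
      using h him by (auto simp: joins_in_def path_def path_image_def pathstart_def pathfinish_def
          f'f image_subset_iff)
    then have "g ` {0..L} \<subseteq> path_image (f' \<circ> h)" using g unfolding tree_arc_def by blast
    then have "f ` g ` {0..L} \<subseteq> f ` path_image (f' \<circ> h)" by blast
    also have "\<dots> \<subseteq> path_image h"
    proof
      fix z assume "z \<in> f ` path_image (f' \<circ> h)"
      then obtain t where t: "t \<in> {0..1}" "z = f (f' (h t))" by (auto simp: path_image_def)
      then obtain w where "h t = f w" using him by blast
      then have "z = h t" using t by (simp add: f'f)
      then show "z \<in> path_image h" using t by (auto simp: path_image_def)
    qed
    finally show ?thesis using im' by simp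
  qed
  ultimately show ?thesis by (auto simp: tree_arc_def)
qed

lemma is_tree_image:
  fixes f :: "real \<times> real \<Rightarrow> real \<times> real"
  assumes "is_tree X" "0 < k" "\<And>u v. dist (f u) (f v) = k * dist u v"
  shows "is_tree (f ` X)"
    and "x \<in> X \<Longrightarrow> y \<in> X \<Longrightarrow> tdist (f ` X) (f x) (f y) = k * tdist X x y"
proof -
  have *: "\<exists>g. tree_arc (f ` X) (f x) (f y) (k * tdist X x y) g" if "x \<in> X" "y \<in> X" for x y
    using is_tree_arc[OF assms(1) that] tree_arc_image[OF _ assms(2,3)] by blast
  then show "is_tree (f ` X)" unfolding is_tree_def by blast
  show "tdist (f ` X) (f x) (f y) = k * tdist X x y" if "x \<in> X" "y \<in> X"
    using *[OF that] tdist_tree_arc by blast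
qed

text \<open>The hyperplane through \<open>z\<close> orthogonal to \<open>y - x\<close> must meet the
  connected set; since everything lies on one line, it does so at \<open>z\<close> itself.\<close>

lemma connected_covers_segment:
  fixes a b :: "'a::euclidean_space"
  assumes S: "connected S" "S \<subseteq> closed_segment a b" and xy: "x \<in> S" "y \<in> S"
  shows "closed_segment x y \<subseteq> S"
proof
  fix z assume z: "z \<in> closed_segment x y"
  then have zab: "z \<in> closed_segment a b" using S xy by (meson closed_segment_subset convex_closed_segment subsetD)
  obtain u where u: "0 \<le> u" "u \<le> 1" "z = x + u *\<^sub>R (y - x)"
    using z by (auto simp: closed_segment_def algebra_simps)
  have "(y - x) \<bullet> (z - x) \<ge> 0" "(y - x) \<bullet> (y - z) \<ge> 0"
  proof -
    have "z - x = u *\<^sub>R (y - x)" "y - z = (1 - u) *\<^sub>R (y - x)"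
      using u by (auto simp: algebra_simps)
    then show "(y - x) \<bullet> (z - x) \<ge> 0" "(y - x) \<bullet> (y - z) \<ge> 0" using u by auto
  qed
  then have "(y - x) \<bullet> x \<le> (y - x) \<bullet> z" "(y - x) \<bullet> z \<le> (y - x) \<bullet> y"
    by (auto simp: inner_diff_right)
  then obtain w where w: "w \<in> S" "(y - x) \<bullet> w = (y - x) \<bullet> z"
    using connected_ivt_hyperplane[OF S(1) xy] by blast
  have "\<exists>t. p = a + t *\<^sub>R (b - a)" if "p \<in> closed_segment a b" for p
    using that by (auto simp: closed_segment_def algebra_simps)
  then obtain tx ty tz tw where t: "x = a + tx *\<^sub>R (b - a)" "y = a + ty *\<^sub>R (b - a)"
      "z = a + tz *\<^sub>R (b - a)" "w = a + tw *\<^sub>R (b - a)"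
    using S xy zab w by (meson subsetD)
  have "y - x = (ty - tx) *\<^sub>R (b - a)" "w - z = (tw - tz) *\<^sub>R (b - a)"
    unfolding t by (auto simp: algebra_simps)
  moreover have "(y - x) \<bullet> (w - z) = 0" using w by (simp add: inner_diff_right)
  ultimately have "(ty - tx) * (tw - tz) * ((b - a) \<bullet> (b - a)) = 0"
    by (simp only: inner_scaleR_left inner_scaleR_right mult.assoc mult.left_commute)
  then have "ty = tx \<or> tw = tz \<or> b = a" by (metis inner_eq_zero_iff mult_eq_0_iff right_minus_eq)
  then consider "y = x" | "w = z" using t by auto
  then show "z \<in> S" using u w xy by cases auto
qed

lemma tree_arc_segment:
  assumes xy: "x \<in> closed_segment a b" "y \<in> closed_segment a b"
  shows "\<exists>g. tree_arc (closed_segment a b) x y (dist x y) g"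
proof -
  define L where "L = dist x y"
  \<comment> \<open>For \<open>x = y\<close> the division by zero makes \<open>g\<close> constant,
    as it should be.\<close>
  define g where "g t = x + (t / L) *\<^sub>R (y - x)" for t
  have dg: "dist (g s) (g t) = \<bar>s - t\<bar>" if "s \<in> {0..L}" "t \<in> {0..L}" for s t
  proof (cases "L = 0")
    case False
    have "g s - g t = ((s - t) / L) *\<^sub>R (y - x)" by (simp add: g_def algebra_simps diff_divide_distrib)
    then have "dist (g s) (g t) = \<bar>s - t\<bar> / \<bar>L\<bar> * L"
      by (simp add: dist_norm L_def norm_minus_commute)
    then show ?thesis using False by (simp add: L_def)
  qed (use that in auto)
  have L: "0 \<le> L" by (simp add: L_def)
  have e: "g 0 = x" "g L = y" by (auto simp: g_def L_def)
  have gs: "g ` {0..L} \<subseteq> closed_segment x y"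
  proof (rule image_subsetI)
    fix t assume "t \<in> {0..L}"
    then have "0 \<le> t / L" "t / L \<le> 1" by (auto simp: divide_le_eq_1)
    moreover have "g t = (1 - t / L) *\<^sub>R x + (t / L) *\<^sub>R y" by (simp add: g_def algebra_simps)
    ultimately show "g t \<in> closed_segment x y" by (auto simp: closed_segment_def)
  qed
  have "rect_curve (closed_segment a b) x y L g"
    unfolding rect_curve_def
  proof (intro conjI L e)
    show "g ` {0..L} \<subseteq> closed_segment a b"
      using gs xy by (meson closed_segment_subset convex_closed_segment subset_trans)
    show "1-lipschitz_on {0..L} g" by (intro lipschitz_onI) (auto simp: dg dist_real_def)
  qed
  moreover have "inj_on g {0..L}"
  proof (rule inj_onI)
    fix s t assume "s \<in> {0..L}" "t \<in> {0..L}" "g s = g t"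
    then show "s = t" using dg[of s t] by simp
  qed
  moreover have "polygonal g 0 L" by (intro polygonal.segment) (auto simp: dg L)
  moreover have "g ` {0..L} \<subseteq> path_image h" if "joins_in (closed_segment a b) x y h" for h
  proof -
    have "closed_segment x y \<subseteq> path_image h"
      using that by (intro connected_covers_segment[of _ a b]) (auto simp: joins_in_def intro: connected_path_image)
    then show ?thesis using gs by blast
  qed
  ultimately show ?thesis unfolding tree_arc_def L_def[symmetric] by blast
qed

lemma is_tree_segment: "is_tree (closed_segment a b)"
  unfolding is_tree_def using tree_arc_segment by blast

lemma tdist_segment:
  assumes X: "is_tree X" and s: "closed_segment x y \<subseteq> X"
  shows "tdist X x y = dist x y"
proof -
  have "tdist (closed_segment x y) x y = dist x y"
    using tree_arc_segment[of x x y y] tdist_tree_arc by fastforce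
  then show ?thesis using tdist_subset[OF is_tree_segment X s, of x y] by simp
qed

section \<open>The cable systems as trees\<close>

text \<open>Half the side of the square with corners \<open>vq 1\<close> to
  \<open>vq 4\<close>.\<close>

definition vh :: real where "vh = sqrt 2 / 2"

definition vsquare :: "(real \<times> real) set" where
  "vsquare = {-vh..vh} \<times> {-vh..vh}"

text \<open>The corners are numbered cyclically, so a shift by two leads to the opposite
  corner.\<close>

definition vopp :: "nat \<Rightarrow> nat" where "vopp i = (if i \<le> 2 then i + 2 else i - 2)"

text \<open>The only point that corner cell \<open>i\<close> shares with the central cell.\<close>

definition vjoint :: "nat \<Rightarrow> real \<times> real" where "vjoint i = (1/3) *\<^sub>R vq i"

lemma vh_pos: "0 < vh" and vh_sq: "vh * vh = 1 / 2"
  by (auto simp: vh_def)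

lemma vq_simps:
  "vq (Suc 0) = (- vh, vh)" "vq 1 = (- vh, vh)" "vq 2 = (vh, vh)" "vq 3 = (vh, - vh)"
  "vq 4 = (- vh, - vh)" "vq 5 = (0, 0)"
  by (auto simp: vq_def vh_def)

lemma index4: "i \<in> {1..4::nat} \<longleftrightarrow> i = 1 \<or> i = 2 \<or> i = 3 \<or> i = 4"
  by auto

lemma index5: "i \<in> {1..5::nat} \<longleftrightarrow> i = 1 \<or> i = 2 \<or> i = 3 \<or> i = 4 \<or> i = 5"
  by auto

lemma norm_vq: "i \<in> {1..4} \<Longrightarrow> norm (vq i) = 1"
  unfolding index4 using vh_sq by (elim disjE) (simp_all add: vq_simps norm_prod_def power2_eq_square)

lemma vpsi_affine: "vpsi i z = (1/3) *\<^sub>R z + (2/3) *\<^sub>R vq i"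
  by (cases "vq i", cases z) (simp add: vpsi_def field_simps)

lemma vpsi_components:
  "fst (vpsi i z) = (fst z + 2 * fst (vq i)) / 3" "snd (vpsi i z) = (snd z + 2 * snd (vq i)) / 3"
  by (auto simp: vpsi_affine field_simps)

lemma dist_vpsi: "dist (vpsi i u) (vpsi i v) = (1/3) * dist u v"
proof -
  have "vpsi i u - vpsi i v = (1/3) *\<^sub>R (u - v)" by (simp add: vpsi_affine algebra_simps)
  then show ?thesis by (simp add: dist_norm)
qed

lemma vpsi_inj: "vpsi i u = vpsi i v \<longleftrightarrow> u = v"
  by (simp add: vpsi_affine)

lemma continuous_on_vpsi: "continuous_on A (vpsi i)"
  unfolding vpsi_affine[abs_def] by (intro continuous_intros)

lemma vq5: "vq 5 = 0"
  by (simp add: vq_simps zero_prod_def)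

lemma vq_opp: "i \<in> {1..4} \<Longrightarrow> vq (vopp i) = - vq i"
  unfolding index4 by (elim disjE) (simp_all add: vopp_def vq_def)

lemma vjoint_eq: "i \<in> {1..4} \<Longrightarrow> vpsi i (vq (vopp i)) = vjoint i" "vpsi 5 (vq i) = vjoint i"
  using scaleR_left_distrib[of "- 1 / 3" "2 / 3" "vq i"]
  by (simp_all add: vq_opp vq5 vpsi_affine vjoint_def)

lemma vq_fixed: "vpsi i (vq i) = vq i"
  by (simp add: vpsi_def)

lemma vopp_index: "i \<in> {1..4} \<Longrightarrow> vopp i \<in> {1..4}"
  by (auto simp: vopp_def)

lemma vq_in_square: "vq i \<in> vsquare"
  using vh_pos by (auto simp: vq_def vsquare_def vh_def[symmetric])

lemma bounded_vsquare: "bounded vsquare"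
  unfolding vsquare_def by (intro bounded_Times) auto

lemma vpsi_square:
  assumes "z \<in> vsquare"
  shows "vpsi i z \<in> vsquare"
  using assms vq_in_square[of i] unfolding vsquare_def mem_Times_iff vpsi_components by auto

text \<open>For two corner cells the equation would need a coordinate difference of
  \<open>4 * vh\<close> inside a square of side \<open>2 * vh\<close>. Against the central cell it
  forces \<open>x\<close> to be the corner opposite to \<open>vq i\<close>.\<close>

lemma vcell_inter:
  assumes "i \<in> {1..4}" "j \<in> {1..5}" "j \<noteq> i" "x \<in> vsquare" "y \<in> vsquare" "vpsi i x = vpsi j y"
  shows "vpsi i x = vjoint i"
proof -
  have eq: "fst x + 2 * fst (vq i) = fst y + 2 * fst (vq j)" "snd x + 2 * snd (vq i) = snd y + 2 * snd (vq j)"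
    using arg_cong[OF assms(6), of fst] arg_cong[OF assms(6), of snd] by (auto simp: vpsi_components)
  have b: "- vh \<le> fst x" "fst x \<le> vh" "- vh \<le> snd x" "snd x \<le> vh"
     "- vh \<le> fst y" "fst y \<le> vh" "- vh \<le> snd y" "snd y \<le> vh"
    using assms(4,5) by (auto simp: vsquare_def mem_Times_iff)
  have "fst x + 2 * fst (vq i) = fst (vq i) \<and> snd x + 2 * snd (vq i) = snd (vq i)"
    using assms(1,2,3) eq b vh_pos unfolding index4 index5
    by (elim disjE) (simp_all add: vq_simps)
  then show ?thesis by (auto simp: prod_eq_iff vpsi_components vjoint_def)
qed

lemma vcable_in_square: "vcable n \<subseteq> vsquare"
proof (induction n)
  case 0
  have "convex vsquare" unfolding vsquare_def by (intro convex_Times convex_real_interval)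
  then show ?case using vq_in_square by (auto dest!: closed_segment_subset[rotated 2])
next
  case (Suc n)
  then show ?case using vpsi_square by auto
qed

lemma compact_vcable: "compact (vcable n)"
  by (induction n) (auto intro!: compact_UN compact_continuous_image continuous_on_vpsi)

lemma closed_vcable: "closed (vcable n)"
  using compact_vcable by (rule compact_imp_closed)

lemma vq_in_vcable: "i \<in> {1..5} \<Longrightarrow> vq i \<in> vcable n"
proof (induction n)
  case 0
  then have "i \<in> {1..4} \<or> i = 5" by auto
  moreover have "(1::nat) \<in> {1..4}" by simp
  ultimately show ?case unfolding vcable.simps by blast
next
  case (Suc n)
  then have "vpsi i (vq i) \<in> vcable (Suc n)" unfolding vcable.simps by blast
  then show ?case by (simp only: vq_fixed)
qed

lemma vcable_Suc_mono: "vcable n \<subseteq> vcable (Suc n)"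
proof (induction n)
  case 0
  have "z \<in> vcable (Suc 0)" if i: "i \<in> {1..4}" and z: "z \<in> closed_segment (vq 5) (vq i)" for z i
  proof -
    obtain u where u: "0 \<le> u" "u \<le> 1" "z = u *\<^sub>R vq i"
      using z by (auto simp: closed_segment_def vq5)
    have in1: "vpsi k w \<in> vcable (Suc 0)"
      if "k \<in> {1..5}" "j \<in> {1..4}" "w = v *\<^sub>R vq j" "0 \<le> v" "v \<le> 1" for k j v w
    proof -
      have "w \<in> closed_segment (vq 5) (vq j)"
        using that by (auto simp: closed_segment_def vq5)
      then show ?thesis using that(1,2) unfolding vcable.simps by blast
    qed
    \<comment> \<open>The arm is cut into thirds: the inner one belongs to the central cell, the
      other two to cell \<open>i\<close>, where the middle one joins the centre of that cell to the
      corner facing the origin.\<close>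
    consider "u \<le> 1/3" | "1/3 \<le> u" "u \<le> 2/3" | "2/3 \<le> u" by linarith
    then show ?thesis
    proof cases
      case 1
      have "z = vpsi 5 ((3 * u) *\<^sub>R vq i)" by (simp add: u vpsi_affine vq5)
      then show ?thesis using in1[of 5 i _ "3 * u"] 1 u i by auto
    next
      case 2
      have "vpsi i ((2 - 3 * u) *\<^sub>R vq (vopp i)) = (- (2 - 3 * u) / 3 + 2 / 3) *\<^sub>R vq i"
        unfolding vpsi_affine vq_opp[OF i] scaleR_left_distrib
        by (simp add: scaleR_minus_left[symmetric] minus_divide_left del: scaleR_minus_left)
      then have "z = vpsi i ((2 - 3 * u) *\<^sub>R vq (vopp i))" using u by (simp add: field_simps)
      then show ?thesis using in1[of i "vopp i" _ "2 - 3 * u"] 2 u i vopp_index[OF i] by auto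
    next
      case 3
      have "vpsi i ((3 * u - 2) *\<^sub>R vq i) = ((3 * u - 2) / 3 + 2 / 3) *\<^sub>R vq i"
        unfolding vpsi_affine scaleR_left_distrib by simp
      then have "z = vpsi i ((3 * u - 2) *\<^sub>R vq i)" using u by (simp add: field_simps)
      then show ?thesis using in1[of i i _ "3 * u - 2"] 3 u i by auto
    qed
  qed
  then show ?case unfolding vcable.simps(1) by blast
next
  case (Suc n)
  then have "(\<Union>i\<in>{1..5}. vpsi i ` vcable n) \<subseteq> (\<Union>i\<in>{1..5}. vpsi i ` vcable (Suc n))"
    by (intro UN_mono image_mono order_refl)
  then show ?case by (simp only: vcable.simps(2))
qed

lemma vcable_mono: "m \<le> n \<Longrightarrow> vcable m \<subseteq> vcable n"
  by (rule lift_Suc_mono_le[of vcable]) (rule vcable_Suc_mono)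

lemma vcell_inter_union:
  assumes i: "i \<in> {1..4}" and J: "J \<subseteq> {1..5} - {i}" "5 \<in> J"
    and X: "X \<subseteq> vsquare" "\<And>k. k \<in> {1..4} \<Longrightarrow> vq k \<in> X"
  shows "vpsi i ` X \<inter> (\<Union>j\<in>J. vpsi j ` X) = {vjoint i}"
proof (rule antisym)
  show "vpsi i ` X \<inter> (\<Union>j\<in>J. vpsi j ` X) \<subseteq> {vjoint i}"
  proof
    fix z assume "z \<in> vpsi i ` X \<inter> (\<Union>j\<in>J. vpsi j ` X)"
    then obtain x j y where "x \<in> X" "z = vpsi i x" "j \<in> J" "y \<in> X" "z = vpsi j y" by blast
    moreover from this have "j \<in> {1..5}" "j \<noteq> i" "x \<in> vsquare" "y \<in> vsquare" using J(1) X(1) by auto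
    ultimately show "z \<in> {vjoint i}" using vcell_inter[OF i, of j x y] by auto
  qed
  have "vjoint i \<in> vpsi i ` X"
    unfolding vjoint_eq(1)[OF i, symmetric] using X(2)[OF vopp_index[OF i]] by blast
  moreover have "vjoint i \<in> vpsi 5 ` X"
    unfolding vjoint_eq(2)[of i, symmetric] using X(2)[OF i] by blast
  ultimately show "{vjoint i} \<subseteq> vpsi i ` X \<inter> (\<Union>j\<in>J. vpsi j ` X)" using J(2) by blast
qed

text \<open>Corner cells are attached to the central one in turn; by
  \<open>vcell_inter_union\<close> each attachment is a gluing at a single point.\<close>

lemma is_tree_cells:
  assumes X: "closed X" "is_tree X" "X \<subseteq> vsquare" "\<And>k. k \<in> {1..4} \<Longrightarrow> vq k \<in> X"
    and J: "J \<subseteq> {1..4}"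
  shows "is_tree (\<Union>j\<in>insert 5 J. vpsi j ` X) \<and> closed (\<Union>j\<in>insert 5 J. vpsi j ` X)"
proof -
  have cell: "is_tree (vpsi j ` X)" for j
    by (rule is_tree_image(1)[OF X(2), of "1/3"]) (auto simp: dist_vpsi)
  have "compact X" using X(1,3) bounded_subset[OF bounded_vsquare] by (simp add: compact_eq_bounded_closed)
  then have cl: "closed (vpsi j ` X)" for j
    by (intro compact_imp_closed compact_continuous_image continuous_on_vpsi)
  have "finite J" using J finite_subset by blast
  then show ?thesis using J
  proof (induction J)
    case empty
    then show ?case using cell cl by simp
  next
    case (insert i J)
    have "(\<Union>j\<in>insert 5 (insert i J). vpsi j ` X) = vpsi i ` X \<union> (\<Union>j\<in>insert 5 J. vpsi j ` X)"
      by auto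
    moreover have "vpsi i ` X \<inter> (\<Union>j\<in>insert 5 J. vpsi j ` X) = {vjoint i}"
      using insert by (intro vcell_inter_union X) auto
    moreover have "is_tree (\<Union>j\<in>insert 5 J. vpsi j ` X)" "closed (\<Union>j\<in>insert 5 J. vpsi j ` X)"
      using insert by auto
    ultimately show ?case using is_tree_glue[OF cl cell, of "\<Union>j\<in>insert 5 J. vpsi j ` X" i "vjoint i"] cl
      by (simp only: closed_Un simp_thms)
  qed
qed

lemma vsegment_inter:
  assumes "i \<in> {1..4}" "j \<in> {1..4}" "i \<noteq> j"
    "z \<in> closed_segment (vq 5) (vq i)" "z \<in> closed_segment (vq 5) (vq j)"
  shows "z = vq 5"
proof -
  obtain u v where uv: "0 \<le> u" "0 \<le> v" "z = u *\<^sub>R vq i" "z = v *\<^sub>R vq j"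
    using assms(4,5) unfolding closed_segment_def vq5 by auto
  have "u *\<^sub>R vq i = v *\<^sub>R vq j" using uv by simp
  moreover have "0 \<le> u * vh" "0 \<le> v * vh" using uv vh_pos by auto
  ultimately have "u * vh \<le> 0"
    using assms(1-3) unfolding index4
    by (elim disjE) (auto simp: vq_simps simp del: mult_cancel_left mult_cancel_right
        mult_le_0_iff zero_le_mult_iff)
  with \<open>0 \<le> u * vh\<close> have "u * vh = 0" by simp
  then show ?thesis using uv vh_pos by (simp add: vq5)
qed

lemma is_tree_star:
  assumes "finite J" "J \<noteq> {}" "J \<subseteq> {1..4}"
  shows "is_tree (\<Union>i\<in>J. closed_segment (vq 5) (vq i))"
  using assms
proof (induction J rule: finite_ne_induct)
  case (singleton i)
  then show ?case using is_tree_segment by simp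
next
  case (insert i J)
  have "closed_segment (vq 5) (vq i) \<inter> (\<Union>i\<in>J. closed_segment (vq 5) (vq i)) = {vq 5}"
  proof (rule antisym)
    show "closed_segment (vq 5) (vq i) \<inter> (\<Union>i\<in>J. closed_segment (vq 5) (vq i)) \<subseteq> {vq 5}"
    proof
      fix z assume z: "z \<in> closed_segment (vq 5) (vq i) \<inter> (\<Union>i\<in>J. closed_segment (vq 5) (vq i))"
      then obtain j where j: "j \<in> J" "z \<in> closed_segment (vq 5) (vq j)" by blast
      then have "j \<in> {1..4}" "i \<noteq> j" "i \<in> {1..4}" using insert by auto
      then show "z \<in> {vq 5}" using vsegment_inter[of i j z] z j by blast
    qed
  qed (use insert in auto)
  moreover have "closed (\<Union>i\<in>J. closed_segment (vq 5) (vq i))" using insert by auto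
  ultimately show ?case
    using is_tree_glue[OF closed_segment is_tree_segment, of "\<Union>i\<in>J. closed_segment (vq 5) (vq i)"] insert
    by simp
qed

lemma is_tree_vcable: "is_tree (vcable n)"
proof (induction n)
  case 0
  then show ?case using is_tree_star[of "{1..4}"] by simp
next
  case (Suc n)
  have "{1..5} = insert 5 {1..4::nat}" by auto
  then show ?case
    using is_tree_cells[OF closed_vcable Suc vcable_in_square vq_in_vcable, of "{1..4}"] by auto
qed

section \<open>Distance on the skeleton and its additivity at joints\<close>

lemma skeleton_dist_eq:
  assumes "x \<in> vcable n" "y \<in> vcable n"
  shows "skeleton_dist x y = tdist (vcable n) x y"
proof -
  have "l = ereal (tdist (vcable n) x y)" if "geodesic_in (vcable m) x y g" "l = curve_length g" for l m g
  proof -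
    have xy: "x \<in> vcable m" "y \<in> vcable m"
      using that(1) joins_in_endpoints[of "vcable m" x y g] by (auto simp: geodesic_in_def)
    have "tdist (vcable m) x y = tdist (vcable n) x y"
      using tdist_subset[OF is_tree_vcable is_tree_vcable vcable_mono, of m n x y]
        tdist_subset[OF is_tree_vcable is_tree_vcable vcable_mono, of n m x y] xy assms
      by (cases "m \<le> n") auto
    then show ?thesis using geodesic_in_length[OF is_tree_vcable that(1)] that(2) by simp
  qed
  moreover obtain g where "geodesic_in (vcable n) x y g" "curve_length g = ereal (tdist (vcable n) x y)"
    using is_tree_rect[OF is_tree_vcable assms] rect_curve_geodesic_in[OF is_tree_vcable]
      geodesic_in_length[OF is_tree_vcable] by blast
  ultimately have "(THE l. \<exists>n g. geodesic_in (vcable n) x y g \<and> l = curve_length g) =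
      ereal (tdist (vcable n) x y)"
    by (intro the_equality) metis+
  then show ?thesis by (simp add: skeleton_dist_def)
qed

lemma vcable_subset_skeleton: "vcable n \<subseteq> vskeleton"
  by (auto simp: vskeleton_def)

lemma skeleton_common_level:
  assumes "finite F" "F \<subseteq> vskeleton"
  obtains n where "F \<subseteq> vcable n"
proof -
  have "\<exists>n. F \<subseteq> vcable n" using assms
  proof (induction F)
    case (insert x F)
    then obtain n m where "F \<subseteq> vcable n" "x \<in> vcable m" by (auto simp: vskeleton_def)
    then have "insert x F \<subseteq> vcable (max n m)"
      using vcable_mono[of n "max n m"] vcable_mono[of m "max n m"] by auto
    then show ?case by blast
  qed simp
  then show ?thesis using that by blast
qed

lemma skeleton_dist_triangle:
  assumes "x \<in> vskeleton" "y \<in> vskeleton" "z \<in> vskeleton"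
  shows "skeleton_dist x z \<le> skeleton_dist x y + skeleton_dist y z"
proof -
  obtain n where "{x, y, z} \<subseteq> vcable n" using skeleton_common_level[of "{x, y, z}"] assms by auto
  then show ?thesis
    using tdist_triangle[OF is_tree_vcable, of x n y z] by (simp add: skeleton_dist_eq[of _ n])
qed

lemma skeleton_dist_pair:
  assumes "x \<in> vskeleton" "y \<in> vskeleton"
  shows "dist x y \<le> skeleton_dist x y" "skeleton_dist y x = skeleton_dist x y"
    "skeleton_dist x x = 0" "0 \<le> skeleton_dist x y"
proof -
  obtain n where "{x, y} \<subseteq> vcable n" using skeleton_common_level[of "{x, y}"] assms by auto
  then show "dist x y \<le> skeleton_dist x y" "skeleton_dist y x = skeleton_dist x y"
    "skeleton_dist x x = 0" "0 \<le> skeleton_dist x y"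
    using dist_le_tdist[OF is_tree_vcable, of x n y] tdist_sym[OF is_tree_vcable, of x n y]
      tdist_refl[OF _ is_tree_vcable, of x n] tdist_nonneg[OF is_tree_vcable, of x n y]
    by (simp_all add: skeleton_dist_eq[of _ n])
qed

lemma vpsi_skeleton: "i \<in> {1..5} \<Longrightarrow> x \<in> vskeleton \<Longrightarrow> vpsi i x \<in> vskeleton"
  proof -
  assume "i \<in> {1..5}" "x \<in> vskeleton"
  then obtain n where "vpsi i x \<in> vcable (Suc n)" unfolding vskeleton_def vcable.simps by blast
  then show ?thesis using vcable_subset_skeleton by blast
qed

lemma skeleton_dist_vpsi:
  assumes "i \<in> {1..5}" "x \<in> vskeleton" "y \<in> vskeleton"
  shows "skeleton_dist (vpsi i x) (vpsi i y) = skeleton_dist x y / 3"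
proof -
  obtain n where n: "{x, y} \<subseteq> vcable n" using skeleton_common_level[of "{x, y}"] assms by auto
  have sub: "vpsi i ` vcable n \<subseteq> vcable (Suc n)" using assms(1) by auto
  have t: "is_tree (vpsi i ` vcable n)"
    by (rule is_tree_image(1)[OF is_tree_vcable _ dist_vpsi]) simp
  have t2: "tdist (vpsi i ` vcable n) (vpsi i x) (vpsi i y) = 1/3 * tdist (vcable n) x y"
    by (rule is_tree_image(2)[OF is_tree_vcable _ dist_vpsi]) (use n in auto)
  have "skeleton_dist (vpsi i x) (vpsi i y) = tdist (vcable (Suc n)) (vpsi i x) (vpsi i y)"
    using n sub by (intro skeleton_dist_eq) auto
  also have "\<dots> = tdist (vpsi i ` vcable n) (vpsi i x) (vpsi i y)"
    using tdist_subset[OF t is_tree_vcable sub] n by auto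
  finally show ?thesis using t2 n by (simp add: skeleton_dist_eq[of _ n])
qed

text \<open>At level \<open>Suc n\<close> the joint is all that cell \<open>i\<close> shares with
  the union of the other cells, so every path between them runs through it.\<close>

lemma skeleton_dist_joint:
  assumes i: "i \<in> {1..4}" and j: "j \<in> {1..5}" "j \<noteq> i" and xy: "x \<in> vskeleton" "y \<in> vskeleton"
  shows "skeleton_dist (vpsi i x) (vpsi j y) =
    skeleton_dist (vpsi i x) (vjoint i) + skeleton_dist (vjoint i) (vpsi j y)"
proof -
  obtain n where n: "{x, y} \<subseteq> vcable n" using skeleton_common_level[of "{x, y}"] xy by auto
  let ?X = "vpsi i ` vcable n" and ?Y = "\<Union>j\<in>{1..5} - {i}. vpsi j ` vcable n"
  have "i \<in> {1..5}" using i by auto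
  then have un: "vcable (Suc n) = ?X \<union> ?Y" unfolding vcable.simps by blast
  have "closed (vpsi k ` vcable n)" for k
    by (intro compact_imp_closed compact_continuous_image continuous_on_vpsi compact_vcable)
  then have cl: "closed ?X" "closed ?Y" by auto
  have int: "?X \<inter> ?Y = {vjoint i}"
    by (rule vcell_inter_union[OF i _ _ vcable_in_square]) (use i vq_in_vcable in auto)
  have x: "vpsi i x \<in> ?X" and y: "vpsi j y \<in> ?Y" using n j by blast+
  have "tdist (vcable (Suc n)) (vpsi i x) (vpsi j y) =
      tdist (vcable (Suc n)) (vpsi i x) (vjoint i) + tdist (vcable (Suc n)) (vjoint i) (vpsi j y)"
  proof (rule tdist_cut[OF is_tree_vcable])
    fix h assume h: "joins_in (vcable (Suc n)) (vpsi i x) (vpsi j y) h"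
    then have "vpsi i x \<in> path_image h" "vpsi j y \<in> path_image h"
      unfolding joins_in_def using pathstart_in_path_image pathfinish_in_path_image by metis+
    then show "vjoint i \<in> path_image h"
      using glue_crossing[OF cl int h[unfolded un]] x y by blast
  qed (use un x y in blast)+
  moreover have "vjoint i \<in> vcable (Suc n)" "vpsi i x \<in> vcable (Suc n)" "vpsi j y \<in> vcable (Suc n)"
    unfolding un using int x y by blast+
  ultimately show ?thesis by (simp only: skeleton_dist_eq[of _ "Suc n"])
qed

lemma skeleton_dist_segment:
  assumes "closed_segment x y \<subseteq> vcable n"
  shows "skeleton_dist x y = dist x y"
proof -
  have "x \<in> vcable n" "y \<in> vcable n" using assms by auto
  then show ?thesis using tdist_segment[OF is_tree_vcable assms] by (simp add: skeleton_dist_eq[of _ n])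
qed

lemma skeleton_dist_star:
  assumes ij: "i \<in> {1..4}" "j \<in> {1..4}" "i \<noteq> j"
    and x: "x \<in> closed_segment (vq 5) (vq i)" and y: "y \<in> closed_segment (vq 5) (vq j)"
  shows "skeleton_dist x y = skeleton_dist x (vq 5) + skeleton_dist (vq 5) y"
proof -
  let ?X = "closed_segment (vq 5) (vq i)" and ?Y = "\<Union>j\<in>{1..4} - {i}. closed_segment (vq 5) (vq j)"
  have un: "vcable 0 = ?X \<union> ?Y" using ij unfolding vcable.simps by blast
  have int: "?X \<inter> ?Y = {vq 5}"
  proof -
    have "?X \<inter> ?Y \<subseteq> {vq 5}" using vsegment_inter[OF ij(1)] by blast
    moreover have "vq 5 \<in> ?Y" using ij by blast
    ultimately show ?thesis by blast
  qed
  have clY: "closed ?Y" by auto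
  have y': "y \<in> ?Y" using ij y by blast
  have "tdist (vcable 0) x y = tdist (vcable 0) x (vq 5) + tdist (vcable 0) (vq 5) y"
  proof (rule tdist_cut[OF is_tree_vcable])
    fix h assume h: "joins_in (vcable 0) x y h"
    then have "x \<in> path_image h" "y \<in> path_image h"
      unfolding joins_in_def using pathstart_in_path_image pathfinish_in_path_image by metis+
    then show "vq 5 \<in> path_image h"
      using glue_crossing[OF closed_segment clY int h[unfolded un]] x y' by blast
  qed (use un x y' in blast)+
  moreover have "x \<in> vcable 0" "y \<in> vcable 0" "vq 5 \<in> vcable 0"
    unfolding un using int x y' by blast+
  ultimately show ?thesis by (simp only: skeleton_dist_eq[of _ 0])
qed

section \<open>The geodesic distance and its extension\<close>

text \<open>The taxicab distance. Unlike the Euclidean one it is additive along triples that are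
  monotone in both coordinates, and this is the position of two points on either side of a
  joint.\<close>

definition vl1 :: "real \<times> real \<Rightarrow> real \<times> real \<Rightarrow> real" where
  "vl1 x y = \<bar>fst x - fst y\<bar> + \<bar>snd x - snd y\<bar>"

text \<open>Strong enough for \<open>2/3 * vh > 2/5\<close> in the distance comparison and for
  \<open>1 + vh < 3 * vh\<close> in the count of cells.\<close>

lemma vh_gt: "3/5 < vh"
proof (rule ccontr)
  assume "\<not> 3/5 < vh"
  then have "vh * vh \<le> (3/5) * (3/5)" using vh_pos by (intro mult_mono) auto
  then show False using vh_sq by simp
qed

lemma vl1_ge:
  "fst x - fst y \<le> vl1 x y" "fst y - fst x \<le> vl1 x y"
  "snd x - snd y \<le> vl1 x y" "snd y - snd x \<le> vl1 x y"
  by (auto simp: vl1_def)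

lemma dist_le_vl1: "dist x y \<le> vl1 x y"
  using sqrt_sum_squares_le_sum_abs[of "fst x - fst y" "snd x - snd y"]
  by (simp add: dist_prod_def dist_real_def vl1_def)

lemma vl1_le_dist: "vl1 x y \<le> 2 * dist x y"
  using dist_fst_le[of x y] dist_snd_le[of x y] by (simp add: dist_real_def vl1_def)

lemma vl1_sym: "vl1 x y = vl1 y x"
  by (simp add: vl1_def)

lemma vl1_vpsi: "vl1 (vpsi i x) (vpsi i y) = vl1 x y / 3"
proof -
  have "\<bar>(a + c) / 3 - (b + c) / 3\<bar> = \<bar>a - b\<bar> / 3" for a b c :: real
    by (simp add: diff_divide_distrib[symmetric])
  then show ?thesis unfolding vl1_def vpsi_components by (simp only: add_divide_distrib[of "\<bar>_\<bar>"])
qed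

lemma vstar_vl1:
  assumes x: "x \<in> vcable 0" and y: "y \<in> vcable 0"
  shows "skeleton_dist x y \<le> 5 * vl1 x y"
proof -
  obtain i j where i: "i \<in> {1..4}" "x \<in> closed_segment (vq 5) (vq i)"
      and j: "j \<in> {1..4}" "y \<in> closed_segment (vq 5) (vq j)"
    using x y unfolding vcable.simps by blast
  have nn: "0 \<le> vl1 x y" by (simp add: vl1_def)
  have seg: "closed_segment u w \<subseteq> vcable 0"
    if "k \<in> {1..4}" "u \<in> closed_segment (vq 5) (vq k)" "w \<in> closed_segment (vq 5) (vq k)" for k u w
    using that closed_segment_subset[OF that(2,3)] unfolding vcable.simps by blast
  show ?thesis
  proof (cases "i = j")
    case True
    then have "skeleton_dist x y = dist x y"
      using skeleton_dist_segment[OF seg[of i x y]] i j by simp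
    then show ?thesis using dist_le_vl1[of x y] nn by linarith
  next
    case False
    obtain u v where uv: "0 \<le> u" "0 \<le> v" "x = u *\<^sub>R vq i" "y = v *\<^sub>R vq j"
      using i(2) j(2) unfolding closed_segment_def vq5 by auto
    have "skeleton_dist x (vq 5) = dist x (vq 5)" "skeleton_dist (vq 5) y = dist (vq 5) y"
      using skeleton_dist_segment[OF seg[of i x "vq 5"]] skeleton_dist_segment[OF seg[of j "vq 5" y]] i j
      by auto
    then have "skeleton_dist x y = u + v"
      using skeleton_dist_star[OF i(1) j(1) False i(2) j(2)] uv norm_vq[OF i(1)] norm_vq[OF j(1)]
      by (simp add: vq5)
    moreover have "0 \<le> u * vh" "0 \<le> v * vh" using uv vh_pos by auto
    \<comment> \<open>Two different arms have opposite signs in some coordinate, so their components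
      there add up.\<close>
    then have "u * vh + v * vh \<le> vl1 x y"
      using i(1) j(1) False vl1_ge[where x = x and y = y] unfolding uv(3,4) index4
      by (elim disjE) (simp_all add: vq_simps)
    moreover have "(u + v) * (3/5) \<le> (u + v) * vh" using vh_gt uv by (intro mult_left_mono) auto
    ultimately show ?thesis using uv by (simp add: algebra_simps)
  qed
qed

lemma vcable_Suc_cases:
  assumes "x \<in> vcable (Suc n)"
  obtains i x' where "i \<in> {1..5}" "x' \<in> vcable n" "x = vpsi i x'"
  using assms unfolding vcable.simps by blast

lemma vq_in_skeleton: "i \<in> {1..5} \<Longrightarrow> vq i \<in> vskeleton"
  using vq_in_vcable vcable_subset_skeleton by blast

lemma vjoint_in_skeleton: "i \<in> {1..4} \<Longrightarrow> vjoint i \<in> vskeleton"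
  using vpsi_skeleton[of 5 "vq i"] vq_in_skeleton[of i] vjoint_eq(2)[of i] by simp

lemma zero_in_skeleton: "0 \<in> vskeleton"
  using vq_in_skeleton[of 5] by (simp add: vq5)

text \<open>The bound reproduces itself: at most \<open>1/3\<close> inside a cell, and
  \<open>2/3\<close> from the centre of a corner cell to the origin.\<close>

lemma skeleton_dist_center_le: "x \<in> vcable n \<Longrightarrow> skeleton_dist x 0 \<le> 1"
proof (induction n arbitrary: x)
  case 0
  then obtain i where i: "i \<in> {1..4}" "x \<in> closed_segment (vq 5) (vq i)" unfolding vcable.simps by blast
  have "closed_segment x 0 \<subseteq> closed_segment (vq 5) (vq i)"
    using i(2) by (intro closed_segment_subset) (auto simp: vq5)
  then have "closed_segment x 0 \<subseteq> vcable 0" using i(1) unfolding vcable.simps by blast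
  then have "skeleton_dist x 0 = dist x 0" by (rule skeleton_dist_segment)
  also have "\<dots> \<le> 1" using i norm_vq[OF i(1)] by (auto simp: closed_segment_def vq5)
  finally show ?case .
next
  case (Suc n)
  then obtain i x' where i: "i \<in> {1..5}" "x' \<in> vcable n" "x = vpsi i x'" by (auto elim: vcable_Suc_cases)
  have x': "x' \<in> vskeleton" using i vcable_subset_skeleton by blast
  have le: "skeleton_dist x (vpsi i 0) \<le> 1 / 3"
    using skeleton_dist_vpsi[OF i(1) x' zero_in_skeleton] Suc.IH[OF i(2)] i(3) by simp
  show ?case
  proof (cases "i = 5")
    case True
    then show ?thesis using le by (simp add: vpsi_affine vq5)
  next
    case False
    then have i4: "i \<in> {1..4}" using i by auto
    have e: "vpsi i 0 = (2/3) *\<^sub>R vq i" by (simp add: vpsi_affine)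
    have "closed_segment (vpsi i 0) 0 \<subseteq> closed_segment (vq 5) (vq i)"
    proof (intro closed_segment_subset convex_closed_segment)
      show "vpsi i 0 \<in> closed_segment (vq 5) (vq i)"
        unfolding e vq5 closed_segment_def by (auto intro!: exI[of _ "2/3"])
    qed (simp add: vq5)
    then have "closed_segment (vpsi i 0) 0 \<subseteq> vcable 0" using i4 unfolding vcable.simps by blast
    then have "skeleton_dist (vpsi i 0) 0 = dist (vpsi i 0) 0" by (rule skeleton_dist_segment)
    also have "\<dots> = 2 / 3" using norm_vq[OF i4] by (simp add: e)
    finally show ?thesis
      using le skeleton_dist_triangle[of x "vpsi i 0" 0] vpsi_skeleton[OF i(1) x']
        vpsi_skeleton[OF i(1) zero_in_skeleton] i(3) zero_in_skeleton by simp
  qed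
qed

lemma skeleton_dist_le_2:
  assumes "x \<in> vskeleton" "y \<in> vskeleton"
  shows "skeleton_dist x y \<le> 2"
proof -
  have "skeleton_dist z 0 \<le> 1" if "z \<in> vskeleton" for z
    using that skeleton_dist_center_le unfolding vskeleton_def by blast
  then have "skeleton_dist x 0 \<le> 1" "skeleton_dist y 0 \<le> 1" using assms by auto
  then show ?thesis
    using skeleton_dist_triangle[OF assms(1) zero_in_skeleton assms(2)]
      skeleton_dist_pair(2)[OF assms(2) zero_in_skeleton] by linarith
qed

lemma vl1_add:
  assumes "fst x \<le> fst y \<and> fst y \<le> fst z \<or> fst z \<le> fst y \<and> fst y \<le> fst x"
    "snd x \<le> snd y \<and> snd y \<le> snd z \<or> snd z \<le> snd y \<and> snd y \<le> snd x"
  shows "vl1 x z = vl1 x y + vl1 y z"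
  using assms by (auto simp: vl1_def)

text \<open>Cells sit in squares of side \<open>2/3 * vh\<close>, and those of the corner cells are
  separated by gaps of that width. A corner cell and the central one touch in monotone position, so
  \<open>vl1_add\<close> applies at their joint.\<close>

lemma vl1_cells:
  assumes i: "i \<in> {1..4}" and j: "j \<in> {1..5}" "j \<noteq> i" and xy: "x \<in> vsquare" "y \<in> vsquare"
  shows "2/3 * vh \<le> vl1 (vq i) (vpsi j y)"
    "j \<noteq> 5 \<Longrightarrow> 2/3 * vh \<le> vl1 (vpsi i x) (vpsi j y)"
    "j = 5 \<Longrightarrow> vl1 (vpsi i x) (vpsi j y) = vl1 (vpsi i x) (vjoint i) + vl1 (vjoint i) (vpsi j y)"
proof -
  have b: "- vh \<le> fst x" "fst x \<le> vh" "- vh \<le> snd x" "snd x \<le> vh"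
     "- vh \<le> fst y" "fst y \<le> vh" "- vh \<le> snd y" "snd y \<le> vh"
    using xy by (auto simp: vsquare_def mem_Times_iff)
  note cases = i[unfolded index4] j(1)[unfolded index5]
  show "2/3 * vh \<le> vl1 (vq i) (vpsi j y)"
    using cases j(2) b vh_pos vl1_ge[where x = "vq i" and y = "vpsi j y"] unfolding vpsi_components
    by (elim disjE) (simp_all add: vq_simps add_divide_distrib diff_divide_distrib)
  show "2/3 * vh \<le> vl1 (vpsi i x) (vpsi j y)" if "j \<noteq> 5"
    using cases j(2) that b vh_pos vl1_ge[where x = "vpsi i x" and y = "vpsi j y"] unfolding vpsi_components
    by (elim disjE) (simp_all add: vq_simps add_divide_distrib diff_divide_distrib)
  show "vl1 (vpsi i x) (vpsi j y) = vl1 (vpsi i x) (vjoint i) + vl1 (vjoint i) (vpsi j y)" if "j = 5"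
    using cases(1) b vh_pos unfolding that
    by (intro vl1_add; elim disjE) (auto simp: vq_simps vpsi_components vjoint_def)
qed

text \<open>Corners come before general pairs because a joint is the image of a corner in both cells
  that meet there. As \<open>vpsi i\<close> fixes \<open>vq i\<close>, the induction either stays in
  cell \<open>i\<close> or meets a positive gap.\<close>

lemma skeleton_dist_corner_le:
  "x \<in> vcable n \<Longrightarrow> i \<in> {1..4} \<Longrightarrow> skeleton_dist (vq i) x \<le> 5 * vl1 (vq i) x"
proof (induction n arbitrary: x)
  case 0
  then show ?case using vq_in_vcable[of i 0] by (intro vstar_vl1) auto
next
  case (Suc n)
  then obtain j x' where j: "j \<in> {1..5}" "x' \<in> vcable n" "x = vpsi j x'" by (auto elim: vcable_Suc_cases)
  have x': "x' \<in> vskeleton" "x' \<in> vsquare" and q: "vq i \<in> vskeleton"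
    using j vcable_subset_skeleton vcable_in_square vq_in_skeleton[of i] Suc.prems by auto
  show ?case
  proof (cases "j = i")
    case True
    have "skeleton_dist (vq i) x = skeleton_dist (vq i) x' / 3"
      using skeleton_dist_vpsi[OF j(1) q x'(1)] j True by (simp add: vq_fixed)
    moreover have "vl1 (vq i) x = vl1 (vq i) x' / 3"
      using vl1_vpsi[of j "vq i" x'] j True by (simp add: vq_fixed)
    ultimately show ?thesis using Suc.IH[OF j(2) Suc.prems(2)] by simp
  next
    case False
    have "2/3 * vh \<le> vl1 (vq i) x"
      using vl1_cells(1)[OF Suc.prems(2) j(1) False x'(2,2)] j by simp
    moreover have "skeleton_dist (vq i) x \<le> 2"
      using skeleton_dist_le_2 q vpsi_skeleton[OF j(1) x'(1)] j by auto
    ultimately show ?thesis using vh_gt by linarith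
  qed
qed

text \<open>Inside one cell both sides scale by \<open>1/3\<close>, and across a joint both sides
  add. For two different corner cells the gap \<open>2/3 * vh > 2/5\<close> is set against the
  overall bound 2 for the distance, and this fixes the constant 5.\<close>

lemma skeleton_dist_le_vl1:
  "x \<in> vcable n \<Longrightarrow> y \<in> vcable n \<Longrightarrow> skeleton_dist x y \<le> 5 * vl1 x y"
proof (induction n arbitrary: x y)
  case 0
  then show ?case by (rule vstar_vl1)
next
  case (Suc n)
  have diff: "skeleton_dist (vpsi i x) (vpsi j y) \<le> 5 * vl1 (vpsi i x) (vpsi j y)"
    if i: "i \<in> {1..4}" and j: "j \<in> {1..5}" "j \<noteq> i" and n: "x \<in> vcable n" "y \<in> vcable n" for i j x y
  proof -
    have xy: "x \<in> vskeleton" "y \<in> vskeleton" "x \<in> vsquare" "y \<in> vsquare"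
      using n vcable_subset_skeleton vcable_in_square by auto
    have i5: "i \<in> {1..5}" using i by auto
    show ?thesis
    proof (cases "j = 5")
      case True
      have q: "vq i \<in> vskeleton" "vq (vopp i) \<in> vskeleton" and o: "vopp i \<in> {1..4}"
        using vq_in_skeleton vopp_index[OF i] i by auto
      have 1: "skeleton_dist (vpsi i x) (vjoint i) \<le> 5 * vl1 (vpsi i x) (vjoint i)"
        using skeleton_dist_corner_le[OF n(1) o] skeleton_dist_vpsi[OF i5 xy(1) q(2)]
          vl1_vpsi[of i x "vq (vopp i)"] vjoint_eq(1)[OF i] skeleton_dist_pair(2)[OF xy(1) q(2)]
        by (simp add: vl1_sym)
      have 2: "skeleton_dist (vjoint i) (vpsi j y) \<le> 5 * vl1 (vjoint i) (vpsi j y)"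
        using skeleton_dist_corner_le[OF n(2) i] skeleton_dist_vpsi[of 5, OF _ q(1) xy(2)]
          vl1_vpsi[of 5 "vq i" y] vjoint_eq(2)[of i] True by simp
      show ?thesis
        using 1 2 skeleton_dist_joint[OF i j xy(1,2)] vl1_cells(3)[OF i j xy(3,4) True] by simp
    next
      case False
      have "2/3 * vh \<le> vl1 (vpsi i x) (vpsi j y)"
        using vl1_cells(2)[OF i j xy(3,4) False] .
      moreover have "skeleton_dist (vpsi i x) (vpsi j y) \<le> 2"
        using skeleton_dist_le_2 vpsi_skeleton[OF i5 xy(1)] vpsi_skeleton[OF j(1) xy(2)] by blast
      ultimately show ?thesis using vh_gt by linarith
    qed
  qed
  obtain i x' j y' where i: "i \<in> {1..5}" "x' \<in> vcable n" "x = vpsi i x'"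
      and j: "j \<in> {1..5}" "y' \<in> vcable n" "y = vpsi j y'"
    using Suc.prems by (metis vcable_Suc_cases)
  have xy: "x' \<in> vskeleton" "y' \<in> vskeleton" using i j vcable_subset_skeleton by auto
  consider "i = j" | "i \<noteq> j" "i \<in> {1..4}" | "i \<noteq> j" "j \<in> {1..4}" using i(1) j(1) by fastforce
  then show ?case
  proof cases
    case 1
    then show ?thesis
      using skeleton_dist_vpsi[OF i(1) xy] vl1_vpsi[of i x' y'] Suc.IH[OF i(2) j(2)] i j by simp
  next
    case 2
    then show ?thesis using diff[of i j x' y'] i j by simp
  next
    case 3
    then show ?thesis using diff[of j i y' x'] i j
        skeleton_dist_pair(2)[OF vpsi_skeleton[OF i(1) xy(1)] vpsi_skeleton[OF j(1) xy(2)]]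
      by (simp add: vl1_sym)
  qed
qed

lemma skeleton_dist_le_dist:
  assumes "x \<in> vskeleton" "y \<in> vskeleton"
  shows "skeleton_dist x y \<le> 10 * dist x y"
proof -
  obtain n where "{x, y} \<subseteq> vcable n" using skeleton_common_level[of "{x, y}"] assms by auto
  then show ?thesis using skeleton_dist_le_vl1[of x n y] vl1_le_dist[of x y] by simp
qed

text \<open>Iterating the contractions pushes a bounded set \<open>B\<close> with \<open>B \<subseteq> (\<Union>i. vpsi i ` B)\<close>
  arbitrarily close to any set that they map to itself.\<close>

lemma vpsi_attractor:
  assumes B: "bounded B" "B \<subseteq> (\<Union>i\<in>{1..5}. vpsi i ` B)"
    and K: "closed K" "K \<noteq> {}" "(\<Union>i\<in>{1..5}. vpsi i ` K) \<subseteq> K"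
  shows "B \<subseteq> K"
proof
  fix b assume b: "b \<in> B"
  obtain k where k: "k \<in> K" using K(2) by blast
  obtain R where R: "\<forall>x\<in>B. dist k x \<le> R"
    using B(1) unfolding bounded_any_center[of _ k] by blast
  have near: "x \<in> B \<Longrightarrow> \<exists>y\<in>K. dist x y \<le> R / 3 ^ n" for x n
  proof (induction n arbitrary: x)
    case 0
    then have "dist x k \<le> R / 3 ^ 0" using R by (metis dist_commute div_by_1 power_0)
    then show ?case using k by blast
  next
    case (Suc n)
    then obtain i x' where i: "i \<in> {1..5}" "x' \<in> B" "x = vpsi i x'" using B(2) by blast
    obtain y where "y \<in> K" "dist x' y \<le> R / 3 ^ n" using Suc.IH[OF i(2)] by blast
    moreover have "vpsi i y \<in> K" using K(3) i(1) \<open>y \<in> K\<close> by blast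
    ultimately show ?case using i(3) by (intro bexI[of _ "vpsi i y"]) (simp_all add: dist_vpsi field_simps)
  qed
  have "b \<in> closure K"
  proof (unfold closure_approachable, intro allI impI)
    fix e :: real assume e: "0 < e"
    have "(\<lambda>n. R / 3 ^ n) \<longlonglongrightarrow> 0"
      using tendsto_mult_right_zero[OF LIMSEQ_realpow_zero[of "1/3"], of R]
      by (simp add: power_one_over field_simps)
    then have "eventually (\<lambda>n. R / 3 ^ n < e) sequentially" using e by (rule order_tendstoD)
    then obtain n where "R / 3 ^ n < e" by (auto simp: eventually_sequentially)
    moreover obtain y where "y \<in> K" "dist b y \<le> R / 3 ^ n" using near[OF b, of n] by blast
    ultimately show "\<exists>y\<in>K. dist y b < e" by (intro bexI[of _ y]) (auto simp: dist_commute)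
  qed
  then show "b \<in> K" using K(1) by simp
qed

lemma skeleton_self_similar: "vskeleton = (\<Union>i\<in>{1..5}. vpsi i ` vskeleton)"
proof (rule antisym)
  show "vskeleton \<subseteq> (\<Union>i\<in>{1..5}. vpsi i ` vskeleton)"
  proof
    fix x assume "x \<in> vskeleton"
    then obtain n where "x \<in> vcable (Suc n)" using vcable_Suc_mono unfolding vskeleton_def by blast
    then show "x \<in> (\<Union>i\<in>{1..5}. vpsi i ` vskeleton)"
      using vcable_subset_skeleton by (blast elim: vcable_Suc_cases)
  qed
qed (use vpsi_skeleton in blast)

lemma bounded_skeleton: "bounded vskeleton"
  using vcable_in_square by (intro bounded_subset[OF bounded_vsquare]) (auto simp: vskeleton_def)

text \<open>Any two compact invariant sets contain each other by \<open>vpsi_attractor\<close>. The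
  closed skeleton is one, which settles existence and names the set that the definite description in
  \<open>vicsek\<close> denotes.\<close>

lemma vicsek_unique:
  "\<exists>!K. compact K \<and> K \<noteq> {} \<and> K = (\<Union>i\<in>{1..5}. vpsi i ` K)"
  "compact (closure vskeleton) \<and> closure vskeleton \<noteq> {} \<and>
    closure vskeleton = (\<Union>i\<in>{1..5}. vpsi i ` closure vskeleton)"
proof -
  have cpt: "compact (closure vskeleton)" using bounded_skeleton by simp
  have "closure vskeleton = (\<Union>i\<in>{1..5}. vpsi i ` closure vskeleton)"
  proof (rule antisym)
    have "vskeleton \<subseteq> (\<Union>i\<in>{1..5}. vpsi i ` closure vskeleton)"
      using skeleton_self_similar closure_subset by blast
    moreover have "closed (\<Union>i\<in>{1..5}. vpsi i ` closure vskeleton)"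
      by (intro compact_imp_closed compact_UN compact_continuous_image continuous_on_vpsi cpt) simp
    ultimately show "closure vskeleton \<subseteq> (\<Union>i\<in>{1..5}. vpsi i ` closure vskeleton)"
      by (rule closure_minimal)
    show "(\<Union>i\<in>{1..5}. vpsi i ` closure vskeleton) \<subseteq> closure vskeleton"
    proof (rule UN_least)
      fix i :: nat assume "i \<in> {1..5}"
      then show "vpsi i ` closure vskeleton \<subseteq> closure vskeleton"
        using vpsi_skeleton closure_subset
        by (intro image_closure_subset continuous_on_vpsi closed_closure) blast
    qed
  qed
  then show ex: "compact (closure vskeleton) \<and> closure vskeleton \<noteq> {} \<and>
      closure vskeleton = (\<Union>i\<in>{1..5}. vpsi i ` closure vskeleton)"
    using cpt zero_in_skeleton by auto
  show "\<exists>!K. compact K \<and> K \<noteq> {} \<and> K = (\<Union>i\<in>{1..5}. vpsi i ` K)"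
  proof (rule ex_ex1I)
    fix K L assume K: "compact K \<and> K \<noteq> {} \<and> K = (\<Union>i\<in>{1..5}. vpsi i ` K)"
      and L: "compact L \<and> L \<noteq> {} \<and> L = (\<Union>i\<in>{1..5}. vpsi i ` L)"
    show "K = L"
    proof (rule antisym)
      show "K \<subseteq> L"
        using K L vpsi_attractor[of K L] by (simp add: compact_imp_bounded compact_imp_closed)
      show "L \<subseteq> K"
        using K L vpsi_attractor[of L K] by (simp add: compact_imp_bounded compact_imp_closed)
    qed
  qed (use ex in blast)
qed

lemma vicsek_eq: "vicsek = closure vskeleton"
  unfolding vicsek_def by (rule the1_equality[OF vicsek_unique])

lemma compact_vicsek: "compact vicsek" and vicsek_self_similar: "vicsek = (\<Union>i\<in>{1..5}. vpsi i ` vicsek)"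
  using vicsek_unique(2) unfolding vicsek_eq by blast+

lemma skeleton_subset_vicsek: "vskeleton \<subseteq> vicsek"
  by (simp add: vicsek_eq closure_subset)

lemma connected_skeleton: "connected vskeleton"
proof (rule path_connected_imp_connected, unfold path_connected_def, intro ballI)
  fix x y assume xy: "x \<in> vskeleton" "y \<in> vskeleton"
  obtain n where n: "{x, y} \<subseteq> vcable n" using skeleton_common_level[of "{x, y}"] xy by auto
  obtain g where "rect_curve (vcable n) x y (tdist (vcable n) x y) g"
    using is_tree_rect[OF is_tree_vcable, of x n y] n by auto
  from rect_curve_joins_in(1)[OF this] show "\<exists>g. path g \<and> path_image g \<subseteq> vskeleton \<and> pathstart g = x \<and> pathfinish g = y"
    using vcable_subset_skeleton[of n] unfolding joins_in_def by blast
qed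

lemma vdist_extension:
  "continuous_on (vicsek \<times> vicsek) (\<lambda>(x, y). vdist x y)"
  "x \<in> vskeleton \<Longrightarrow> y \<in> vskeleton \<Longrightarrow> vdist x y = skeleton_dist x y"
proof -
  let ?S = "vskeleton \<times> vskeleton" and ?d = "\<lambda>(x, y). skeleton_dist x y"
  have "uniformly_continuous_on ?S ?d"
  proof (rule lipschitz_on_uniformly_continuous)
    \<comment> \<open>Ten for each of the two arguments, by
      \<open>skeleton_dist_le_dist\<close>.\<close>
    show "20-lipschitz_on ?S ?d"
    proof (rule lipschitz_onI)
      fix p q assume pq: "p \<in> ?S" "q \<in> ?S"
      obtain u v u' v' where e: "p = (u, v)" "q = (u', v')" by (cases p, cases q)
      then have S: "u \<in> vskeleton" "v \<in> vskeleton" "u' \<in> vskeleton" "v' \<in> vskeleton" using pq by auto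
      have "\<bar>skeleton_dist u v - skeleton_dist u' v'\<bar> \<le> skeleton_dist u u' + skeleton_dist v v'"
        using skeleton_dist_triangle[OF S(1,3,2)] skeleton_dist_triangle[OF S(3,4,2)]
          skeleton_dist_triangle[OF S(3,1,4)] skeleton_dist_triangle[OF S(1,2,4)]
          skeleton_dist_pair(2)[OF S(1,3)] skeleton_dist_pair(2)[OF S(2,4)] by linarith
      also have "\<dots> \<le> 10 * dist u u' + 10 * dist v v'"
        using skeleton_dist_le_dist S by (intro add_mono) auto
      also have "\<dots> \<le> 20 * dist p q"
        using dist_fst_le[of p q] dist_snd_le[of p q] e by simp
      finally show "dist (?d p) (?d q) \<le> 20 * dist p q" by (simp add: e dist_real_def)
    qed simp
  qed
  then obtain g where g: "uniformly_continuous_on (closure ?S) g" "\<And>p. p \<in> ?S \<Longrightarrow> ?d p = g p"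
    by (rule uniformly_continuous_on_extension_on_closure) blast
  have cl: "closure ?S = vicsek \<times> vicsek" by (simp add: closure_Times vicsek_eq)
  have cg: "continuous_on (vicsek \<times> vicsek) g" using g(1) uniformly_continuous_imp_continuous cl by metis
  have vd: "vdist x y = g (x, y)" if xy: "x \<in> vicsek" "y \<in> vicsek" for x y
    unfolding vdist_def
  proof (rule tendsto_Lim)
    \<comment> \<open>The limit defining \<open>vdist\<close> leaves out the point itself, so it is
      determined only where the product of the skeletons accumulates. A connected set with more than
      one point has no isolated points.\<close>
    have "?S \<noteq> {(a, b)}" for a b
    proof
      assume "?S = {(a, b)}"
      moreover have "(vq 1, vq 1) \<in> ?S" "(vq 2, vq 2) \<in> ?S"
        using vq_in_skeleton[of 1] vq_in_skeleton[of 2] by auto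
      ultimately have "vq 1 = vq 2" by auto
      then show False using vh_pos by (simp add: vq_simps)
    qed
    then have "p islimpt ?S" if "p \<in> ?S" for p
      using connected_imp_perfect[of ?S p] connected_Times[OF connected_skeleton connected_skeleton] that
      by (metis surj_pair)
    moreover have "(x, y) \<in> closure ?S" using xy cl by simp
    ultimately have "(x, y) islimpt ?S" unfolding closure_def by blast
    then show "\<not> trivial_limit (at (x, y) within ?S)" by (simp add: trivial_limit_within)
    have "(g \<longlongrightarrow> g (x, y)) (at (x, y) within vicsek \<times> vicsek)"
      using cg xy by (auto simp: continuous_on_def)
    then have "(g \<longlongrightarrow> g (x, y)) (at (x, y) within ?S)"
      by (rule tendsto_within_subset) (use skeleton_subset_vicsek in blast)
    moreover have "eventually (\<lambda>p. g p = ?d p) (at (x, y) within ?S)"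
      using g(2) by (auto simp: eventually_at_filter)
    ultimately show "(?d \<longlongrightarrow> g (x, y)) (at (x, y) within ?S)"
      by (rule Lim_transform_eventually)
  qed
  show "continuous_on (vicsek \<times> vicsek) (\<lambda>(x, y). vdist x y)"
    using cg by (rule continuous_on_eq) (auto simp: vd)
  show "vdist x y = skeleton_dist x y" if "x \<in> vskeleton" "y \<in> vskeleton"
    using vd[of x y] g(2)[of "(x, y)"] that skeleton_subset_vicsek by auto
qed

section \<open>Balls\<close>

lemma vdist_tendsto:
  assumes "X \<longlonglongrightarrow> x" "Y \<longlonglongrightarrow> y" "\<And>n. X n \<in> vicsek" "\<And>n. Y n \<in> vicsek" "x \<in> vicsek" "y \<in> vicsek"
  shows "(\<lambda>n. vdist (X n) (Y n)) \<longlonglongrightarrow> vdist x y"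
  using continuous_on_tendsto_compose[OF vdist_extension(1) tendsto_Pair[OF assms(1,2)]] assms
  by auto

lemma skeleton_sequence:
  assumes "x \<in> vicsek"
  shows "\<exists>X. (\<forall>n. X n \<in> vskeleton) \<and> (\<forall>n. X n \<in> vicsek) \<and> X \<longlonglongrightarrow> x"
proof -
  obtain X where "\<forall>n. X n \<in> vskeleton" "X \<longlonglongrightarrow> x"
    using assms unfolding vicsek_eq closure_sequential by blast
  then show ?thesis using skeleton_subset_vicsek by blast
qed

lemma vdist_bounds:
  assumes x: "x \<in> vicsek" and y: "y \<in> vicsek"
  shows "dist x y \<le> vdist x y" "vdist x y \<le> 10 * dist x y" "vdist x y \<le> 2" "vdist y x = vdist x y"
proof -
  obtain X where X: "\<And>n. X n \<in> vskeleton" "\<And>n. X n \<in> vicsek" "X \<longlonglongrightarrow> x" using skeleton_sequence[OF x] by blast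
  obtain Y where Y: "\<And>n. Y n \<in> vskeleton" "\<And>n. Y n \<in> vicsek" "Y \<longlonglongrightarrow> y" using skeleton_sequence[OF y] by blast
  have v: "(\<lambda>n. vdist (X n) (Y n)) \<longlonglongrightarrow> vdist x y" and v': "(\<lambda>n. vdist (Y n) (X n)) \<longlonglongrightarrow> vdist y x"
    using X Y x y by (auto intro: vdist_tendsto)
  have d: "(\<lambda>n. dist (X n) (Y n)) \<longlonglongrightarrow> dist x y" using X Y by (intro tendsto_dist)
  have e: "vdist (X n) (Y n) = skeleton_dist (X n) (Y n)" "vdist (Y n) (X n) = skeleton_dist (X n) (Y n)" for n
    using X(1) Y(1) skeleton_dist_pair(2)[of "X n" "Y n"] by (auto simp: vdist_extension(2))
  show "dist x y \<le> vdist x y"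
    using skeleton_dist_pair(1)[OF X(1) Y(1)] by (intro LIMSEQ_le[OF d v]) (auto simp: e)
  show "vdist x y \<le> 10 * dist x y"
    using skeleton_dist_le_dist[OF X(1) Y(1)]
    by (intro LIMSEQ_le[OF v tendsto_mult_left[OF d]]) (auto simp: e)
  show "vdist x y \<le> 2"
    using skeleton_dist_le_2[OF X(1) Y(1)] by (intro LIMSEQ_le_const2[OF v]) (auto simp: e)
  show "vdist y x = vdist x y"
  proof -
    have "(\<lambda>n. vdist (Y n) (X n)) = (\<lambda>n. vdist (X n) (Y n))" by (simp only: e)
    then show ?thesis using LIMSEQ_unique[OF v'] v by simp
  qed
qed

lemma vdist_triangle:
  assumes x: "x \<in> vicsek" and y: "y \<in> vicsek" and z: "z \<in> vicsek"
  shows "vdist x z \<le> vdist x y + vdist y z"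
proof -
  obtain X where X: "\<And>n. X n \<in> vskeleton" "\<And>n. X n \<in> vicsek" "X \<longlonglongrightarrow> x" using skeleton_sequence[OF x] by blast
  obtain Y where Y: "\<And>n. Y n \<in> vskeleton" "\<And>n. Y n \<in> vicsek" "Y \<longlonglongrightarrow> y" using skeleton_sequence[OF y] by blast
  obtain Z where Z: "\<And>n. Z n \<in> vskeleton" "\<And>n. Z n \<in> vicsek" "Z \<longlonglongrightarrow> z" using skeleton_sequence[OF z] by blast
  have 1: "(\<lambda>n. vdist (X n) (Z n)) \<longlonglongrightarrow> vdist x z"
    using X Z x z by (auto intro: vdist_tendsto)
  have 2: "(\<lambda>n. vdist (X n) (Y n) + vdist (Y n) (Z n)) \<longlonglongrightarrow> vdist x y + vdist y z"
    using X Y Z x y z by (auto intro!: tendsto_add vdist_tendsto)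
  show ?thesis
    using skeleton_dist_triangle[OF X(1) Y(1) Z(1)] X(1) Y(1) Z(1)
    by (intro LIMSEQ_le[OF 1 2]) (auto simp: vdist_extension(2))
qed

lemma skeleton_near:
  assumes "x \<in> vicsek" "0 < e"
  obtains x' where "x' \<in> vskeleton" "vdist x x' < e"
proof -
  obtain x' where "x' \<in> vskeleton" "dist x' x < e / 10"
    using assms unfolding vicsek_eq closure_approachable by (metis zero_less_divide_iff zero_less_numeral)
  then show ?thesis
    using that[of x'] vdist_bounds(2)[of x x'] assms skeleton_subset_vicsek by (auto simp: dist_commute)
qed

lemma vdist_le_vdiam:
  assumes "A \<subseteq> vicsek" "x \<in> A" "y \<in> A"
  shows "vdist x y \<le> vdiam A"
proof -
  have "bdd_above ((\<lambda>(x, y). vdist x y) ` (A \<times> A))"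
    using assms(1) by (intro bdd_aboveI[of _ 2]) (auto intro!: vdist_bounds(3))
  then show ?thesis
    unfolding vdiam_def using cSUP_upper[of "(x, y)" "A \<times> A" "\<lambda>(x, y). vdist x y"] assms by auto
qed

lemma skeleton_geodesic_point:
  assumes "x \<in> vskeleton" "y \<in> vskeleton" "0 \<le> t" "t \<le> skeleton_dist x y"
  obtains z where "z \<in> vskeleton" "skeleton_dist x z = t" "skeleton_dist z y = skeleton_dist x y - t"
proof -
  obtain n where n: "{x, y} \<subseteq> vcable n" using skeleton_common_level[of "{x, y}"] assms by auto
  obtain g where g: "rect_curve (vcable n) x y (tdist (vcable n) x y) g"
    using is_tree_rect[OF is_tree_vcable, of x n y] n by auto
  have t: "t \<le> tdist (vcable n) x y" using assms(4) n by (simp add: skeleton_dist_eq[of _ n])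
  have gt: "g t \<in> vcable n" and e: "g 0 = x" "g (tdist (vcable n) x y) = y"
    using g t assms(3) by (auto simp: rect_curve_def image_subset_iff)
  have "tdist (vcable n) x (g t) = t" "tdist (vcable n) (g t) y = tdist (vcable n) x y - t"
    using tdist_along[OF is_tree_vcable g, of 0 t] tdist_along[OF is_tree_vcable g, of t "tdist (vcable n) x y"]
      assms(3) t e by auto
  then show ?thesis
    using that[of "g t"] gt n vcable_subset_skeleton by (auto simp: skeleton_dist_eq[of _ n])
qed

lemma geodesically_convex_between:
  assumes A: "geodesically_convex A" and xy: "x \<in> A \<inter> vskeleton" "y \<in> A \<inter> vskeleton"
    and z: "z \<in> vskeleton" "skeleton_dist x z + skeleton_dist z y = skeleton_dist x y"
  shows "z \<in> A"
proof -
  obtain n where n: "{x, y, z} \<subseteq> vcable n" using skeleton_common_level[of "{x, y, z}"] xy z by auto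
  then obtain g where "geodesic_in (vcable n) x y g" "z \<in> path_image g"
    using between_geodesic_in[OF is_tree_vcable, of x n y z] z by (auto simp: skeleton_dist_eq[of _ n])
  then show ?thesis using A xy unfolding geodesically_convex_def by blast
qed

lemma geodesic_in_between_skeleton:
  assumes g: "geodesic_in (vcable n) y z g" and w: "w \<in> path_image g"
  shows "w \<in> vskeleton" "skeleton_dist y w + skeleton_dist w z = skeleton_dist y z"
proof -
  have j: "joins_in (vcable n) y z g" using g by (simp add: geodesic_in_def)
  have "{y, z, w} \<subseteq> vcable n" using joins_in_endpoints[OF j] j w by (auto simp: joins_in_def)
  then show "w \<in> vskeleton" "skeleton_dist y w + skeleton_dist w z = skeleton_dist y z"
    using geodesic_in_between[OF is_tree_vcable g w] vcable_subset_skeleton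
    by (auto simp: skeleton_dist_eq[of _ n])
qed

lemma skeleton_dist_between_le_max:
  assumes "x \<in> vskeleton" "y \<in> vskeleton" "z \<in> vskeleton" "w \<in> vskeleton"
    and "skeleton_dist y w + skeleton_dist w z = skeleton_dist y z"
  shows "skeleton_dist x w \<le> max (skeleton_dist x y) (skeleton_dist x z)"
proof -
  obtain n where n: "{x, y, z, w} \<subseteq> vcable n" using skeleton_common_level[of "{x, y, z, w}"] assms by auto
  then show ?thesis
    using tdist_between_le_max[OF is_tree_vcable, of x n y z w] assms(5) by (simp add: skeleton_dist_eq[of _ n])
qed

lemma vball_subset: "vball x r \<subseteq> vicsek"
  by (auto simp: vball_def)

lemma geodesically_convex_vball:
  assumes x: "x \<in> vicsek"
  shows "geodesically_convex (vball x r)"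
  unfolding geodesically_convex_def
proof (intro conjI vball_subset ballI allI impI)
  fix y z n g
  assume y: "y \<in> vball x r \<inter> vskeleton" and z: "z \<in> vball x r \<inter> vskeleton"
    and g: "geodesic_in (vcable n) y z g"
  show "path_image g \<subseteq> vball x r \<inter> vskeleton"
  proof
    fix w assume w: "w \<in> path_image g"
    note b = geodesic_in_between_skeleton[OF g w]
    \<comment> \<open>The centre may lie off the skeleton, so the estimate is taken at skeleton
      points tending to it.\<close>
    obtain X where X: "\<And>n. X n \<in> vskeleton" "\<And>n. X n \<in> vicsek" "X \<longlonglongrightarrow> x" using skeleton_sequence[OF x] by blast
    have K: "y \<in> vicsek" "z \<in> vicsek" "w \<in> vicsek" using y z b skeleton_subset_vicsek by (auto simp: vball_def)
    have "vdist x w \<le> max (vdist x y) (vdist x z)"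
    proof (rule LIMSEQ_le)
      show "(\<lambda>n. vdist (X n) w) \<longlonglongrightarrow> vdist x w"
        using X K x by (auto intro: vdist_tendsto)
      show "(\<lambda>n. max (vdist (X n) y) (vdist (X n) z)) \<longlonglongrightarrow> max (vdist x y) (vdist x z)"
        using X K x by (auto intro!: tendsto_max vdist_tendsto)
      show "\<exists>N. \<forall>n\<ge>N. vdist (X n) w \<le> max (vdist (X n) y) (vdist (X n) z)"
        using skeleton_dist_between_le_max[OF X(1) _ _ b(1,2)] y z b(1) X(1) by (simp add: vdist_extension(2))
    qed
    then show "w \<in> vball x r \<inter> vskeleton" using y z b K by (auto simp: vball_def)
  qed
qed

lemma closed_vball:
  assumes x: "x \<in> vicsek"
  shows "closed (vball x r)"
proof -
  have cl: "closed vicsek" using compact_vicsek by (rule compact_imp_closed)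
  have "continuous_on vicsek ((\<lambda>(x, y). vdist x y) \<circ> (\<lambda>y. (x, y)))"
    using x by (intro continuous_on_compose continuous_intros
        continuous_on_subset[OF vdist_extension(1)]) auto
  then have "continuous_on vicsek (vdist x)" by (simp add: o_def)
  from continuous_closed_preimage[OF this cl, of "{..r}"] show ?thesis
    by (simp add: vball_def vimage_def Int_def)
qed

text \<open>A skeleton point near \<open>y\<close> may fall just outside the ball. It is then pulled
  back along a geodesic towards a skeleton point near the centre.\<close>

lemma vball_dense:
  assumes x: "x \<in> vicsek" and r: "0 < r"
  shows "vball x r \<subseteq> closure (vball x r \<inter> vskeleton)"
proof
  fix y assume "y \<in> vball x r"
  then have y: "y \<in> vicsek" "vdist x y \<le> r" by (auto simp: vball_def)
  show "y \<in> closure (vball x r \<inter> vskeleton)"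
    unfolding closure_approachable
  proof (intro allI impI)
    fix e' :: real assume e': "0 < e'"
    \<comment> \<open>Stopping at distance \<open>r - e\<close> from \<open>a\<close> leaves room
      for the distance from the centre to \<open>a\<close>. The point found there is within
      \<open>3 * e\<close> of \<open>b\<close>, hence within \<open>4 * e\<close> of
      \<open>y\<close>; this dictates the fifth of \<open>e'\<close>.\<close>
    define e where "e = min (e' / 5) (r / 2)"
    have e: "0 < e" "4 * e < e'" "e < r" using e' r by (auto simp: e_def)
    obtain a where a: "a \<in> vskeleton" "vdist x a < e" using skeleton_near[OF x e(1)] .
    obtain b where b: "b \<in> vskeleton" "vdist y b < e" using skeleton_near[OF y(1) e(1)] .
    have K: "a \<in> vicsek" "b \<in> vicsek" using a b skeleton_subset_vicsek by auto
    have ab: "vdist a b \<le> r + 2 * e"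
      using vdist_triangle[OF K(1) x K(2)] vdist_triangle[OF x y(1) K(2)] vdist_bounds(4)[OF x K(1)] a b y
      by linarith
    have sab: "vdist a b = skeleton_dist a b" using a b by (simp add: vdist_extension(2))
    show "\<exists>z\<in>vball x r \<inter> vskeleton. dist z y < e'"
    proof (cases "vdist a b \<le> r - e")
      case True
      then have "vdist x b \<le> r" using vdist_triangle[OF x K] a by linarith
      moreover have "dist b y < e'"
        using vdist_bounds(1)[OF y(1) K(2)] b e by (simp add: dist_commute)
      ultimately show ?thesis using b K by (intro bexI[of _ b]) (auto simp: vball_def)
    next
      case False
      obtain z where z: "z \<in> vskeleton" "skeleton_dist a z = r - e"
          "skeleton_dist z b = skeleton_dist a b - (r - e)"
        using skeleton_geodesic_point[OF a(1) b(1), of "r - e"] False e sab by auto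
      have zK: "z \<in> vicsek" using z skeleton_subset_vicsek by auto
      have zd: "vdist a z = r - e" "vdist z b = vdist a b - (r - e)"
        using z a b by (auto simp: vdist_extension(2))
      have "vdist x z \<le> r" using vdist_triangle[OF x K(1) zK] a zd by linarith
      moreover have "dist z y < e'"
        using vdist_bounds(1)[OF zK y(1)] vdist_triangle[OF zK K(2) y(1)] zd ab b e
          vdist_bounds(4)[OF K(2) y(1)] by linarith
      ultimately show ?thesis using z zK by (intro bexI[of _ z]) (auto simp: vball_def)
    qed
  qed
qed

lemma vdist_self: "x \<in> vicsek \<Longrightarrow> vdist x x = 0"
  using vdist_bounds[of x x] by simp

lemma vdiam_vball_le:
  assumes x: "x \<in> vicsek" and r: "0 < r"
  shows "vdiam (vball x r) \<le> 2 * r"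
  unfolding vdiam_def
proof (rule cSUP_least)
  have "x \<in> vball x r" using x r vdist_self[OF x] by (simp add: vball_def)
  then show "vball x r \<times> vball x r \<noteq> {}" by blast
  fix p assume "p \<in> vball x r \<times> vball x r"
  then obtain y z where p: "p = (y, z)" "y \<in> vicsek" "z \<in> vicsek" "vdist x y \<le> r" "vdist x z \<le> r"
    by (auto simp: vball_def)
  then show "(case p of (y, z) \<Rightarrow> vdist y z) \<le> 2 * r"
    using vdist_triangle[OF p(2) x p(3)] vdist_bounds(4)[OF x p(2)] by simp
qed

section \<open>Cells and the measure of small sets\<close>

lemma foldr_vpsi: "foldr vpsi w z = foldr vpsi w 0 + (1 / 3 ^ length w) *\<^sub>R z"
  by (induction w) (simp_all add: vpsi_affine algebra_simps)

lemma finite_vwords: "finite (vwords n)"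
  using finite_lists_length_eq[of "{1..5::nat}" n] by (simp add: vwords_def conj_commute)

lemma vwords_Suc: "w \<in> vwords (Suc n) \<longleftrightarrow> (\<exists>i u. w = i # u \<and> i \<in> {1..5} \<and> u \<in> vwords n)"
  by (cases w) (auto simp: vwords_def)

lemma vq_lattice: "\<exists>(a :: int) (b :: int). vq i = (vh * a, vh * b)"
proof -
  have "vq i = (vh * of_int (if i = 1 \<or> i = 4 then - 1 else if i = 2 \<or> i = 3 then 1 else 0),
      vh * of_int (if i = 1 \<or> i = 2 then 1 else if i = 3 \<or> i = 4 then - 1 else 0))"
    by (simp add: vq_def vh_def)
  then show ?thesis by blast
qed

lemma cell_center_lattice:
  "\<exists>(a :: int) (b :: int). foldr vpsi w 0 = (2 * vh / 3 ^ length w * a, 2 * vh / 3 ^ length w * b)"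
proof (induction w)
  case Nil
  then show ?case by (auto simp: zero_prod_def intro!: exI[of _ 0])
next
  case (Cons i w)
  then obtain a b :: int where ab: "foldr vpsi w 0 = (2 * vh / 3 ^ length w * a, 2 * vh / 3 ^ length w * b)"
    by blast
  obtain c d :: int where cd: "vq i = (vh * c, vh * d)" using vq_lattice by blast
  \<comment> \<open>The map \<open>vpsi i\<close> divides the mesh by three and adds
    \<open>2/3 * vq i\<close>, which is \<open>3 ^ length w\<close> times an integer vector of the
    new lattice.\<close>
  have "foldr vpsi (i # w) 0 = (2 * vh / 3 ^ length (i # w) * of_int (a + 3 ^ length w * c),
      2 * vh / 3 ^ length (i # w) * of_int (b + 3 ^ length w * d))"
    by (simp add: ab cd vpsi_affine field_simps)
  then show ?case by blast
qed

text \<open>Strictness is what \<open>cell_center_inj\<close> uses: a centre common to two cells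
  would be a joint, hence the image of a corner of the square.\<close>

lemma cell_center_interior: "\<bar>fst (foldr vpsi w 0)\<bar> < vh \<and> \<bar>snd (foldr vpsi w 0)\<bar> < vh"
proof (induction w)
  case Nil
  then show ?case using vh_pos by simp
next
  case (Cons i w)
  then show ?case using vq_in_square[of i]
    by (auto simp: vpsi_components vsquare_def mem_Times_iff abs_less_iff)
qed

lemma cell_center_inj: "inj_on (\<lambda>w. foldr vpsi w 0) (vwords n)"
proof (induction n)
  case 0
  then show ?case by (auto simp: inj_on_def vwords_def)
next
  case (Suc n)
  have no: False if ij: "i \<in> {1..4}" "j \<in> {1..5}" "j \<noteq> i"
    and eq: "vpsi i (foldr vpsi u 0) = vpsi j (foldr vpsi v 0)" for i j u v
  proof -
    have "foldr vpsi u 0 \<in> vsquare" "foldr vpsi v 0 \<in> vsquare"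
      using cell_center_interior[of u] cell_center_interior[of v]
      by (auto simp: vsquare_def mem_Times_iff)
    from vcell_inter[OF ij this eq] have "vpsi i (foldr vpsi u 0) = vpsi i (vq (vopp i))"
      using vjoint_eq(1)[OF ij(1)] by simp
    then have "\<bar>fst (vq (vopp i))\<bar> < vh" using cell_center_interior[of u] by (simp add: vpsi_inj)
    then show False using vopp_index[OF ij(1)] unfolding index4 using vh_pos by (elim disjE) (simp_all add: vq_simps)
  qed
  show ?case
  proof (rule inj_onI)
    fix w w' assume "w \<in> vwords (Suc n)" "w' \<in> vwords (Suc n)" and eq: "foldr vpsi w 0 = foldr vpsi w' 0"
    then obtain i u j v where w: "w = i # u" "i \<in> {1..5}" "u \<in> vwords n"
        "w' = j # v" "j \<in> {1..5}" "v \<in> vwords n"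
      unfolding vwords_Suc by blast
    have "i = j"
    proof (rule ccontr)
      assume "i \<noteq> j"
      then consider "i \<in> {1..4}" | "j \<in> {1..4}" using w(2,5) by fastforce
      then show False using no[of i j u v] no[of j i v u] eq w \<open>i \<noteq> j\<close> by cases auto
    qed
    then show "w = w'" using eq w inj_onD[OF Suc, of u v] by (simp add: vpsi_inj)
  qed
qed

lemma vicsek_cells: "vicsek = (\<Union>w\<in>vwords n. foldr vpsi w ` vicsek)"
proof (induction n)
  case 0
  then show ?case by (auto simp: vwords_def)
next
  case (Suc n)
  have "(\<Union>w\<in>vwords (Suc n). foldr vpsi w ` vicsek) =
      (\<Union>i\<in>{1..5}. vpsi i ` (\<Union>w\<in>vwords n. foldr vpsi w ` vicsek))" (is "?L = ?R")
  proof (rule antisym)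
    show "?L \<subseteq> ?R"
    proof
      fix z assume "z \<in> ?L"
      then obtain w y where w: "w \<in> vwords (Suc n)" "y \<in> vicsek" "z = foldr vpsi w y" by blast
      then obtain i u where "w = i # u" "i \<in> {1..5}" "u \<in> vwords n" unfolding vwords_Suc by blast
      moreover from this have "z = vpsi i (foldr vpsi u y)" using w by simp
      ultimately show "z \<in> ?R" using w(2) by blast
    qed
    show "?R \<subseteq> ?L"
    proof
      fix z assume "z \<in> ?R"
      then obtain i u y where "i \<in> {1..5}" "u \<in> vwords n" "y \<in> vicsek" "z = vpsi i (foldr vpsi u y)" by blast
      then have "i # u \<in> vwords (Suc n)" "z = foldr vpsi (i # u) y" by (auto simp: vwords_def)
      then show "z \<in> ?L" using \<open>y \<in> vicsek\<close> by blast
    qed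
  qed
  also have "\<dots> = (\<Union>i\<in>{1..5}. vpsi i ` vicsek)" by (simp only: Suc[symmetric])
  also have "\<dots> = vicsek" by (rule vicsek_self_similar[symmetric])
  finally show ?case by (rule sym)
qed

lemma continuous_on_foldr_vpsi: "continuous_on A (foldr vpsi w)"
proof -
  have "continuous_on A (\<lambda>z. foldr vpsi w 0 + (1 / 3 ^ length w) *\<^sub>R z)"
    by (intro continuous_intros)
  then show ?thesis by (simp only: foldr_vpsi[of w, symmetric])
qed

lemma vicsek_in_square: "vicsek \<subseteq> vsquare"
proof -
  have "vskeleton \<subseteq> vsquare" using vcable_in_square by (auto simp: vskeleton_def)
  then show ?thesis unfolding vicsek_eq vsquare_def
    by (intro closure_minimal closed_Times closed_atLeastAtMost)
qed

lemma three_powr_vdh: "3 powr vdh = 5"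
  by (simp add: vdh_def powr_def)

text \<open>With \<open>1 / 3 ^ Suc n < r \<le> 1 / 3 ^ n\<close>, at most 25 cells of level
  \<open>n\<close> meet \<open>B\<close>, each of mass \<open>1 / 5 ^ n\<close>. As
  \<open>3 powr vdh = 5\<close>, passing from \<open>n\<close> to \<open>Suc n\<close> costs the
  further factor 5 in 125.\<close>

lemma vicsek_measure_small_le:
  assumes M: "is_vicsek_measure M" and B: "B \<in> sets M" "B \<subseteq> vicsek"
    and x: "\<And>y. y \<in> B \<Longrightarrow> dist x y \<le> r" and r: "0 < r"
  shows "measure M B \<le> 125 * r powr vdh"
proof -
  interpret prob_space M using M by (simp add: is_vicsek_measure_def)
  have vdh: "0 < vdh" by (simp add: vdh_def)
  show ?thesis
  proof (cases "1 < r")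
    case True
    then have "1 \<le> r powr vdh" using vdh by (simp add: ge_one_powr_ge_zero)
    then show ?thesis using prob_le_1[of B] by linarith
  next
    case False
    \<comment> \<open>The first scale below \<open>r\<close>. Cells are counted one level earlier,
      at a scale still at least \<open>r\<close>; such a level exists because
      \<open>r \<le> 1\<close> excludes \<open>m = 0\<close>.\<close>
    define m where "m = (LEAST m. (1/3::real) ^ m < r)"
    have "\<exists>m. (1/3::real) ^ m < r" using real_arch_pow_inv[OF r, of "1/3"] by auto
    then have m: "(1/3) ^ m < r" unfolding m_def by (rule LeastI_ex)
    then have "m \<noteq> 0" using False by (cases m) auto
    then obtain n where n: "m = Suc n" by (cases m) auto
    have "\<not> (1/3) ^ n < r" using not_less_Least[of n "\<lambda>m. (1/3::real) ^ m < r"] n unfolding m_def by simp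
    then have rn: "r \<le> 1 / 3 ^ n" by (simp add: power_one_over)
    have rn': "1 / 3 ^ Suc n < r" using m n by (simp add: power_one_over)
    define W where "W = {w \<in> vwords n. foldr vpsi w ` vicsek \<inter> B \<noteq> {}}"
    have cells: "(\<Union>w\<in>vwords n. foldr vpsi w ` vicsek) = vicsek" by (rule vicsek_cells[symmetric])
    have finW: "finite W" using finite_vwords by (simp add: W_def)
    obtain a b :: "nat list \<Rightarrow> int" where ab:
        "\<And>w. foldr vpsi w 0 = (2 * vh / 3 ^ length w * a w, 2 * vh / 3 ^ length w * b w)"
      using cell_center_lattice by metis
    have close: "\<bar>a w - a w0\<bar> \<le> 2 \<and> \<bar>b w - b w0\<bar> \<le> 2" if "w \<in> W" "w0 \<in> W" for w w0
    proof -
      define h where "h = (1::real) / 3 ^ n"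
      have h: "0 < h" "r \<le> h" using rn by (auto simp: h_def)
      \<comment> \<open>The centre of a cell meeting \<open>B\<close> differs from \<open>x\<close>
        in each coordinate by at most the radius plus half the side of the cell's square.\<close>
      have c: "\<bar>2 * vh * h * a u - fst x\<bar> \<le> h * (1 + vh) \<and> \<bar>2 * vh * h * b u - snd x\<bar> \<le> h * (1 + vh)"
        if u: "u \<in> W" for u
      proof -
        obtain z where z: "z \<in> vicsek" "foldr vpsi u z \<in> B" and len: "length u = n"
          using u by (auto simp: W_def vwords_def)
        have e: "foldr vpsi u z = (2 * vh * h * a u, 2 * vh * h * b u) + h *\<^sub>R z"
          using foldr_vpsi[of u z] len by (simp add: ab h_def)
        have "\<bar>fst z\<bar> \<le> vh" "\<bar>snd z\<bar> \<le> vh"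
          using subsetD[OF vicsek_in_square z(1)] by (auto simp: vsquare_def mem_Times_iff)
        then have "\<bar>h * fst z\<bar> \<le> h * vh" "\<bar>h * snd z\<bar> \<le> h * vh" using h by (auto simp: abs_mult)
        moreover have "dist (fst x) (fst (foldr vpsi u z)) \<le> h" "dist (snd x) (snd (foldr vpsi u z)) \<le> h"
          using x[OF z(2)] h(2) dist_fst_le[of x "foldr vpsi u z"] dist_snd_le[of x "foldr vpsi u z"] by linarith+
        ultimately show ?thesis
          unfolding e by (auto simp: dist_real_def algebra_simps abs_le_iff)
      qed
      \<comment> \<open>Dividing by the mesh \<open>2 * vh * h\<close>, the indices differ by at
        most \<open>1 + 1 / vh < 3\<close>, hence by at most 2. This leaves five values per
        coordinate.\<close>
      have fin: "\<bar>k - l\<bar> \<le> 2" if "\<bar>2 * vh * h * of_int k - s\<bar> \<le> h * (1 + vh)"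
          "\<bar>2 * vh * h * of_int l - s\<bar> \<le> h * (1 + vh)" for k l :: int and s :: real
      proof -
        have "\<bar>2 * vh * h * of_int k - 2 * vh * h * of_int l\<bar> \<le> 2 * (h * (1 + vh))" using that by linarith
        also have "2 * vh * h * of_int k - 2 * vh * h * of_int l = (2 * vh * h) * of_int (k - l)"
          by (simp add: algebra_simps)
        finally have "\<bar>(2 * vh * h) * of_int (k - l)\<bar> \<le> 2 * (h * (1 + vh))" .
        moreover have "\<bar>(2 * vh * h) * of_int (k - l)\<bar> = (2 * vh * h) * \<bar>of_int (k - l)\<bar>"
          using h vh_pos by (simp add: abs_mult)
        ultimately have "h * (2 * (vh * \<bar>of_int (k - l)\<bar>)) \<le> h * (2 * (1 + vh))"
          by (simp only: ac_simps)
        then have "vh * \<bar>of_int (k - l)\<bar> \<le> 1 + vh" using h by simp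
        also have "\<dots> < vh * 3" using vh_gt by simp
        finally have "\<bar>of_int (k - l)\<bar> < (3::real)" using vh_pos by simp
        then show ?thesis by linarith
      qed
      show ?thesis using c[OF that(1)] c[OF that(2)] fin by blast
    qed
    have card: "card W \<le> 25"
    proof (cases "W = {}")
      case False
      then obtain w0 where w0: "w0 \<in> W" by blast
      have "inj_on (\<lambda>w. (a w, b w)) W"
      proof (rule inj_onI)
        fix w w' assume w: "w \<in> W" "w' \<in> W" "(a w, b w) = (a w', b w')"
        then have "foldr vpsi w 0 = foldr vpsi w' 0" by (simp add: ab W_def vwords_def)
        then show "w = w'" using w inj_onD[OF cell_center_inj[of n]] by (simp add: W_def)
      qed
      moreover have "(\<lambda>w. (a w, b w)) ` W \<subseteq> {a w0 - 2..a w0 + 2} \<times> {b w0 - 2..b w0 + 2}"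
        using close[OF _ w0] by (force simp: abs_le_iff)
      ultimately have "card W \<le> card ({a w0 - 2..a w0 + 2} \<times> {b w0 - 2..b w0 + 2})"
        by (rule card_inj_on_le) simp
      then show ?thesis by simp
    qed simp
    have cell_sets: "foldr vpsi w ` vicsek \<in> sets M" if "w \<in> W" for w
    proof -
      have "closed (foldr vpsi w ` vicsek)"
        by (intro compact_imp_closed compact_continuous_image continuous_on_foldr_vpsi compact_vicsek)
      moreover have "foldr vpsi w ` vicsek \<subseteq> vicsek" 
        using cells that unfolding W_def by blast
      ultimately show ?thesis using M compact_vicsek
        by (auto simp: is_vicsek_measure_def sets_restrict_space_iff compact_imp_closed)
    qed
    have "B \<subseteq> (\<Union>w\<in>W. foldr vpsi w ` vicsek)"
    proof
      fix y assume y: "y \<in> B"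
      then have "y \<in> (\<Union>w\<in>vwords n. foldr vpsi w ` vicsek)" using B(2) cells by blast
      then show "y \<in> (\<Union>w\<in>W. foldr vpsi w ` vicsek)" using y unfolding W_def by blast
    qed
    then have "measure M B \<le> measure M (\<Union>w\<in>W. foldr vpsi w ` vicsek)"
      using cell_sets finW by (intro finite_measure_mono sets.finite_UN)
    also have "\<dots> \<le> (\<Sum>w\<in>W. measure M (foldr vpsi w ` vicsek))"
      using cell_sets finW by (intro finite_measure_subadditive_finite) auto
    also have "\<dots> = (\<Sum>w\<in>W. 1 / 5 ^ n)"
      using M by (intro sum.cong) (auto simp: is_vicsek_measure_def W_def)
    also have "\<dots> \<le> 25 * (1 / 5 ^ n)" using card by (simp add: divide_right_mono)
    also have "\<dots> = 125 * (1 / 3 ^ Suc n) powr vdh"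
    proof -
      have "(1 / 3 ^ Suc n :: real) powr vdh = 1 / (3 powr real (Suc n)) powr vdh"
        by (subst powr_realpow) (auto simp: powr_divide)
      also have "\<dots> = 1 / (3 powr vdh) powr real (Suc n)" by (simp add: powr_powr mult.commute)
      also have "\<dots> = 1 / 5 ^ Suc n" by (subst three_powr_vdh, subst powr_realpow) auto
      finally show ?thesis by simp
    qed
    also have "\<dots> \<le> 125 * r powr vdh"
      using rn' vdh by (intro mult_left_mono powr_mono2) auto
    finally show ?thesis .
  qed
qed

section \<open>Monotonicity of the energy\<close>

text \<open>Convexity of the power, applied to the mean of the terms. Zero terms are dropped
  beforehand, so that convexity is used on positive numbers; restoring them only enlarges the number
  of terms.\<close>

lemma sum_powr_le:
  fixes a :: "'a \<Rightarrow> real"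
  assumes "finite S" "\<And>i. i \<in> S \<Longrightarrow> 0 \<le> a i" "1 \<le> p"
  shows "(\<Sum>i\<in>S. a i) powr p \<le> real (card S) powr (p - 1) * (\<Sum>i\<in>S. a i powr p)"
proof -
  define T where "T = {i\<in>S. a i \<noteq> 0}"
  have T: "finite T" "T \<subseteq> S" "\<And>i. i \<in> T \<Longrightarrow> 0 < a i"
    using assms by (auto simp: T_def less_le)
  have e: "(\<Sum>i\<in>S. a i) = (\<Sum>i\<in>T. a i)" "(\<Sum>i\<in>S. a i powr p) = (\<Sum>i\<in>T. a i powr p)"
    using T assms(1) by (auto intro!: sum.mono_neutral_right simp: T_def)
  show ?thesis
  proof (cases "T = {}")
    case False
    define n where "n = real (card T)"
    have n: "0 < n" using False T(1) by (simp add: n_def card_gt_0_iff)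
    have "(\<Sum>i\<in>T. (1 / n) *\<^sub>R a i) powr p \<le> (\<Sum>i\<in>T. (1 / n) * a i powr p)"
      using T False n
      by (intro convex_on_sum[OF _ _ powr_convex[OF assms(3)]]) (auto simp: n_def)
    then have "((\<Sum>i\<in>T. a i) / n) powr p \<le> (\<Sum>i\<in>T. a i powr p) / n"
      by (simp add: sum_divide_distrib)
    then have "(\<Sum>i\<in>T. a i) powr p / n powr p \<le> (\<Sum>i\<in>T. a i powr p) / n"
      using n T(3) by (simp add: powr_divide sum_nonneg less_imp_le)
    then have "(\<Sum>i\<in>T. a i) powr p \<le> n powr p / n * (\<Sum>i\<in>T. a i powr p)"
      using n by (simp add: divide_simps mult.commute)
    also have "n powr p / n = n powr (p - 1)" using n by (simp add: powr_diff)
    also have "n powr (p - 1) * (\<Sum>i\<in>T. a i powr p) \<le> real (card S) powr (p - 1) * (\<Sum>i\<in>T. a i powr p)"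
      using n assms card_mono[OF assms(1) T(2)]
      by (intro mult_right_mono powr_mono2 sum_nonneg) (auto simp: n_def)
    finally show ?thesis using e by simp
  qed (simp add: e)
qed

section \<open>Vertices, edges and their subdivision\<close>

lemma vadj_sym: "vadj m x y \<Longrightarrow> vadj m y x"
  by (simp add: vadj_def insert_commute)

lemma vadj_cases:
  assumes "vadj m x y"
  obtains w i where "w \<in> vwords m" "i \<in> {1..4}"
    "x = foldr vpsi w (vq 5) \<and> y = foldr vpsi w (vq i) \<or> y = foldr vpsi w (vq 5) \<and> x = foldr vpsi w (vq i)"
  using assms unfolding vadj_def by (metis doubleton_eq_iff)

lemma vadjI: "w \<in> vwords m \<Longrightarrow> i \<in> {1..4} \<Longrightarrow> vadj m (foldr vpsi w (vq 5)) (foldr vpsi w (vq i))"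
  unfolding vadj_def by blast

lemma foldr_in_vvert: "w \<in> vwords m \<Longrightarrow> i \<in> {1..5} \<Longrightarrow> foldr vpsi w (vq i) \<in> vvert m"
proof (induction m arbitrary: w)
  case (Suc m)
  then obtain j u where w: "w = j # u" "j \<in> {1..5}" "u \<in> vwords m" unfolding vwords_Suc by blast
  then have "foldr vpsi u (vq i) \<in> vvert m" using Suc by blast
  then show ?case using w unfolding vvert.simps by (simp only: foldr.simps o_def) blast
qed (auto simp: vwords_def)

lemma foldr_in_vcable: "w \<in> vwords m \<Longrightarrow> z \<in> vcable 0 \<Longrightarrow> foldr vpsi w z \<in> vcable m"
proof (induction m arbitrary: w)
  case (Suc m)
  then obtain j u where w: "w = j # u" "j \<in> {1..5}" "u \<in> vwords m" unfolding vwords_Suc by blast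
  then have "foldr vpsi u z \<in> vcable m" using Suc by blast
  then show ?case using w unfolding vcable.simps by (simp only: foldr.simps o_def) blast
qed (auto simp: vwords_def)

lemma vvert_subset_vcable: "vvert m \<subseteq> vcable m"
proof (induction m)
  case 0
  then show ?case using vq_in_vcable[of _ 0] by auto
next
  case (Suc m)
  then show ?case unfolding vvert.simps vcable.simps by blast
qed

lemma vvert_subset_skeleton: "vvert m \<subseteq> vskeleton"
  using vvert_subset_vcable vcable_subset_skeleton by blast

lemma finite_vvert: "finite (vvert m)"
  by (induction m) auto

lemma vq_in_vvert: "i \<in> {1..5} \<Longrightarrow> vq i \<in> vvert m"
proof (induction m)
  case (Suc m)
  then have "vpsi i (vq i) \<in> vvert (Suc m)" unfolding vvert.simps by blast
  then show ?case by (simp only: vq_fixed)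
qed simp

lemma vadj_in_vvert: "vadj m x y \<Longrightarrow> x \<in> vvert m \<and> y \<in> vvert m"
  by (elim vadj_cases) (auto intro!: foldr_in_vvert)

lemma vadj_segment:
  assumes "vadj m x y"
  shows "closed_segment x y \<subseteq> vcable m" "dist x y = 1 / 3 ^ m"
proof -
  obtain w i where w: "w \<in> vwords m" "i \<in> {1..4}" and
    e: "x = foldr vpsi w (vq 5) \<and> y = foldr vpsi w (vq i) \<or> y = foldr vpsi w (vq 5) \<and> x = foldr vpsi w (vq i)"
    using assms by (rule vadj_cases)
  have len: "length w = m" using w by (simp add: vwords_def)
  define a b where "a = foldr vpsi w (vq 5)" and "b = foldr vpsi w (vq i)"
  have b: "b = a + (1 / 3 ^ m) *\<^sub>R vq i"
    using foldr_vpsi[of w "vq i"] len by (simp add: a_def b_def vq5)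
  have "closed_segment a b \<subseteq> vcable m"
  proof
    fix z assume "z \<in> closed_segment a b"
    then obtain u where u: "0 \<le> u" "u \<le> 1" "z = (1 - u) *\<^sub>R a + u *\<^sub>R b" by (auto simp: closed_segment_def)
    have "z = a + (1 / 3 ^ m) *\<^sub>R (u *\<^sub>R vq i)" unfolding u(3) b by (simp add: algebra_simps)
    also have "\<dots> = foldr vpsi w (u *\<^sub>R vq i)"
      using foldr_vpsi[of w "u *\<^sub>R vq i"] len by (simp add: a_def vq5)
    finally have "z = foldr vpsi w (u *\<^sub>R vq i)" .
    moreover have "u *\<^sub>R vq i \<in> closed_segment (vq 5) (vq i)" using u by (auto simp: vq5 closed_segment_def)
    then have "u *\<^sub>R vq i \<in> vcable 0" using w(2) unfolding vcable.simps by blast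
    ultimately show "z \<in> vcable m" using foldr_in_vcable[OF w(1)] by simp
  qed
  moreover have "dist a b = 1 / 3 ^ m" using norm_vq[OF w(2)] by (simp add: b dist_norm)
  ultimately show "closed_segment x y \<subseteq> vcable m" "dist x y = 1 / 3 ^ m"
    using e by (auto simp: a_def b_def closed_segment_commute dist_commute)
qed

text \<open>Of the thirds of an edge of cell \<open>w\<close>, the inner one is an edge of the
  subcell \<open>w @ [5]\<close> and the other two are edges of \<open>w @ [i]\<close>.\<close>

lemma vadj_subdivide:
  assumes "vadj m x y" "k < 3"
  shows "vadj (Suc m) (x + (real k / 3) *\<^sub>R (y - x)) (x + (real (Suc k) / 3) *\<^sub>R (y - x))"
proof -
  obtain w i where w: "w \<in> vwords m" "i \<in> {1..4}" and
    e: "x = foldr vpsi w (vq 5) \<and> y = foldr vpsi w (vq i) \<or> y = foldr vpsi w (vq 5) \<and> x = foldr vpsi w (vq i)"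
    using assms(1) by (rule vadj_cases)
  have len: "length w = m" using w by (simp add: vwords_def)
  define a b where "a = foldr vpsi w (vq 5)" and "b = foldr vpsi w (vq i)"
  define c where "c l = a + (real l / 3) *\<^sub>R (b - a)" for l
  have b: "b - a = (1 / 3 ^ m) *\<^sub>R vq i"
    using foldr_vpsi[of w "vq i"] len by (simp add: a_def b_def vq5)
  have c: "c l = foldr vpsi w ((real l / 3) *\<^sub>R vq i)" for l
    using foldr_vpsi[of w "(real l / 3) *\<^sub>R vq i"] len unfolding c_def b by (simp add: a_def vq5 mult.commute)
  have words: "w @ [j] \<in> vwords (Suc m)" if "j \<in> {1..5}" for j
    using w that by (auto simp: vwords_def)
  have i5: "i \<in> {1..5}" using w by auto
  \<comment> \<open>\<open>c 1\<close> is the joint of the two subcells and therefore has two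
    addresses.\<close>
  have c': "c 0 = foldr vpsi (w @ [5]) (vq 5)" "c 1 = foldr vpsi (w @ [5]) (vq i)"
    "c 2 = foldr vpsi (w @ [i]) (vq 5)" "c 1 = foldr vpsi (w @ [i]) (vq (vopp i))"
    "c 3 = foldr vpsi (w @ [i]) (vq i)"
    using vjoint_eq(1)[OF w(2)] vjoint_eq(2)[of i]
    by (simp_all add: c vpsi_affine vq5 vjoint_def vq_opp[OF w(2)] flip: scaleR_left_distrib)
  have "vadj (Suc m) (c 0) (c 1)" using vadjI[OF words[of 5] w(2)] c' by simp
  moreover have "vadj (Suc m) (c 1) (c 2)"
    using vadj_sym[OF vadjI[OF words[OF i5] vopp_index[OF w(2)]]] c' by simp
  moreover have "vadj (Suc m) (c 2) (c 3)" using vadjI[OF words[OF i5] w(2)] c' by simp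
  ultimately have adj: "vadj (Suc m) (c l) (c (Suc l))" if "l < 3" for l
    using that by (auto simp: less_Suc_eq numeral_eq_Suc)
  from e consider "x = a" "y = b" | "x = b" "y = a" by (auto simp: a_def b_def)
  then show ?thesis
  proof cases
    case 1
    then show ?thesis using adj[OF assms(2)] by (simp add: c_def)
  next
    case 2
    \<comment> \<open>An edge run through from the corner to the centre meets the same division
      points in reverse order.\<close>
    have "x + (real l / 3) *\<^sub>R (y - x) = c (3 - l)" if "l \<le> 3" for l
      using that unfolding 2 c_def by (simp add: of_nat_diff diff_divide_distrib algebra_simps)
    moreover have "3 - k = Suc (2 - k)" "3 - Suc k = 2 - k" using assms(2) by auto
    ultimately have "x + (real k / 3) *\<^sub>R (y - x) = c (Suc (2 - k))"
        "x + (real (Suc k) / 3) *\<^sub>R (y - x) = c (2 - k)"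
      using assms(2) by (metis less_imp_le, metis Suc_leI)
    then show ?thesis using vadj_sym[OF adj[of "2 - k"]] by simp
  qed
qed

text \<open>Edges are diagonal, so the first coordinate alone measures the position along an
  edge.\<close>

lemma vadj_lattice:
  assumes "vadj m x y"
  shows "\<exists>a :: int. fst x = vh / 3 ^ m * a" "\<bar>fst (y - x)\<bar> = vh / 3 ^ m"
proof -
  obtain w i where w: "w \<in> vwords m" "i \<in> {1..4}" and
    e: "x = foldr vpsi w (vq 5) \<and> y = foldr vpsi w (vq i) \<or> y = foldr vpsi w (vq 5) \<and> x = foldr vpsi w (vq i)"
    using assms by (rule vadj_cases)
  have len: "length w = m" using w by (simp add: vwords_def)
  obtain a b :: int where ab: "foldr vpsi w 0 = (2 * vh / 3 ^ m * a, 2 * vh / 3 ^ m * b)"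
    using cell_center_lattice[of w] len by blast
  obtain c d :: int where cd: "vq i = (vh * c, vh * d)" using vq_lattice by blast
  have "fst (foldr vpsi w (vq 5)) = vh / 3 ^ m * of_int (2 * a)" by (simp add: vq5 ab)
  moreover have f: "fst (foldr vpsi w (vq i)) = fst (foldr vpsi w (vq 5)) + fst (vq i) / 3 ^ m"
    using foldr_vpsi[of w "vq i"] len by (simp add: vq5)
  then have "fst (foldr vpsi w (vq i)) = vh / 3 ^ m * of_int (2 * a + c)"
    by (simp add: vq5 ab cd algebra_simps)
  ultimately show "\<exists>a :: int. fst x = vh / 3 ^ m * a" using e by blast
  have "\<bar>fst (vq i)\<bar> = vh" using w(2) vh_pos unfolding index4 by (elim disjE) (simp_all add: vq_simps)
  then show "\<bar>fst (y - x)\<bar> = vh / 3 ^ m" using e f by (auto simp: abs_divide)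
qed

text \<open>The pairs are ordered, so each edge occurs in both directions, which the factor
  \<open>1/2\<close> of the energy compensates.\<close>

definition vedges :: "nat \<Rightarrow> (real \<times> real) set \<Rightarrow> ((real \<times> real) \<times> (real \<times> real)) set" where
  "vedges m A = {(x, y). x \<in> A \<inter> vvert m \<and> y \<in> A \<inter> vvert m \<and> vadj m x y}"

lemma finite_vedges: "finite (vedges m A)"
  by (rule finite_subset[of _ "vvert m \<times> vvert m"]) (auto simp: vedges_def finite_vvert)

lemma venergy_m_eq:
  "venergy_m m p A f = 1/2 * 3 powr ((p - 1) * real m) * (\<Sum>(x, y)\<in>vedges m A. \<bar>f x - f y\<bar> powr p)"
  by (simp add: venergy_m_def vedges_def)

lemma venergy_m_nonneg: "0 \<le> venergy_m m p A f"
  unfolding venergy_m_eq by (intro mult_nonneg_nonneg sum_nonneg) auto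

text \<open>The subdivided edges of different edges differ: their direction gives that of the original
  edge, and the start points of the edges of level \<open>m\<close> lie on a lattice of mesh \<open>vh / 3 ^ m\<close>.\<close>

lemma subdivide_inj:
  "inj_on (\<lambda>((x, y), k :: nat). (x + (real k / 3) *\<^sub>R (y - x), x + (real (Suc k) / 3) *\<^sub>R (y - x)))
     (vedges m A \<times> {..<3})"
proof (rule inj_onI)
  fix s s'
  assume s: "s \<in> vedges m A \<times> {..<3}" "s' \<in> vedges m A \<times> {..<3}"
    and eqs: "(\<lambda>((x, y), k). (x + (real k / 3) *\<^sub>R (y - x), x + (real (Suc k) / 3) *\<^sub>R (y - x))) s =
      (\<lambda>((x, y), k). (x + (real k / 3) *\<^sub>R (y - x), x + (real (Suc k) / 3) *\<^sub>R (y - x))) s'"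
  obtain x y k where s1: "s = ((x, y), k)" by (metis surj_pair)
  obtain x' y' k' where s2: "s' = ((x', y'), k')" by (metis surj_pair)
  have adj: "vadj m x y" "vadj m x' y'" and k: "k < 3" "k' < 3"
    using s unfolding s1 s2 by (auto simp: vedges_def)
  have eq: "x + (real k / 3) *\<^sub>R (y - x) = x' + (real k' / 3) *\<^sub>R (y' - x')"
     "x + (real (Suc k) / 3) *\<^sub>R (y - x) = x' + (real (Suc k') / 3) *\<^sub>R (y' - x')"
    using eqs unfolding s1 s2 by (simp_all only: prod.case prod.inject)
  have step: "(z + (real (Suc l) / 3) *\<^sub>R v) - (z + (real l / 3) *\<^sub>R v) = (1 / 3) *\<^sub>R v"
    for z v :: "real \<times> real" and l
    by (simp add: algebra_simps add_divide_distrib)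
  have "(1 / 3 :: real) *\<^sub>R (y - x) = (1 / 3) *\<^sub>R (y' - x')"
    using step[of x k "y - x"] step[of x' k' "y' - x'"] eq by simp
  then have v: "y - x = y' - x'" by simp
  obtain i i' :: int where i: "fst x = vh / 3 ^ m * i" "fst x' = vh / 3 ^ m * i'"
    using vadj_lattice(1)[OF adj(1)] vadj_lattice(1)[OF adj(2)] by blast
  have "fst x + real k / 3 * fst (y - x) = fst x' + real k' / 3 * fst (y - x)"
    using arg_cong[OF eq(1), of fst] v by simp
  moreover obtain sg :: int where sg: "\<bar>sg\<bar> = 1" "fst (y - x) = vh / 3 ^ m * of_int sg"
  proof -
    have "fst (y - x) = vh / 3 ^ m * of_int 1 \<or> fst (y - x) = vh / 3 ^ m * of_int (- 1)"
      using vadj_lattice(2)[OF adj(1)] by (auto simp: abs_if split: if_splits)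
    then show ?thesis using that[of 1] that[of "- 1"] by auto
  qed
  ultimately have "(vh / 3 ^ m) * (of_int i + real k / 3 * of_int sg) = (vh / 3 ^ m) * (of_int i' + real k' / 3 * of_int sg)"
    unfolding i by (simp add: algebra_simps)
  then have "of_int i + real k / 3 * of_int sg = of_int i' + real k' / 3 * of_int sg" using vh_pos by simp
  then have "of_int (3 * i + int k * sg) = (of_int (3 * i' + int k' * sg) :: real)" by (simp add: field_simps)
  then have "3 * i + int k * sg = 3 * i' + int k' * sg" by (simp only: of_int_eq_iff)
  moreover have "sg = 1 \<or> sg = - 1" using sg(1) by linarith
  \<comment> \<open>Modulo 3 the indices \<open>k\<close> and \<open>k'\<close> agree up to the
    common sign, and both are below 3.\<close>
  ultimately have kk: "k = k'" using k by (elim disjE) (simp_all, presburger+)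
  then have "x = x'" using eq(1) v by simp
  then show "s = s'" using v kk s1 s2 by simp
qed

text \<open>On a straight edge geodesic and Euclidean distance coincide, so each of its points is
  between the ends.\<close>

lemma geodesically_convex_edge:
  assumes A: "geodesically_convex A" and xy: "(x, y) \<in> vedges m A"
  shows "closed_segment x y \<subseteq> A"
proof
  fix z assume z: "z \<in> closed_segment x y"
  have adj: "vadj m x y" "x \<in> A \<inter> vskeleton" "y \<in> A \<inter> vskeleton"
    using xy vvert_subset_skeleton by (auto simp: vedges_def)
  note s = vadj_segment(1)[OF adj(1)]
  have "skeleton_dist x z = dist x z" "skeleton_dist z y = dist z y" "skeleton_dist x y = dist x y"
    using z s by (auto intro!: skeleton_dist_segment[of _ _ m] dest: subsetD[OF subset_closed_segment[THEN iffD2], rotated])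
  moreover have "dist x z + dist z y = dist x y"
    using z by (simp add: between_mem_segment[symmetric] between)
  moreover have "z \<in> vskeleton" using z s vcable_subset_skeleton by blast
  ultimately show "z \<in> A" using geodesically_convex_between[OF A adj(2,3)] by simp
qed

text \<open>The power mean inequality for three terms costs \<open>3 powr (p - 1)\<close>, exactly
  the ratio of the renormalizing factors of consecutive levels.\<close>

lemma venergy_m_mono:
  assumes A: "geodesically_convex A" and p: "1 \<le> p"
  shows "venergy_m m p A f \<le> venergy_m (Suc m) p A f"
proof -
  let ?T = "\<lambda>((x, y), k :: nat). (x + (real k / 3) *\<^sub>R (y - x), x + (real (Suc k) / 3) *\<^sub>R (y - x))"
  let ?F = "\<lambda>(x, y). \<bar>f x - f y\<bar> powr p"
  have sub: "?F (x, y) \<le> 3 powr (p - 1) * (\<Sum>k<3. ?F (?T ((x, y), k)))" for x y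
  proof -
    let ?c = "\<lambda>k. f (x + (real k / 3) *\<^sub>R (y - x))"
    have "f x - f y = (\<Sum>k<3. ?c k - ?c (Suc k))"
      by (simp add: numeral_eq_Suc)
    then have "\<bar>f x - f y\<bar> \<le> (\<Sum>k<3. \<bar>?c k - ?c (Suc k)\<bar>)" by (simp only: sum_abs)
    then have "\<bar>f x - f y\<bar> powr p \<le> (\<Sum>k<3. \<bar>?c k - ?c (Suc k)\<bar>) powr p"
      using p by (intro powr_mono2) auto
    also have "\<dots> \<le> real (card {..<3::nat}) powr (p - 1) * (\<Sum>k<3. \<bar>?c k - ?c (Suc k)\<bar> powr p)"
      using p by (intro sum_powr_le) auto
    finally show ?thesis by simp
  qed
  have im: "?T ` (vedges m A \<times> {..<3}) \<subseteq> vedges (Suc m) A"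
  proof (rule image_subsetI)
    fix s assume s: "s \<in> vedges m A \<times> {..<3::nat}"
    obtain x y k where s1: "s = ((x, y), k)" by (metis surj_pair)
    have e': "(x, y) \<in> vedges m A" and k: "k < 3" using s s1 by auto
    note adj = vadj_subdivide[OF _ k, of m x y]
    have a: "vadj (Suc m) (x + (real k / 3) *\<^sub>R (y - x)) (x + (real (Suc k) / 3) *\<^sub>R (y - x))"
      using e' by (intro adj) (auto simp: vedges_def)
    have "x + (real l / 3) *\<^sub>R (y - x) \<in> A" if "l \<le> 3" for l
    proof -
      have "x + (real l / 3) *\<^sub>R (y - x) = (1 - real l / 3) *\<^sub>R x + (real l / 3) *\<^sub>R y"
        by (simp add: algebra_simps)
      then have "x + (real l / 3) *\<^sub>R (y - x) \<in> closed_segment x y"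
        unfolding closed_segment_def using that by (auto intro!: exI[of _ "real l / 3"])
      then show ?thesis using geodesically_convex_edge[OF A e'] by blast
    qed
    from this[of k] this[of "Suc k"] show "?T s \<in> vedges (Suc m) A"
      unfolding s1 using a vadj_in_vvert[OF a] k by (simp add: vedges_def)
  qed
  have "(\<Sum>e\<in>vedges m A. ?F e) \<le> (\<Sum>e\<in>vedges m A. 3 powr (p - 1) * (\<Sum>k<3. ?F (?T (e, k))))"
  proof (rule sum_mono)
    fix e :: "(real \<times> real) \<times> (real \<times> real)"
    obtain x y where "e = (x, y)" by (cases e)
    then show "?F e \<le> 3 powr (p - 1) * (\<Sum>k<3. ?F (?T (e, k)))" using sub[of x y] by simp
  qed
  also have "\<dots> = 3 powr (p - 1) * (\<Sum>e\<in>vedges m A. \<Sum>k<3. ?F (?T (e, k)))"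
    by (simp only: sum_distrib_left)
  also have "(\<Sum>e\<in>vedges m A. \<Sum>k<3. ?F (?T (e, k))) =
      (\<Sum>(e, k)\<in>vedges m A \<times> {..<3}. ?F (?T (e, k)))"
    by (rule sum.cartesian_product)
  also have "\<dots> = (\<Sum>ek\<in>vedges m A \<times> {..<3}. ?F (?T ek))"
    by (intro sum.cong refl) (simp add: split_beta)
  \<comment> \<open>Here \<open>subdivide_inj\<close> ensures that no edge of level
    \<open>Suc m\<close> is charged twice.\<close>
  also have "(\<Sum>ek\<in>vedges m A \<times> {..<3}. ?F (?T ek)) = (\<Sum>e\<in>?T ` (vedges m A \<times> {..<3}). ?F e)"
    by (subst sum.reindex[OF subdivide_inj]) (simp only: o_def)
  also have "\<dots> \<le> (\<Sum>e\<in>vedges (Suc m) A. ?F e)"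
    using im finite_vedges by (intro sum_mono2) auto
  finally have "(\<Sum>e\<in>vedges m A. ?F e) \<le> 3 powr (p - 1) * (\<Sum>e\<in>vedges (Suc m) A. ?F e)" by simp
  then have "3 powr ((p - 1) * real m) * (\<Sum>e\<in>vedges m A. ?F e) \<le>
      3 powr ((p - 1) * real m) * (3 powr (p - 1) * (\<Sum>e\<in>vedges (Suc m) A. ?F e))"
    by (intro mult_left_mono) auto
  also have "\<dots> = 3 powr ((p - 1) * real (Suc m)) * (\<Sum>e\<in>vedges (Suc m) A. ?F e)"
  proof -
    have "(3::real) powr ((p - 1) * real (Suc m)) = 3 powr ((p - 1) * real m) * 3 powr (p - 1)"
      by (simp add: distrib_left add.commute flip: powr_add)
    then show ?thesis by simp
  qed
  finally show ?thesis unfolding venergy_m_eq by simp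
qed

text \<open>By monotonicity the limit exists in the extended reals and is the supremum over all
  levels.\<close>

lemma venergy_ge:
  assumes "geodesically_convex A" "1 \<le> p"
  shows "ereal (venergy_m m p A f) \<le> venergy p A f" "0 \<le> venergy p A f"
proof -
  have "incseq (\<lambda>m. ereal (venergy_m m p A f))"
    using venergy_m_mono[OF assms] by (intro incseq_SucI) simp
  then have eq: "venergy p A f = (SUP m. ereal (venergy_m m p A f))"
    unfolding venergy_def by (intro limI LIMSEQ_SUP)
  show le: "ereal (venergy_m m p A f) \<le> venergy p A f" for m 
    unfolding eq by (rule SUP_upper) simp
  show "0 \<le> venergy p A f"
    using order_trans[OF _ le[of 0]] venergy_m_nonneg[of 0 p A f] by simp
qed

section \<open>The energy controls the oscillation\<close>

text \<open>Expresses that some chain of edges is a geodesic: \<open>k\<close> edges of length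
  \<open>1 / 3 ^ m\<close> span a distance of exactly \<open>k\<close> edge lengths.\<close>

definition vgrid :: "nat \<Rightarrow> real \<times> real \<Rightarrow> real \<times> real \<Rightarrow> bool" where
  "vgrid m u v \<longleftrightarrow> (\<exists>k. (vadj m ^^ k) u v \<and> skeleton_dist u v = real k / 3 ^ m)"

lemma vgrid_trans:
  assumes "vgrid m u v" "vgrid m v w" "skeleton_dist u w = skeleton_dist u v + skeleton_dist v w"
  shows "vgrid m u w"
proof -
  obtain k l where "(vadj m ^^ k) u v" "skeleton_dist u v = real k / 3 ^ m"
      "(vadj m ^^ l) v w" "skeleton_dist v w = real l / 3 ^ m"
    using assms(1,2) by (auto simp: vgrid_def)
  then show ?thesis unfolding vgrid_def
    using assms(3) relpowp_trans by (intro exI[of _ "k + l"]) (auto simp: add_divide_distrib)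
qed

lemma vgrid_refl: "u \<in> vskeleton \<Longrightarrow> vgrid m u u"
  unfolding vgrid_def by (intro exI[of _ 0]) (simp add: skeleton_dist_pair)

lemma vgrid_edge: "vadj m u v \<Longrightarrow> vgrid m u v"
  unfolding vgrid_def using skeleton_dist_segment[OF vadj_segment(1), of m u v] vadj_segment(2)[of m u v]
  by (intro exI[of _ 1]) (simp only: relpowp_1 of_nat_1)

lemma vadj_vpsi:
  assumes i: "i \<in> {1..5}" and "vadj m x y"
  shows "vadj (Suc m) (vpsi i x) (vpsi i y)"
proof -
  obtain w j where w: "w \<in> vwords m" "j \<in> {1..4}" "{x, y} = {foldr vpsi w (vq 5), foldr vpsi w (vq j)}"
    using assms(2) unfolding vadj_def by blast
  have "vpsi i ` {x, y} = {foldr vpsi (i # w) (vq 5), foldr vpsi (i # w) (vq j)}"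
    unfolding w(3) by simp
  moreover have "i # w \<in> vwords (Suc m)" using i w(1) by (simp add: vwords_def)
  ultimately show ?thesis unfolding vadj_def using w(2) by (metis image_empty image_insert)
qed

lemma vgrid_vpsi:
  assumes i: "i \<in> {1..5}" and uv: "u \<in> vskeleton" "v \<in> vskeleton" and g: "vgrid m u v"
  shows "vgrid (Suc m) (vpsi i u) (vpsi i v)"
proof -
  obtain k where k: "(vadj m ^^ k) u v" "skeleton_dist u v = real k / 3 ^ m" using g by (auto simp: vgrid_def)
  have "(vadj m ^^ k) u v \<Longrightarrow> (vadj (Suc m) ^^ k) (vpsi i u) (vpsi i v)"
  proof (induction k arbitrary: v)
    case (Suc k)
    from Suc.prems obtain w where "(vadj m ^^ k) u w" "vadj m w v" by (rule relpowp_Suc_E)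
    then show ?case using relpowp_Suc_I[OF Suc.IH vadj_vpsi[OF i]] by blast
  qed simp
  then show ?thesis unfolding vgrid_def
    using k skeleton_dist_vpsi[OF i uv] by (intro exI[of _ k]) simp
qed

text \<open>Inside one cell the previous level provides the chain. Chains of different cells are
  linked at the joints, which are vertices of both cells and where distances add.\<close>

lemma vgrid_vertices: "u \<in> vvert m \<Longrightarrow> v \<in> vvert m \<Longrightarrow> vgrid m u v"
proof (induction m arbitrary: u v)
  case 0
  have c: "vgrid 0 (vq 5) (vq i)" "vgrid 0 (vq i) (vq 5)" if "i \<in> {1..5}" for i
  proof -
    have "[] \<in> vwords 0" by (simp add: vwords_def)
    have "i = 5 \<or> i \<in> {1..4}" using that by auto
    then have "vq i = vq 5 \<or> vadj 0 (vq 5) (vq i)"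
      using vadjI[OF \<open>[] \<in> vwords 0\<close>, of i] by auto
    then show "vgrid 0 (vq 5) (vq i)" "vgrid 0 (vq i) (vq 5)"
      using vgrid_edge[of 0 "vq 5" "vq i"] vgrid_edge[OF vadj_sym[of 0 "vq 5" "vq i"]]
        vgrid_refl[OF vq_in_skeleton[of 5], of 0] by auto
  qed
  obtain i j where ij: "i \<in> {1..5}" "u = vq i" "j \<in> {1..5}" "v = vq j" using 0 by auto
  consider "i = j" | "i = 5" | "j = 5" | "i \<noteq> j" "i \<in> {1..4}" "j \<in> {1..4}" using ij by fastforce
  then show ?case
  proof cases
    case 1 then show ?thesis using vgrid_refl vq_in_skeleton ij by simp
  next
    case 2 then show ?thesis using c ij by simp
  next
    case 3 then show ?thesis using c ij by simp
  next
    case 4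
    then show ?thesis
      using vgrid_trans[OF c(2)[OF ij(1)] c(1)[OF ij(3)]] skeleton_dist_star[of i j "vq i" "vq j"] ij by simp
  qed
next
  case (Suc m)
  have S: "z \<in> vskeleton" if "z \<in> vvert m" for z using that vvert_subset_skeleton by blast
  have same: "vgrid (Suc m) (vpsi i u) (vpsi i v)" if "i \<in> {1..5}" "u \<in> vvert m" "v \<in> vvert m" for i u v
    using vgrid_vpsi[OF that(1) S[OF that(2)] S[OF that(3)] Suc.IH[OF that(2,3)]] .
  have joint: "vgrid (Suc m) (vpsi i u) (vjoint i)" "vgrid (Suc m) (vjoint i) (vpsi i u)"
    "vgrid (Suc m) (vpsi 5 u) (vjoint i)" "vgrid (Suc m) (vjoint i) (vpsi 5 u)"
    if i: "i \<in> {1..4}" and u: "u \<in> vvert m" for i u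
  proof -
    have q: "vq i \<in> vvert m" "vq (vopp i) \<in> vvert m" using i vopp_index[OF i] by (auto intro!: vq_in_vvert)
    have "i \<in> {1..5}" using i by auto
    then show "vgrid (Suc m) (vpsi i u) (vjoint i)" "vgrid (Suc m) (vjoint i) (vpsi i u)"
      unfolding vjoint_eq(1)[OF i, symmetric] using same u q by auto
    show "vgrid (Suc m) (vpsi 5 u) (vjoint i)" "vgrid (Suc m) (vjoint i) (vpsi 5 u)"
      unfolding vjoint_eq(2)[of i, symmetric] using same[of 5] u q by auto
  qed
  have center: "vgrid (Suc m) (vpsi i u) (vpsi 5 v)" "vgrid (Suc m) (vpsi 5 v) (vpsi i u)"
    if i: "i \<in> {1..4}" and uv: "u \<in> vvert m" "v \<in> vvert m" for i u v
  proof -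
    have i5: "i \<in> {1..5}" "5 \<noteq> i" "5 \<in> {1..5::nat}" using i by auto
    note d = skeleton_dist_joint[OF i i5(3,2) S[OF uv(1)] S[OF uv(2)]]
    show "vgrid (Suc m) (vpsi i u) (vpsi 5 v)"
      using vgrid_trans[OF joint(1)[OF i uv(1)] joint(4)[OF i uv(2)] d] .
    have "skeleton_dist (vpsi 5 v) (vpsi i u) =
        skeleton_dist (vpsi 5 v) (vjoint i) + skeleton_dist (vjoint i) (vpsi i u)"
      using d skeleton_dist_pair(2) vpsi_skeleton[OF i5(1) S[OF uv(1)]] vpsi_skeleton[OF i5(3) S[OF uv(2)]]
        vjoint_in_skeleton[OF i] by simp
    then show "vgrid (Suc m) (vpsi 5 v) (vpsi i u)"
      using vgrid_trans[OF joint(3)[OF i uv(2)] joint(2)[OF i uv(1)]] by simp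
  qed
  obtain i u' j v' where i: "i \<in> {1..5}" "u' \<in> vvert m" "u = vpsi i u'"
      and j: "j \<in> {1..5}" "v' \<in> vvert m" "v = vpsi j v'"
    using Suc.prems unfolding vvert.simps by blast
  consider "i = j" | "i = 5" "j \<in> {1..4}" | "j = 5" "i \<in> {1..4}" | "i \<noteq> j" "i \<in> {1..4}" "j \<in> {1..4}"
    using i(1) j(1) by fastforce
  then show ?case
  proof cases
    case 1 then show ?thesis using same i j by simp
  next
    case 2 then show ?thesis using center(2) i j by simp
  next
    case 3 then show ?thesis using center(1) i j by simp
  next
    case 4
    \<comment> \<open>Between two corner cells the chain crosses the central cell, which it enters
      at \<open>vjoint i\<close>.\<close>
    have "vgrid (Suc m) (vjoint i) (vpsi j v')"
      unfolding vjoint_eq(2)[of i, symmetric] using center(2)[OF 4(3) j(2), of "vq i"] i by (simp add: vq_in_vvert)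
    then show ?thesis
      using vgrid_trans[OF joint(1)[OF 4(2) i(2)] _ skeleton_dist_joint[OF 4(2) j(1) _ S[OF i(2)] S[OF j(2)]]]
        4 i j by simp
  qed
qed

text \<open>\<open>vpsi i c\<close> is the exit of cell \<open>i\<close> towards cell
  \<open>j\<close>: \<open>c\<close> is the corner opposite to \<open>vq i\<close> if
  \<open>i\<close> is a corner cell, and \<open>vq j\<close> if \<open>i\<close> is the central
  one.\<close>

lemma skeleton_dist_joint_cell:
  assumes i: "i \<in> {1..5}" and j: "j \<in> {1..5}" "i \<noteq> j"
  shows "\<exists>c\<in>vvert m. vpsi i c \<in> vvert (Suc m) \<and> (\<forall>x\<in>vskeleton. \<forall>y\<in>vskeleton.
    skeleton_dist (vpsi i x) (vpsi j y) = skeleton_dist (vpsi i x) (vpsi i c) + skeleton_dist (vpsi i c) (vpsi j y))"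
proof -
  have v: "vpsi i c \<in> vvert (Suc m)" if "c \<in> vvert m" for c
    unfolding vvert.simps using i that by blast
  show ?thesis
  proof (cases "i = 5")
    case False
    then have i4: "i \<in> {1..4}" using i by auto
    have c: "vq (vopp i) \<in> vvert m" using vopp_index[OF i4] by (intro vq_in_vvert) auto
    show ?thesis
      using skeleton_dist_joint[OF i4 j(1) j(2)[symmetric]] unfolding vjoint_eq(1)[OF i4, symmetric]
      by (intro bexI[OF _ c] conjI v[OF c]) blast
  next
    case True
    then have j4: "j \<in> {1..4}" and ne: "i \<noteq> j" using j by auto
    have c: "vq j \<in> vvert m" using j by (intro vq_in_vvert)
    have "skeleton_dist (vpsi i x) (vpsi j y) =
        skeleton_dist (vpsi i x) (vjoint j) + skeleton_dist (vjoint j) (vpsi j y)"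
      if "x \<in> vskeleton" "y \<in> vskeleton" for x y
      using skeleton_dist_joint[OF j4 i ne that(2,1)] skeleton_dist_pair(2) vjoint_in_skeleton[OF j4]
        vpsi_skeleton[OF i that(1)] vpsi_skeleton[OF j(1) that(2)] by simp
    moreover have "vjoint j = vpsi i (vq j)" using vjoint_eq(2) True by simp
    ultimately show ?thesis by (intro bexI[OF _ c] conjI v[OF c] ballI) simp
  qed
qed

lemma vvert_Suc_cases:
  assumes "x \<in> vvert (Suc n)"
  obtains i x' where "i \<in> {1..5}" "x' \<in> vvert n" "x = vpsi i x'"
  using assms unfolding vvert.simps by blast

text \<open>\<open>u\<close> is the vertex at which the geodesic from \<open>x\<close> to
  \<open>v\<close> leaves the edge of \<open>x\<close>. It is found inside the cell of
  \<open>x\<close>, by aiming at the exit of that cell when \<open>v\<close> lies in another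
  one.\<close>

lemma first_vertex:
  "x \<in> vcable m \<Longrightarrow> v \<in> vvert m \<Longrightarrow>
    \<exists>u\<in>vvert m. skeleton_dist x v = skeleton_dist x u + skeleton_dist u v \<and> skeleton_dist x u \<le> 1 / 3 ^ m"
proof (induction m arbitrary: x v)
  case 0
  obtain i where i: "i \<in> {1..4}" "x \<in> closed_segment (vq 5) (vq i)" using 0 unfolding vcable.simps by blast
  obtain j where j: "j \<in> {1..5}" "v = vq j" using 0 by auto
  have xS: "x \<in> vskeleton" using 0 vcable_subset_skeleton by blast
  have d5: "skeleton_dist x (vq 5) \<le> 1" using skeleton_dist_center_le[OF 0(1)] by (simp add: vq5)
  have q5: "vq 5 \<in> vvert 0" "vq j \<in> vvert 0" "vq 5 \<in> vskeleton" "vq j \<in> vskeleton"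
    using vq_in_vvert vq_in_skeleton j by auto
  consider "j = i" | "j = 5" | "j \<in> {1..4}" "i \<noteq> j" using j by fastforce
  then show ?case
  proof cases
    case 1
    have "closed_segment x v \<subseteq> closed_segment (vq 5) (vq i)"
      using i(2) j 1 by (intro closed_segment_subset) auto
    then have "closed_segment x v \<subseteq> vcable 0" using i(1) unfolding vcable.simps by blast
    then have "skeleton_dist x v = dist x v" by (rule skeleton_dist_segment)
    also have "\<dots> \<le> dist (vq 5) (vq i)"
      using i(2) 1 j segment_bound(2)[of x "vq 5" "vq i"] by (simp add: dist_norm norm_minus_commute)
    also have "\<dots> = 1" using norm_vq[OF i(1)] by (simp add: vq5)
    finally show ?thesis using q5 j by (intro bexI[of _ v]) (auto simp: skeleton_dist_pair)
  next
    case 2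
    then show ?thesis using d5 q5 j by (intro bexI[of _ "vq 5"]) (auto simp: skeleton_dist_pair)
  next
    case 3
    then show ?thesis using d5 q5 j skeleton_dist_star[OF i(1) 3 i(2), of v] by (intro bexI[of _ "vq 5"]) auto
  qed
next
  case (Suc m)
  obtain i x' where i: "i \<in> {1..5}" "x' \<in> vcable m" "x = vpsi i x'" using Suc.prems(1) by (rule vcable_Suc_cases)
  obtain j v' where j: "j \<in> {1..5}" "v' \<in> vvert m" "v = vpsi j v'" using Suc.prems(2) by (rule vvert_Suc_cases)
  have S: "x' \<in> vskeleton" "v' \<in> vskeleton" using i j vcable_subset_skeleton vvert_subset_skeleton by auto
  have cell: "\<exists>u\<in>vvert (Suc m). skeleton_dist x (vpsi i c) = skeleton_dist x u + skeleton_dist u (vpsi i c) \<and>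
      skeleton_dist x u \<le> 1 / 3 ^ Suc m" if c: "c \<in> vvert m" for c
  proof -
    obtain u where u: "u \<in> vvert m" "skeleton_dist x' c = skeleton_dist x' u + skeleton_dist u c"
        "skeleton_dist x' u \<le> 1 / 3 ^ m" using Suc.IH[OF i(2) c] by blast
    have uc: "u \<in> vskeleton" "c \<in> vskeleton" using u c vvert_subset_skeleton by auto
    have mem: "vpsi i u \<in> vvert (Suc m)" unfolding vvert.simps using u i by blast
    show ?thesis
      using u(2,3) skeleton_dist_vpsi[OF i(1) S(1) uc(1)] skeleton_dist_vpsi[OF i(1) S(1) uc(2)]
        skeleton_dist_vpsi[OF i(1) uc] unfolding i(3)
      by (intro bexI[OF _ mem]) simp
  qed
  show ?case
  proof (cases "i = j")
    case True then show ?thesis using cell[OF j(2)] j by simp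
  next
    case False
    obtain c where c: "c \<in> vvert m" "vpsi i c \<in> vvert (Suc m)"
        "skeleton_dist x v = skeleton_dist x (vpsi i c) + skeleton_dist (vpsi i c) v"
      using skeleton_dist_joint_cell[OF i(1) j(1) False, of m] S i j by blast
    obtain u where u: "u \<in> vvert (Suc m)" "skeleton_dist x (vpsi i c) = skeleton_dist x u + skeleton_dist u (vpsi i c)"
      "skeleton_dist x u \<le> 1 / 3 ^ Suc m" using cell[OF c(1)] by blast
    have SS: "x \<in> vskeleton" "v \<in> vskeleton" "u \<in> vskeleton" "vpsi i c \<in> vskeleton"
      using Suc.prems u(1) c(2) vcable_subset_skeleton vvert_subset_skeleton by blast+
    have "skeleton_dist x v = skeleton_dist x u + skeleton_dist u v"
      using c(3) u(2) skeleton_dist_triangle[OF SS(3,4,2)] skeleton_dist_triangle[OF SS(1,3,2)] by linarith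
    then show ?thesis using u by blast
  qed
qed

text \<open>Two points with no vertex between them share an edge, and edges have length
  \<open>1 / 3 ^ m\<close>.\<close>

lemma vertex_between:
  "x \<in> vcable m \<Longrightarrow> y \<in> vcable m \<Longrightarrow> skeleton_dist x y \<le> 1 / 3 ^ m \<or>
    (\<exists>u\<in>vvert m. skeleton_dist x y = skeleton_dist x u + skeleton_dist u y)"
proof (induction m arbitrary: x y)
  case 0
  obtain i where i: "i \<in> {1..4}" "x \<in> closed_segment (vq 5) (vq i)" using 0 unfolding vcable.simps by blast
  obtain j where j: "j \<in> {1..4}" "y \<in> closed_segment (vq 5) (vq j)" using 0 unfolding vcable.simps by blast
  show ?case
  proof (cases "i = j")
    case True
    have "closed_segment x y \<subseteq> closed_segment (vq 5) (vq i)"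
      using i(2) j True by (intro closed_segment_subset) auto
    then have "closed_segment x y \<subseteq> vcable 0" using i(1) unfolding vcable.simps by blast
    then have "skeleton_dist x y = dist x y" by (rule skeleton_dist_segment)
    also have "\<dots> \<le> dist (vq 5) (vq i)"
    proof -
      obtain s t where "0 \<le> s" "s \<le> 1" "x = s *\<^sub>R vq i" "0 \<le> t" "t \<le> 1" "y = t *\<^sub>R vq i"
        using i(2) j(2) True unfolding closed_segment_def vq5 by auto
      then show ?thesis using norm_vq[OF i(1)] by (simp add: dist_norm vq5 flip: scaleR_left_diff_distrib)
    qed
    also have "\<dots> = 1" using norm_vq[OF i(1)] by (simp add: vq5)
    finally show ?thesis by simp
  next
    case False
    then show ?thesis using skeleton_dist_star[OF i(1) j(1) False i(2) j(2)] vq_in_vvert[of 5 0] by auto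
  qed
next
  case (Suc m)
  obtain i x' where i: "i \<in> {1..5}" "x' \<in> vcable m" "x = vpsi i x'" using Suc.prems(1) by (rule vcable_Suc_cases)
  obtain j y' where j: "j \<in> {1..5}" "y' \<in> vcable m" "y = vpsi j y'" using Suc.prems(2) by (rule vcable_Suc_cases)
  have S: "x' \<in> vskeleton" "y' \<in> vskeleton" using i j vcable_subset_skeleton by auto
  show ?case
  proof (cases "i = j")
    case True
    note d = skeleton_dist_vpsi[OF i(1) S]
    from Suc.IH[OF i(2) j(2)] show ?thesis
    proof
      assume "skeleton_dist x' y' \<le> 1 / 3 ^ m"
      then show ?thesis using d i j True by simp
    next
      assume "\<exists>u\<in>vvert m. skeleton_dist x' y' = skeleton_dist x' u + skeleton_dist u y'"
      then obtain u where u: "u \<in> vvert m" "skeleton_dist x' y' = skeleton_dist x' u + skeleton_dist u y'" by blast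
      have uS: "u \<in> vskeleton" using u vvert_subset_skeleton by auto
      have mem: "vpsi i u \<in> vvert (Suc m)" unfolding vvert.simps using u i by blast
      show ?thesis
        using u(2) d skeleton_dist_vpsi[OF i(1) S(1) uS] skeleton_dist_vpsi[OF i(1) uS S(2)]
        unfolding i(3) j(3) True[symmetric] by (intro disjI2 bexI[OF _ mem]) simp
    qed
  next
    case False
    then show ?thesis using skeleton_dist_joint_cell[OF i(1) j(1) False, of m] S i j by blast
  qed
qed

text \<open>A vertex \<open>w\<close> between \<open>x\<close> and \<open>y\<close> serves as the
  common target for the first vertices seen from the two ends.\<close>

lemma skeleton_vertices:
  assumes xy: "x \<in> vcable m" "y \<in> vcable m" and d: "1 / 3 ^ m < skeleton_dist x y"
  obtains u v where "u \<in> vvert m" "v \<in> vvert m"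
    "skeleton_dist x y = skeleton_dist x u + skeleton_dist u v + skeleton_dist v y"
    "skeleton_dist x u \<le> 1 / 3 ^ m" "skeleton_dist y v \<le> 1 / 3 ^ m"
proof -
  obtain w where w: "w \<in> vvert m" "skeleton_dist x y = skeleton_dist x w + skeleton_dist w y"
    using vertex_between[OF xy] d by auto
  obtain u where u: "u \<in> vvert m" "skeleton_dist x w = skeleton_dist x u + skeleton_dist u w"
      "skeleton_dist x u \<le> 1 / 3 ^ m" using first_vertex[OF xy(1) w(1)] by blast
  obtain v where v: "v \<in> vvert m" "skeleton_dist y w = skeleton_dist y v + skeleton_dist v w"
      "skeleton_dist y v \<le> 1 / 3 ^ m" using first_vertex[OF xy(2) w(1)] by blast
  have S: "x \<in> vskeleton" "y \<in> vskeleton" "u \<in> vskeleton" "v \<in> vskeleton" "w \<in> vskeleton"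
    using xy u(1) v(1) w(1) vcable_subset_skeleton vvert_subset_skeleton by blast+
  have "skeleton_dist x y = skeleton_dist x u + skeleton_dist u v + skeleton_dist v y"
    using w u v skeleton_dist_pair(2)[OF S(2,5)] skeleton_dist_pair(2)[OF S(2,4)] skeleton_dist_pair(2)[OF S(4,5)]
      skeleton_dist_triangle[OF S(3,5,4)] skeleton_dist_triangle[OF S(1,3,2)] skeleton_dist_triangle[OF S(3,4,2)]
    by linarith
  then show ?thesis using that u v by blast
qed

lemma vertex_energy_bound:
  assumes A: "geodesically_convex A" and p: "1 \<le> p" and uv: "u \<in> A \<inter> vvert m" "v \<in> A \<inter> vvert m"
  shows "\<bar>f u - f v\<bar> powr p \<le> skeleton_dist u v powr (p - 1) * venergy_m m p A f"
proof -
  obtain k where k: "(vadj m ^^ k) u v" "skeleton_dist u v = real k / 3 ^ m"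
    using vgrid_vertices[of u m v] uv by (auto simp: vgrid_def)
  obtain q where q: "q 0 = u" "q k = v" "\<And>i. i < k \<Longrightarrow> vadj m (q i) (q (Suc i))"
    using k(1) unfolding relpowp_fun_conv by blast
  have uS: "u \<in> vskeleton" "v \<in> vskeleton" using uv vvert_subset_skeleton by auto
  have qv: "q i \<in> vvert m" if "i \<le> k" for i
    using that uv q vadj_in_vvert[OF q(3)[of i]] by (cases "i = k") auto
  then have qS: "q i \<in> vskeleton" if "i \<le> k" for i using that vvert_subset_skeleton by blast
  have le: "skeleton_dist (q i) (q j) \<le> real (j - i) / 3 ^ m" if "i \<le> j" "j \<le> k" for i j
    using that
  proof (induction j)
    case 0
    then show ?case using skeleton_dist_pair(3)[OF qS qS, of 0 0] by simp
  next
    case (Suc j)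
    show ?case
    proof (cases "i = Suc j")
      case True
      then show ?thesis using skeleton_dist_pair(3)[OF qS qS, of i i] Suc.prems by simp
    next
      case False
      then have "i \<le> j" using Suc.prems by simp
      have "skeleton_dist (q j) (q (Suc j)) = 1 / 3 ^ m"
        using skeleton_dist_segment[OF vadj_segment(1)[OF q(3)]] vadj_segment(2)[OF q(3)] Suc.prems by simp
      then have "skeleton_dist (q i) (q (Suc j)) \<le> real (j - i) / 3 ^ m + 1 / 3 ^ m"
        using Suc.IH \<open>i \<le> j\<close> Suc.prems skeleton_dist_triangle[OF qS[of i] qS[of j] qS[of "Suc j"]] by simp
      also have "\<dots> = real (Suc j - i) / 3 ^ m"
        using \<open>i \<le> j\<close> by (simp add: Suc_diff_le add_divide_distrib)
      finally show ?thesis .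
    qed
  qed
  \<comment> \<open>The upper bounds for the two parts of the chain add up to the distance of its
    ends, so they are equalities. This places the chain in \<open>A\<close> by convexity and makes
    its vertices distinct.\<close>
  have btw: "skeleton_dist u (q i) + skeleton_dist (q i) v = skeleton_dist u v"
      "skeleton_dist u (q i) = real i / 3 ^ m" if "i \<le> k" for i
  proof -
    have "skeleton_dist u (q i) \<le> real i / 3 ^ m" "skeleton_dist (q i) v \<le> real k / 3 ^ m - real i / 3 ^ m"
      using le[of 0 i] le[of i k] that q by (auto simp: of_nat_diff diff_divide_distrib)
    then show "skeleton_dist u (q i) + skeleton_dist (q i) v = skeleton_dist u v"
        "skeleton_dist u (q i) = real i / 3 ^ m"
      using skeleton_dist_triangle[OF uS(1) qS[OF that] uS(2)] k(2) by linarith+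
  qed
  have qA: "q i \<in> A" if "i \<le> k" for i
    using geodesically_convex_between[OF A _ _ qS[OF that] btw(1)[OF that]] uv uS by blast
  have qinj: "i = j" if "i \<le> k" "j \<le> k" "q i = q j" for i j
  proof -
    have "real i / 3 ^ m = skeleton_dist u (q i)" by (rule btw(2)[OF that(1), symmetric])
    also have "\<dots> = skeleton_dist u (q j)" by (simp only: that(3))
    also have "\<dots> = real j / 3 ^ m" by (rule btw(2)[OF that(2)])
    finally show ?thesis by simp
  qed
  let ?F = "\<lambda>(x, y). \<bar>f x - f y\<bar> powr p"
  let ?s = "\<Sum>i<k. \<bar>f (q i) - f (q (Suc i))\<bar> powr p"
  \<comment> \<open>Both orientations of the chain are collected, since the energy is half of a sum
    over ordered pairs.\<close>
  define E1 where "E1 = (\<lambda>i. (q i, q (Suc i))) ` {..<k}"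
  define E2 where "E2 = (\<lambda>i. (q (Suc i), q i)) ` {..<k}"
  have s1: "(\<Sum>e\<in>E1. ?F e) = ?s"
  proof -
    have "inj_on (\<lambda>i. (q i, q (Suc i))) {..<k}"
    proof (rule inj_onI)
      fix i j assume "i \<in> {..<k}" "j \<in> {..<k}" "(q i, q (Suc i)) = (q j, q (Suc j))"
      then show "i = j" using qinj[of i j] by simp
    qed
    then show ?thesis unfolding E1_def by (subst sum.reindex) (simp_all only: o_def prod.case)
  qed
  have s2: "(\<Sum>e\<in>E2. ?F e) = ?s"
  proof -
    have "inj_on (\<lambda>i. (q (Suc i), q i)) {..<k}"
    proof (rule inj_onI)
      fix i j assume "i \<in> {..<k}" "j \<in> {..<k}" "(q (Suc i), q i) = (q (Suc j), q j)"
      then show "i = j" using qinj[of i j] by simp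
    qed
    then show ?thesis unfolding E2_def
      by (subst sum.reindex) (simp_all only: o_def prod.case abs_minus_commute[of "f (q (Suc _))"])
  qed
  have "E1 \<inter> E2 = {}"
  proof -
    have False if "i < k" "j < k" "q i = q (Suc j)" "q (Suc i) = q j" for i j
      using qinj[of i "Suc j"] qinj[of "Suc i" j] that by simp
    then show ?thesis unfolding E1_def E2_def by blast
  qed
  then have "2 * ?s = (\<Sum>e\<in>E1 \<union> E2. ?F e)"
    using s1 s2 by (subst sum.union_disjoint) (auto simp: E1_def E2_def)
  also have "\<dots> \<le> (\<Sum>e\<in>vedges m A. ?F e)"
  proof (intro sum_mono2 finite_vedges)
    have "(q i, q (Suc i)) \<in> vedges m A" "(q (Suc i), q i) \<in> vedges m A" if "i < k" for i
      using that qA[of i] qA[of "Suc i"] qv[of i] qv[of "Suc i"] q(3)[of i] vadj_sym[OF q(3)[of i]]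
      by (simp_all add: vedges_def)
    then show "E1 \<union> E2 \<subseteq> vedges m A" unfolding E1_def E2_def by blast
  qed auto
  finally have s: "2 * ?s \<le> (\<Sum>e\<in>vedges m A. ?F e)" .
  have "f u - f v = (\<Sum>i<k. f (q i) - f (q (Suc i)))"
    using sum_lessThan_telescope'[of "\<lambda>i. f (q i)" k] q by simp
  then have "\<bar>f u - f v\<bar> \<le> (\<Sum>i<k. \<bar>f (q i) - f (q (Suc i))\<bar>)" by (simp only: sum_abs)
  then have "\<bar>f u - f v\<bar> powr p \<le> (\<Sum>i<k. \<bar>f (q i) - f (q (Suc i))\<bar>) powr p"
    using p by (intro powr_mono2) auto
  also have "\<dots> \<le> real (card {..<k}) powr (p - 1) * ?s"
    using p by (intro sum_powr_le) auto
  also have "\<dots> \<le> real k powr (p - 1) * (1/2 * (\<Sum>e\<in>vedges m A. ?F e))"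
    using s by (intro mult_mono) (auto intro: sum_nonneg)
  \<comment> \<open>As \<open>k\<close> is the distance times \<open>3 ^ m\<close>, the factor lost
    in the power mean inequality supplies the renormalization of the energy.\<close>
  also have "real k powr (p - 1) = skeleton_dist u v powr (p - 1) * 3 powr ((p - 1) * real m)"
  proof -
    have "(3::real) powr ((p - 1) * real m) = (3 ^ m) powr (p - 1)"
      by (simp add: powr_powr mult.commute flip: powr_realpow)
    then show ?thesis unfolding k(2) by (simp flip: powr_mult)
  qed
  finally show ?thesis unfolding venergy_m_eq by (simp add: mult_ac)
qed

text \<open>Vertices of high level on the geodesic from \<open>x\<close> to \<open>y\<close>
  approximate the ends, belong to \<open>A\<close> by convexity and are no further apart than the
  ends.\<close>

lemma skeleton_energy_bound:
  assumes A: "geodesically_convex A" and p: "1 \<le> p" and f: "continuous_on vicsek f"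
    and xy: "x \<in> A \<inter> vskeleton" "y \<in> A \<inter> vskeleton" and e: "venergy p A f = ereal e"
  shows "\<bar>f x - f y\<bar> powr p \<le> skeleton_dist x y powr (p - 1) * e"
proof (cases "x = y")
  case True
  have "0 \<le> e" using venergy_ge(2)[OF A p, of f] e by simp
  then show ?thesis using True by simp
next
  case False
  have S: "x \<in> vskeleton" "y \<in> vskeleton" using xy by auto
  have dp: "0 < skeleton_dist x y"
    using False skeleton_dist_pair(1)[OF S] zero_less_dist_iff[of x y] by linarith
  obtain n where n: "{x, y} \<subseteq> vcable n" using skeleton_common_level[of "{x, y}"] S by auto
  have l0: "(\<lambda>m. 1 / 3 ^ m :: real) \<longlonglongrightarrow> 0"
    using LIMSEQ_realpow_zero[of "1/3::real"] by (simp add: power_one_over)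
  \<comment> \<open>From these levels on, edges are shorter than the distance of \<open>x\<close>
    and \<open>y\<close>, as \<open>skeleton_vertices\<close> demands.\<close>
  then have "eventually (\<lambda>m. 1 / 3 ^ m < skeleton_dist x y) sequentially"
    using dp by (rule order_tendstoD)
  then obtain N0 where N0: "\<And>m. N0 \<le> m \<Longrightarrow> 1 / 3 ^ m < skeleton_dist x y"
    unfolding eventually_sequentially by blast
  define N where "N = max n N0"
  have "\<exists>u v. u \<in> A \<inter> vvert m \<and> v \<in> A \<inter> vvert m \<and> skeleton_dist u v \<le> skeleton_dist x y \<and>
      dist u x \<le> 1 / 3 ^ m \<and> dist v y \<le> 1 / 3 ^ m" if m: "N \<le> m" for m
  proof -
    have xym: "x \<in> vcable m" "y \<in> vcable m" using n vcable_mono[of n m] m by (auto simp: N_def)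
    have "1 / 3 ^ m < skeleton_dist x y" using N0 m by (simp add: N_def)
    from skeleton_vertices[OF xym this] obtain u v where u: "u \<in> vvert m" "v \<in> vvert m"
      "skeleton_dist x y = skeleton_dist x u + skeleton_dist u v + skeleton_dist v y"
      "skeleton_dist x u \<le> 1 / 3 ^ m" "skeleton_dist y v \<le> 1 / 3 ^ m" by blast
    have uS: "u \<in> vskeleton" "v \<in> vskeleton" using u vvert_subset_skeleton by auto
    note t = skeleton_dist_triangle[OF S(1) uS(1) S(2)] skeleton_dist_triangle[OF S(1) uS(2) S(2)]
      skeleton_dist_triangle[OF S(1) uS] skeleton_dist_triangle[OF uS S(2)]
    have "skeleton_dist x u + skeleton_dist u y = skeleton_dist x y"
        "skeleton_dist x v + skeleton_dist v y = skeleton_dist x y"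
      using t u(3) by linarith+
    then have "u \<in> A" "v \<in> A" using geodesically_convex_between[OF A xy] uS by auto
    moreover have "skeleton_dist u v \<le> skeleton_dist x y"
      using u(3) skeleton_dist_pair(4)[OF S(1) uS(1)] skeleton_dist_pair(4)[OF uS(2) S(2)] by linarith
    moreover have "dist u x \<le> 1 / 3 ^ m" "dist v y \<le> 1 / 3 ^ m"
      using u(4,5) skeleton_dist_pair(1)[OF S(1) uS(1)] skeleton_dist_pair(1)[OF S(2) uS(2)]
      by (auto simp: dist_commute)
    ultimately show ?thesis using u by blast
  qed
  then obtain u v where uv: "\<And>m. N \<le> m \<Longrightarrow> u m \<in> A \<inter> vvert m \<and> v m \<in> A \<inter> vvert m \<and>
      skeleton_dist (u m) (v m) \<le> skeleton_dist x y \<and> dist (u m) x \<le> 1 / 3 ^ m \<and> dist (v m) y \<le> 1 / 3 ^ m"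
    by metis
  have ev: "eventually (\<lambda>m. N \<le> m) sequentially" by (rule eventually_ge_at_top)
  have lim: "(\<lambda>m. f (u m)) \<longlonglongrightarrow> f x" "(\<lambda>m. f (v m)) \<longlonglongrightarrow> f y"
  proof -
    have "u \<longlonglongrightarrow> x" "v \<longlonglongrightarrow> y"
      by (intro metric_tendsto_imp_tendsto[OF l0] eventually_mono[OF ev]; use uv in \<open>simp add: dist_real_def\<close>)+
    moreover have "eventually (\<lambda>m. u m \<in> vicsek) sequentially" "eventually (\<lambda>m. v m \<in> vicsek) sequentially"
      using uv vvert_subset_skeleton skeleton_subset_vicsek by (intro eventually_mono[OF ev]; blast)+
    moreover have "x \<in> vicsek" "y \<in> vicsek" using S skeleton_subset_vicsek by auto
    ultimately show "(\<lambda>m. f (u m)) \<longlonglongrightarrow> f x" "(\<lambda>m. f (v m)) \<longlonglongrightarrow> f y"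
      using continuous_on_tendsto_compose[OF f] by blast+
  qed
  have "(\<lambda>m. \<bar>f (u m) - f (v m)\<bar> powr p) \<longlonglongrightarrow> \<bar>f x - f y\<bar> powr p"
    using p by (intro tendsto_powr' tendsto_intros lim) auto
  moreover have "\<bar>f (u m) - f (v m)\<bar> powr p \<le> skeleton_dist x y powr (p - 1) * e" if m: "N \<le> m" for m
  proof -
    have "venergy_m m p A f \<le> e" using venergy_ge(1)[OF A p, of m f] e by simp
    moreover have "skeleton_dist (u m) (v m) powr (p - 1) \<le> skeleton_dist x y powr (p - 1)"
      using uv[OF m] p skeleton_dist_pair(4)[of "u m" "v m"] vvert_subset_skeleton by (intro powr_mono2) auto
    ultimately have "skeleton_dist (u m) (v m) powr (p - 1) * venergy_m m p A f \<le> skeleton_dist x y powr (p - 1) * e"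
      using venergy_m_nonneg by (intro mult_mono) auto
    then show ?thesis using vertex_energy_bound[OF A p, of "u m" m "v m" f] uv[OF m] by linarith
  qed
  ultimately show ?thesis by (intro LIMSEQ_le_const2) blast+
qed

text \<open>The density of the skeleton in \<open>A\<close> enters here: points off the skeleton are
  limits of points of \<open>A\<close> to which \<open>skeleton_energy_bound\<close>
  applies.\<close>

lemma energy_oscillation:
  assumes A: "geodesically_convex A" "A \<subseteq> closure (A \<inter> vskeleton)" and p: "1 \<le> p"
    and f: "continuous_on vicsek f" and xy: "x \<in> A" "y \<in> A" and e: "venergy p A f = ereal e"
  shows "\<bar>f x - f y\<bar> powr p \<le> vdiam A powr (p - 1) * e"
proof -
  have AK: "A \<subseteq> vicsek" using A(1) by (simp add: geodesically_convex_def)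
  have e0: "0 \<le> e" using venergy_ge(2)[OF A(1) p, of f] e by simp
  have "x \<in> closure (A \<inter> vskeleton)" "y \<in> closure (A \<inter> vskeleton)" using A(2) xy by auto
  then obtain X Y where X: "\<And>n. X n \<in> A \<inter> vskeleton" "X \<longlonglongrightarrow> x"
      and Y: "\<And>n. Y n \<in> A \<inter> vskeleton" "Y \<longlonglongrightarrow> y"
    unfolding closure_sequential by metis
  have "(\<lambda>n. f (X n)) \<longlonglongrightarrow> f x" "(\<lambda>n. f (Y n)) \<longlonglongrightarrow> f y"
    using X Y AK xy by (auto intro!: continuous_on_tendsto_compose[OF f] always_eventually)
  then have "(\<lambda>n. \<bar>f (X n) - f (Y n)\<bar> powr p) \<longlonglongrightarrow> \<bar>f x - f y\<bar> powr p"
    using p by (intro tendsto_powr' tendsto_intros) auto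
  moreover have "\<bar>f (X n) - f (Y n)\<bar> powr p \<le> vdiam A powr (p - 1) * e" for n
  proof -
    have S: "X n \<in> vskeleton" "Y n \<in> vskeleton" using X Y by auto
    have "skeleton_dist (X n) (Y n) \<le> vdiam A"
      using vdist_le_vdiam[OF AK, of "X n" "Y n"] X(1)[of n] Y(1)[of n] by (simp add: vdist_extension(2))
    then have "skeleton_dist (X n) (Y n) powr (p - 1) * e \<le> vdiam A powr (p - 1) * e"
      using p e0 skeleton_dist_pair(4)[OF S] by (intro mult_right_mono powr_mono2) auto
    then show ?thesis
      using skeleton_energy_bound[OF A(1) p f X(1) Y(1) e, of n n] by linarith
  qed
  ultimately show ?thesis by (intro LIMSEQ_le_const2) blast+
qed

section \<open>From oscillation to the mean deviation\<close>

lemma (in finite_measure) average_deviation_le: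
  fixes f :: "'a \<Rightarrow> real"
  assumes A: "A \<in> sets M" "0 < measure M A" and f: "f \<in> borel_measurable M"
    and osc: "\<And>x y. x \<in> A \<Longrightarrow> y \<in> A \<Longrightarrow> \<bar>f x - f y\<bar> powr p \<le> B" and p: "1 \<le> p"
  shows "1 / measure M A * (LINT x:A|M. \<bar>f x - 1 / measure M A * (LINT y:A|M. f y)\<bar> powr p) \<le> B"
proof -
  define m where "m = measure M A"
  define a where "a = 1 / m * (LINT y:A|M. f y)"
  define b where "b = B powr (1 / p)"
  have m: "0 < m" using A by (simp add: m_def)
  then obtain x0 where x0: "x0 \<in> A" unfolding m_def by (metis measure_empty ex_in_conv less_irrefl)
  have B: "0 \<le> B" using osc[OF x0 x0] by (metis powr_ge_zero order_trans)
  have fb: "\<bar>f x - f y\<bar> \<le> b" if "x \<in> A" "y \<in> A" for x y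
  proof -
    have "(\<bar>f x - f y\<bar> powr p) powr (1 / p) \<le> b"
      unfolding b_def using osc[OF that] p by (intro powr_mono2) auto
    then show ?thesis using p by (simp add: powr_powr)
  qed
  have fin: "emeasure M A < \<infinity>" by (simp add: less_top[symmetric])
  have int: "set_integrable M A g" if "g \<in> borel_measurable M" "\<And>x. x \<in> A \<Longrightarrow> \<bar>g x\<bar> \<le> c" for g :: "'a \<Rightarrow> real" and c
    unfolding set_integrable_def
    using that A(1) order_trans[OF abs_ge_zero that(2)[OF x0]]
    by (intro integrable_const_bound[where B = c]) (auto simp: indicator_def)
  have fA: "\<bar>f x\<bar> \<le> \<bar>f x0\<bar> + b" if "x \<in> A" for x using fb[OF that x0] by linarith
  note intf = int[OF f fA]
  have const: "(LINT y:A|M. c) = m * c" for c :: real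
    using A fin by (simp add: set_lebesgue_integral_def m_def sets.Int_space_eq2)
  have intc: "set_integrable M A (\<lambda>_. c)" for c :: real using int[of "\<lambda>_. c" "\<bar>c\<bar>"] by simp
  \<comment> \<open>Integrating \<open>f x - b \<le> f y \<le> f x + b\<close> over \<open>y\<close>
    keeps the mean within \<open>b\<close> of every value of \<open>f\<close> on
    \<open>A\<close>.\<close>
  have dev: "\<bar>f x - a\<bar> \<le> b" if x: "x \<in> A" for x
  proof -
    have "(LINT y:A|M. f x - b) \<le> (LINT y:A|M. f y)"
    proof (rule set_integral_mono[OF intc intf])
      show "f x - b \<le> f y" if "y \<in> A" for y using fb[OF x that] by linarith
    qed
    moreover have "(LINT y:A|M. f y) \<le> (LINT y:A|M. f x + b)"
    proof (rule set_integral_mono[OF intf intc])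
      show "f y \<le> f x + b" if "y \<in> A" for y using fb[OF x that] by linarith
    qed
    ultimately have "f x - b \<le> a" "a \<le> f x + b"
      using m unfolding const a_def by (simp_all add: field_simps)
    then show ?thesis by (simp add: abs_le_iff)
  qed
  have dp: "\<bar>f x - a\<bar> powr p \<le> B" if "x \<in> A" for x
  proof -
    have "\<bar>f x - a\<bar> powr p \<le> b powr p" using dev[OF that] p by (intro powr_mono2) auto
    also have "b powr p = B" using p B by (simp add: b_def powr_powr)
    finally show ?thesis .
  qed
  have "(LINT x:A|M. \<bar>f x - a\<bar> powr p) \<le> (LINT x:A|M. B)"
    using f dp by (intro set_integral_mono intc int[where c = B]) auto
  then have "1 / m * (LINT x:A|M. \<bar>f x - a\<bar> powr p) \<le> B" using m unfolding const by (simp add: field_simps)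
  then show ?thesis by (simp add: a_def m_def)
qed

lemma closed_in_vicsek_measure:
  assumes "is_vicsek_measure M" "closed A" "A \<subseteq> vicsek"
  shows "A \<in> sets M"
  using assms compact_imp_closed[OF compact_vicsek]
  by (auto simp: is_vicsek_measure_def sets_restrict_space_iff)

lemma vicsek_poincare:
  assumes M: "is_vicsek_measure M" and p: "1 \<le> p" and f: "f \<in> vsobolev p"
    and A: "closed A" "geodesically_convex A" "A \<subseteq> closure (A \<inter> vskeleton)" "0 < measure M A"
  shows "ereal (1 / measure M A * (LINT x:A|M. \<bar>f x - vavg M A f\<bar> powr p))
           \<le> ereal (vdiam A powr (p - 1)) * venergy p A f"
proof -
  interpret prob_space M using M by (simp add: is_vicsek_measure_def)
  have AK: "A \<subseteq> vicsek" using A(2) by (simp add: geodesically_convex_def)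
  have fc: "continuous_on vicsek f" using f by (simp add: vsobolev_def)
  have fm: "f \<in> borel_measurable M"
    using borel_measurable_continuous_on_restrict[OF fc] M measurable_cong_sets
    unfolding is_vicsek_measure_def by blast
  note avg = average_deviation_le[OF closed_in_vicsek_measure[OF M A(1) AK] A(4) fm _ p]
  obtain x0 where x0: "x0 \<in> A" using A(4) by (metis measure_empty ex_in_conv less_irrefl)
  have d0: "0 \<le> vdiam A" using vdist_le_vdiam[OF AK x0 x0] vdist_self[of x0] AK x0 by auto
  show ?thesis
  proof (cases "venergy p A f")
    case (real e)
    have "1 / measure M A * (LINT x:A|M. \<bar>f x - vavg M A f\<bar> powr p) \<le> vdiam A powr (p - 1) * e"
      unfolding vavg_def using energy_oscillation[OF A(2,3) p fc _ _ real] by (intro avg)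
    then show ?thesis using real by simp
  next
    case PInf
    show ?thesis
    proof (cases "vdiam A = 0")
      \<comment> \<open>In the extended reals \<open>0 * \<infinity> = 0\<close>, and
        \<open>0 powr (p - 1) = 0\<close> even for \<open>p = 1\<close>, so the right-hand side is
        zero. The deviation vanishes too, because \<open>A\<close> is a single point.\<close>
      case True
      have "x = y" if "x \<in> A" "y \<in> A" for x y
      proof -
        have "dist x y \<le> vdist x y" using that AK by (intro vdist_bounds(1)) auto
        then have "dist x y \<le> 0" using vdist_le_vdiam[OF AK that] True by linarith
        then show ?thesis by simp
      qed
      then have "\<bar>f x - f y\<bar> powr p \<le> 0" if "x \<in> A" "y \<in> A" for x y using that by fastforce
      then have "1 / measure M A * (LINT x:A|M. \<bar>f x - vavg M A f\<bar> powr p) \<le> 0"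
        unfolding vavg_def by (intro avg)
      then show ?thesis using True by (simp add: zero_ereal_def[symmetric])
    next
      case False
      then show ?thesis using PInf d0 by simp
    qed
  next
    case MInf
    then show ?thesis using venergy_ge(2)[OF A(2) p, of f] by simp
  qed
qed

theorem corollary3p14:
  fixes \<mu> :: "(real \<times> real) measure" and p :: real
  assumes "is_vicsek_measure \<mu>" and "1 \<le> p"
  shows "(\<forall>A. closed A \<and> geodesically_convex A \<and> A \<subseteq> closure (A \<inter> vskeleton) \<and> measure \<mu> A > 0 \<longrightarrow>
            (\<forall>f\<in>vsobolev p.
               ereal (1 / measure \<mu> A * (LINT x:A|\<mu>. \<bar>f x - vavg \<mu> A f\<bar> powr p))
                 \<le> ereal (vdiam A powr (p - 1)) * venergy p A f)) \<and>
         (\<exists>C>0. \<forall>x\<^sub>0\<in>vicsek. \<forall>r>0. \<forall>f\<in>vsobolev p.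
            ereal (LINT x:vball x\<^sub>0 r|\<mu>. \<bar>f x - vavg \<mu> (vball x\<^sub>0 r) f\<bar> powr p)
              \<le> ereal (C * r powr (p * valpha p)) * venergy p (vball x\<^sub>0 r) f)"
proof (intro conjI allI impI ballI exI[of _ "125 * 2 powr (p - 1)"])
  fix A f
  assume "closed A \<and> geodesically_convex A \<and> A \<subseteq> closure (A \<inter> vskeleton) \<and> measure \<mu> A > 0" "f \<in> vsobolev p"
  then show "ereal (1 / measure \<mu> A * (LINT x:A|\<mu>. \<bar>f x - vavg \<mu> A f\<bar> powr p))
      \<le> ereal (vdiam A powr (p - 1)) * venergy p A f"
    using vicsek_poincare[OF assms] by blast
next
  fix z f and r :: real assume z: "z \<in> vicsek" and r: "0 < r" and f: "f \<in> vsobolev p"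
  interpret prob_space \<mu> using assms(1) by (simp add: is_vicsek_measure_def)
  define B where "B = vball z r"
  define I where "I = (LINT x:B|\<mu>. \<bar>f x - vavg \<mu> B f\<bar> powr p)"
  note conv = geodesically_convex_vball[OF z, of r, folded B_def]
  have BK: "B \<subseteq> vicsek" and Bs: "B \<in> sets \<mu>"
    using vball_subset closed_in_vicsek_measure[OF assms(1) closed_vball[OF z]] by (auto simp: B_def)
  have E: "0 \<le> venergy p B f" using venergy_ge(2)[OF conv assms(2)] .
  have "ereal I \<le> ereal (125 * 2 powr (p - 1) * r powr (p * valpha p)) * venergy p B f"
  proof (cases "measure \<mu> B = 0")
    \<comment> \<open>On a null ball the averaged inequality would divide by zero; the integral over
      it is zero directly.\<close>
    case True
    then have "B \<in> null_sets \<mu>" using Bs by (auto simp: null_sets_def emeasure_eq_measure)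
    then have "I = 0" unfolding I_def set_lebesgue_integral_def
      by (intro integral_eq_zero_AE) (auto dest!: AE_not_in elim!: eventually_mono)
    then show ?thesis using ereal_0_le_mult[OF _ E] by (simp add: zero_ereal_def[symmetric])
  next
    case False
    then have pos: "0 < measure \<mu> B" by (simp add: less_le)
    have P: "ereal (1 / measure \<mu> B * I) \<le> ereal (vdiam B powr (p - 1)) * venergy p B f"
      unfolding I_def using vicsek_poincare[OF assms f closed_vball[OF z] _ vball_dense[OF z r]] conv pos
      by (simp add: B_def)
    have "z \<in> B" using z r vdist_self[OF z] by (simp add: B_def vball_def)
    then have d: "0 \<le> vdiam B" "vdiam B \<le> 2 * r"
      using vdist_le_vdiam[OF BK, of z z] vdist_self[OF z] vdiam_vball_le[OF z r] by (auto simp: B_def)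
    have "measure \<mu> B \<le> 125 * r powr vdh"
    proof (rule vicsek_measure_small_le[OF assms(1) Bs BK _ r])
      fix y assume "y \<in> B"
      then show "dist z y \<le> r" using vdist_bounds(1)[OF z, of y] by (auto simp: B_def vball_def)
    qed
    \<comment> \<open>The constant is assembled here: 125 from the measure of the ball and
      \<open>2 powr (p - 1)\<close> from its diameter, while the exponents \<open>vdh\<close> and
      \<open>p - 1\<close> of \<open>r\<close> add up to \<open>p * valpha p\<close>.\<close>
    then have "measure \<mu> B * vdiam B powr (p - 1) \<le> (125 * r powr vdh) * (2 * r) powr (p - 1)"
      using d assms(2) by (intro mult_mono powr_mono2) auto
    also have "\<dots> = 125 * 2 powr (p - 1) * r powr (p * valpha p)"
    proof -
      have "p * valpha p = vdh + (p - 1)" using assms(2) by (simp add: valpha_def field_simps)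
      then show ?thesis using r by (simp add: powr_mult powr_add)
    qed
    finally have le: "measure \<mu> B * vdiam B powr (p - 1) \<le> 125 * 2 powr (p - 1) * r powr (p * valpha p)" .
    have "ereal I = ereal (measure \<mu> B) * ereal (1 / measure \<mu> B * I)" using pos by simp
    also have "\<dots> \<le> ereal (measure \<mu> B) * (ereal (vdiam B powr (p - 1)) * venergy p B f)"
      using pos by (intro ereal_mult_left_mono P) auto
    also have "\<dots> = ereal (measure \<mu> B * vdiam B powr (p - 1)) * venergy p B f"
      by (simp add: mult.assoc[symmetric])
    also have "\<dots> \<le> ereal (125 * 2 powr (p - 1) * r powr (p * valpha p)) * venergy p B f"
      using le E by (intro ereal_mult_right_mono) auto
    finally show ?thesis .
  qed
  then show "ereal (LINT x:vball z r|\<mu>. \<bar>f x - vavg \<mu> (vball z r) f\<bar> powr p)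
      \<le> ereal (125 * 2 powr (p - 1) * r powr (p * valpha p)) * venergy p (vball z r) f"
    unfolding I_def B_def .
qed simp

end
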